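(* (1) Let $1\to S\to\Delta\to G\to 1$ be an elliptic presentation of a finite group $G$, with $\Delta=\Delta(m_\ast)$ and $y_i\mapsto g_i$, and let $D=\Delta/[S,\Delta]$. Then the homomorphism $D\to G$ induces a covering projection between compact oriented surfaces, namely from the elliptic surface of $D$ associated to the images of $y_1,\dots,y_{d+1}$ in $D$ to the elliptic surface of $G$ associated to $(g_1,\dots,g_{d+1})$. (2) Every non-trivial finite group $G$ admits an elliptic cover, i.e. there is an elliptic presentation $1\to S\to\Delta\to G\to 1$ such that $1\to S/[S,\Delta]\to\Delta/[S,\Delta]\to G\to 1$ is a cover of $G$.
   Context: An elliptic generating system of a group $G$ is a sequence $g_\ast=(g_1,\dots,g_{d+1})$ generating $G$ with $g_1g_2\cdots g_{d+1}=1$ and $1<m_i=o(g_i)<\infty$ for all $i$; its signature is $m_\ast=(m_1,\dots,m_{d+1})$. For integers $m_i>1$, $\Delta(m_\ast)=\langle y_1,\dots,y_{d+1}\mid y_1^{m_1},\dots,y_{d+1}^{m_{d+1}},\,y_1y_2\cdots y_{d+1}\rangle$. If $G$ has an elliptic generating system $g_\ast$ of signature $m_\ast$ and $\Delta=\Delta(m_\ast)$, the extension $1\to S\to\Delta\to G\to1$, $y_i\mapsto g_i$, is an elliptic presentation of $G$, and $1\to S/[S,\Delta]\to\Delta/[S,\Delta]\to G\to1$ is an elliptic central extension of $G$. A cover of a finite group $G$ is a finite central extension $1\to A\to E\to G\to 1$ such that every projective representation $G\to\mathrm{PGL}_n(\mathbb C)$ lifts to an ordinary representation $E\to\mathrm{GL}_n(\mathbb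 C)$ (equivalently $[E,E]\cap A\simeq H^2(G,\mathbb C^\times)$ with trivial action). The elliptic surface of $G$ associated to an elliptic generating system $g_\ast$ is the oriented surface $Y$ given as a 2-dimensional complex (simplices glued along faces, a $\Delta$-complex) as follows, with $g\in G$, $i=1,\dots,d+1$ and the index $i$ of $\mathbf s_i$ read modulo $d+1$. Vertices: $g\mathbf v$, $g\mathbf o$, $g\mathbf c_i$, where $g\mathbf c_i=g'\mathbf c_i$ iff $g\langle g_i\rangle=g'\langle g_i\rangle$. Edges: $g\mathbf e_i=\langle g\mathbf v,gg_i\mathbf v\rangle$, $g\mathbf r_i=\langle g\mathbf v,g\mathbf c_i\rangle$, $g\mathbf s_i=\langle g\mathbf v,gg_i\cdots g_{d+1}\mathbf o\rangle$. Triangles: $g\mathbf f_i=\langle g\mathbf v,gg_i\mathbf v,g\mathbf c_i\rangle$ with faces $gg_i\mathbf r_i,g\mathbf r_i,g\mathbf e_i$, and $g\mathbf t_i=\langle g\mathbf v,gg_i\cdots g_{d+1}\mathbf o,gg_i\mathbf v\rangle$ with faces $gg_i\mathbf s_{i+1},g\mathbf s_i,g\mathbf e_i$. Apart from the $\mathbf c_i$, distinct $g\in G$ give distinct simplices. For a surjection $\pi:H\to G$ carrying an elliptic generating system $h_\ast$ of $H$ to one $g_\ast=\pi(h_\ast)$ of $G$, the induced map of the associated surfaces $W\to Y$ is $p(h\sigma)=\pi(h)\sigma$ for every generating simplex $\sigma\in\{\mathbf v,\mathbf o,\mathbf c_i,\mathbf e_i,\mathbf r_i,\mathbf s_i,\mathbf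 f_i,\mathbf t_i\}$. *)

theory Defs
  imports
    "HOL-Analysis.Abstract_Topological_Spaces"
    "HOL-Analysis.Sum_Topology"
    "HOL-Homology.Homology"
    "HOL-Algebra.Multiplicative_Group"
    "HOL-Algebra.Generated_Groups"
    "Jordan_Normal_Form.Matrix"
begin

section \<open>Groups given by generators and relators\<close>

text \<open>The letter \<open>(x, True)\<close> stands for \<open>x\<close> and \<open>(x, False)\<close> for its inverse.
  \<open>word_equiv X R\<close> is the congruence on words over \<open>X\<close> generated by free cancellation and by
  setting the relators in \<open>R\<close> (words over \<open>X\<close>) equal to the empty word.\<close>

inductive word_equiv ::
  "'x set \<Rightarrow> ('x \<times> bool) list set \<Rightarrow> ('x \<times> bool) list \<Rightarrow> ('x \<times> bool) list \<Rightarrow> bool"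
  for X R where
  refl: "w \<in> lists (X \<times> UNIV) \<Longrightarrow> word_equiv X R w w"
| sym: "word_equiv X R u v \<Longrightarrow> word_equiv X R v u"
| trans: "word_equiv X R u v \<Longrightarrow> word_equiv X R v w \<Longrightarrow> word_equiv X R u w"
| cong: "word_equiv X R u v \<Longrightarrow> a \<in> lists (X \<times> UNIV) \<Longrightarrow> b \<in> lists (X \<times> UNIV)
    \<Longrightarrow> word_equiv X R (a @ u @ b) (a @ v @ b)"
| cancel: "x \<in> X \<Longrightarrow> word_equiv X R [(x, s), (x, \<not> s)] []"
| relator: "r \<in> R \<Longrightarrow> r \<in> lists (X \<times> UNIV) \<Longrightarrow> word_equiv X R r []"

definition word_rel ::
  "'x set \<Rightarrow> ('x \<times> bool) list set \<Rightarrow> (('x \<times> bool) list \<times> ('x \<times> bool) list) set" where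
  "word_rel X R = {(u, v). word_equiv X R u v}"

definition presented_group ::
  "'x set \<Rightarrow> ('x \<times> bool) list set \<Rightarrow> ('x \<times> bool) list set monoid" where
  "presented_group X R =
    \<lparr>carrier = lists (X \<times> UNIV) // word_rel X R,
     monoid.mult = (\<lambda>A B. \<Union>a\<in>A. \<Union>b\<in>B. word_rel X R `` {a @ b}),
     one = word_rel X R `` {[]}\<rparr>"

definition presented_gen :: "'x set \<Rightarrow> ('x \<times> bool) list set \<Rightarrow> 'x \<Rightarrow> ('x \<times> bool) list set" where
  "presented_gen X R x = word_rel X R `` {[(x, True)]}"


section \<open>Elliptic generating systems and elliptic presentations\<close>

text \<open>Sequences indexed by \<open>1, \<dots>, d + 1\<close> are non-empty lists, indexed from \<open>0\<close>.\<close>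

definition list_mult :: "('a, 'b) monoid_scheme \<Rightarrow> 'a list \<Rightarrow> 'a" where
  "list_mult G xs = foldr (\<lambda>x y. x \<otimes>\<^bsub>G\<^esub> y) xs \<one>\<^bsub>G\<^esub>"

text \<open>\<open>group.ord G g\<close> is \<open>0\<close> for elements of infinite order, so \<open>1 < group.ord G g\<close> also says that
  the order of \<open>g\<close> is finite.\<close>

definition elliptic_system :: "('a, 'b) monoid_scheme \<Rightarrow> 'a list \<Rightarrow> bool" where
  "elliptic_system G gs \<longleftrightarrow>
     gs \<noteq> [] \<and> set gs \<subseteq> carrier G \<and> generate G (set gs) = carrier G \<and>
     list_mult G gs = \<one>\<^bsub>G\<^esub> \<and> (\<forall>g\<in>set gs. 1 < group.ord G g)"

definition signature :: "('a, 'b) monoid_scheme \<Rightarrow> 'a list \<Rightarrow> nat list" where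
  "signature G gs = map (group.ord G) gs"

definition Delta_relators :: "nat list \<Rightarrow> (nat \<times> bool) list set" where
  "Delta_relators ms =
     insert (map (\<lambda>i. (i, True)) [0..<length ms])
       {replicate (ms ! i) (i, True) | i. i < length ms}"

definition Delta :: "nat list \<Rightarrow> (nat \<times> bool) list set monoid" where
  "Delta ms = presented_group {..<length ms} (Delta_relators ms)"

definition Delta_gen :: "nat list \<Rightarrow> nat \<Rightarrow> (nat \<times> bool) list set" where
  "Delta_gen ms i = presented_gen {..<length ms} (Delta_relators ms) i"

text \<open>\<open>\<phi>\<close> is the projection of the extension; the subgroup denoted \<open>S\<close> below is its kernel.\<close>

definition elliptic_presentation ::
  "('a, 'b) monoid_scheme \<Rightarrow> 'a list \<Rightarrow> ((nat \<times> bool) list set \<Rightarrow> 'a) \<Rightarrow> bool" where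
  "elliptic_presentation G gs \<phi> \<longleftrightarrow>
     elliptic_system G gs \<and> \<phi> \<in> hom (Delta (signature G gs)) G \<and>
     (\<forall>i<length gs. \<phi> (Delta_gen (signature G gs) i) = gs ! i)"

definition commutator_subgroup :: "('a, 'b) monoid_scheme \<Rightarrow> 'a set \<Rightarrow> 'a set \<Rightarrow> 'a set" where
  "commutator_subgroup G H K =
     generate G {h \<otimes>\<^bsub>G\<^esub> k \<otimes>\<^bsub>G\<^esub> inv\<^bsub>G\<^esub> h \<otimes>\<^bsub>G\<^esub> inv\<^bsub>G\<^esub> k | h k. h \<in> H \<and> k \<in> K}"

text \<open>For \<open>S = kernel \<Delta> G \<phi>\<close>, the following are \<open>[S, \<Delta>]\<close>, the group \<open>\<Delta>/[S, \<Delta>]\<close>, its subgroup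
  \<open>S/[S, \<Delta>]\<close>, the homomorphism \<open>\<Delta>/[S, \<Delta>] \<rightarrow> G\<close>, and the images of the generators of \<open>\<Delta>\<close>
  in \<open>\<Delta>/[S, \<Delta>]\<close>.\<close>

definition elliptic_commutator ::
  "('a, 'b) monoid_scheme \<Rightarrow> 'a list \<Rightarrow> ((nat \<times> bool) list set \<Rightarrow> 'a) \<Rightarrow> (nat \<times> bool) list set set"
  where
  "elliptic_commutator G gs \<phi> =
     (let \<Delta> = Delta (signature G gs) in commutator_subgroup \<Delta> (kernel \<Delta> G \<phi>) (carrier \<Delta>))"

definition elliptic_central ::
  "('a, 'b) monoid_scheme \<Rightarrow> 'a list \<Rightarrow> ((nat \<times> bool) list set \<Rightarrow> 'a)
    \<Rightarrow> (nat \<times> bool) list set set monoid" where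
  "elliptic_central G gs \<phi> = Delta (signature G gs) Mod elliptic_commutator G gs \<phi>"

definition elliptic_central_kernel ::
  "('a, 'b) monoid_scheme \<Rightarrow> 'a list \<Rightarrow> ((nat \<times> bool) list set \<Rightarrow> 'a)
    \<Rightarrow> (nat \<times> bool) list set set set" where
  "elliptic_central_kernel G gs \<phi> =
     (let \<Delta> = Delta (signature G gs) in
       (\<lambda>s. elliptic_commutator G gs \<phi> #>\<^bsub>\<Delta>\<^esub> s) ` kernel \<Delta> G \<phi>)"

definition elliptic_central_proj ::
  "((nat \<times> bool) list set \<Rightarrow> 'a) \<Rightarrow> (nat \<times> bool) list set set \<Rightarrow> 'a" where
  "elliptic_central_proj \<phi> = (\<lambda>A. the_elem (\<phi> ` A))"

definition elliptic_central_system ::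
  "('a, 'b) monoid_scheme \<Rightarrow> 'a list \<Rightarrow> ((nat \<times> bool) list set \<Rightarrow> 'a)
    \<Rightarrow> (nat \<times> bool) list set set list" where
  "elliptic_central_system G gs \<phi> =
     (let ms = signature G gs in
       map (\<lambda>i. elliptic_commutator G gs \<phi> #>\<^bsub>Delta ms\<^esub> Delta_gen ms i) [0..<length gs])"


section \<open>Covers of finite groups\<close>

definition GL :: "nat \<Rightarrow> complex mat monoid" where
  "GL n = units_of (ring_mat TYPE(complex) n ())"

definition scalar_mats :: "nat \<Rightarrow> complex mat set" where
  "scalar_mats n = {c \<cdot>\<^sub>m 1\<^sub>m n | c. c \<noteq> 0}"

definition PGL :: "nat \<Rightarrow> complex mat set monoid" where
  "PGL n = GL n Mod scalar_mats n"

definition central_extension ::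
  "'e set \<Rightarrow> ('e, 'f) monoid_scheme \<Rightarrow> ('a, 'b) monoid_scheme \<Rightarrow> ('e \<Rightarrow> 'a) \<Rightarrow> bool" where
  "central_extension A E G \<pi> \<longleftrightarrow>
     group E \<and> group G \<and> \<pi> \<in> hom E G \<and> \<pi> ` carrier E = carrier G \<and> kernel E G \<pi> = A \<and>
     (\<forall>a\<in>A. \<forall>x\<in>carrier E. a \<otimes>\<^bsub>E\<^esub> x = x \<otimes>\<^bsub>E\<^esub> a)"

definition group_cover ::
  "'e set \<Rightarrow> ('e, 'f) monoid_scheme \<Rightarrow> ('a, 'b) monoid_scheme \<Rightarrow> ('e \<Rightarrow> 'a) \<Rightarrow> bool" where
  "group_cover A E G \<pi> \<longleftrightarrow>
     central_extension A E G \<pi> \<and> finite (carrier E) \<and>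
     (\<forall>n>0. \<forall>\<rho> \<in> hom G (PGL n).
        \<exists>\<sigma> \<in> hom E (GL n). \<forall>x\<in>carrier E. scalar_mats n #>\<^bsub>GL n\<^esub> \<sigma> x = \<rho> (\<pi> x))"


section \<open>Delta-complexes and their geometric realization\<close>

text \<open>\<open>cells X n\<close> is the set of \<open>n\<close>-simplices, and \<open>face X k \<sigma>\<close> is the face of the ordered simplex
  \<open>\<sigma>\<close> opposite to its vertex number \<open>k\<close>.\<close>

record 'c dcomplex =
  cells :: "nat \<Rightarrow> 'c set"
  face :: "nat \<Rightarrow> 'c \<Rightarrow> 'c"

definition delta_complex :: "'c dcomplex \<Rightarrow> bool" where
  "delta_complex X \<longleftrightarrow>
     (\<forall>n. \<forall>\<sigma>\<in>cells X (Suc n). \<forall>k\<le>Suc n. face X k \<sigma> \<in> cells X n) \<and>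
     (\<forall>n. \<forall>\<sigma>\<in>cells X (Suc (Suc n)). \<forall>k l. k < l \<and> l \<le> Suc (Suc n) \<longrightarrow>
        face X k (face X l \<sigma>) = face X (l - 1) (face X k \<sigma>))"

definition simplicial :: "'c dcomplex \<Rightarrow> 'd dcomplex \<Rightarrow> ('c \<Rightarrow> 'd) \<Rightarrow> bool" where
  "simplicial X Y f \<longleftrightarrow>
     (\<forall>n. f ` cells X n \<subseteq> cells Y n) \<and>
     (\<forall>n. \<forall>\<sigma>\<in>cells X (Suc n). \<forall>k\<le>Suc n. face Y k (f \<sigma>) = f (face X k \<sigma>))"

text \<open>The disjoint union of the standard simplices; the point with barycentric coordinates \<open>t\<close> in the
  simplex of \<open>\<sigma> \<in> cells X n\<close> is \<open>((n, \<sigma>), t)\<close>.\<close>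

type_synonym 'c dpoint = "(nat \<times> 'c) \<times> (nat \<Rightarrow> real)"

definition simplex_sum :: "'c dcomplex \<Rightarrow> 'c dpoint topology" where
  "simplex_sum X =
     sum_topology (\<lambda>(n, \<sigma>). subtopology (powertop_real UNIV) (standard_simplex n))
       (SIGMA n:UNIV. cells X n)"

definition face_rel :: "'c dcomplex \<Rightarrow> 'c dpoint rel" where
  "face_rel X =
     {(((n, face X k \<sigma>), t), ((Suc n, \<sigma>), simplical_face k t)) | n k \<sigma> t.
        \<sigma> \<in> cells X (Suc n) \<and> k \<le> Suc n \<and> t \<in> standard_simplex n}"

definition glue :: "'c dcomplex \<Rightarrow> 'c dpoint rel" where
  "glue X = Restr ((face_rel X \<union> (face_rel X)\<inverse>)\<^sup>*) (topspace (simplex_sum X))"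

definition quotient_topology :: "'p topology \<Rightarrow> 'p rel \<Rightarrow> 'p set topology" where
  "quotient_topology X r =
     topology (\<lambda>U. U \<subseteq> topspace X // r \<and> openin X {x \<in> topspace X. r `` {x} \<in> U})"

lemma openin_quotient_topology:
  "openin (quotient_topology X r) U \<longleftrightarrow>
     U \<subseteq> topspace X // r \<and> openin X {x \<in> topspace X. r `` {x} \<in> U}"
proof -
  have "istopology (\<lambda>U. U \<subseteq> topspace X // r \<and> openin X {x \<in> topspace X. r `` {x} \<in> U})"
    unfolding istopology_def
  proof (intro conjI allI impI)
    fix S T
    assume S: "S \<subseteq> topspace X // r \<and> openin X {x \<in> topspace X. r `` {x} \<in> S}"
      and T: "T \<subseteq> topspace X // r \<and> openin X {x \<in> topspace X. r `` {x} \<in> T}"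
    then show "S \<inter> T \<subseteq> topspace X // r" by blast
    have "{x \<in> topspace X. r `` {x} \<in> S \<inter> T} =
        {x \<in> topspace X. r `` {x} \<in> S} \<inter> {x \<in> topspace X. r `` {x} \<in> T}"
      by blast
    then show "openin X {x \<in> topspace X. r `` {x} \<in> S \<inter> T}"
      using S T by (simp only: openin_Int)
  next
    fix \<K>
    assume K: "\<forall>K\<in>\<K>. K \<subseteq> topspace X // r \<and> openin X {x \<in> topspace X. r `` {x} \<in> K}"
    then show "\<Union>\<K> \<subseteq> topspace X // r" by blast
    have "{x \<in> topspace X. r `` {x} \<in> \<Union>\<K>} =
        \<Union>((\<lambda>K. {x \<in> topspace X. r `` {x} \<in> K}) ` \<K>)"
      by blast
    moreover have "openin X (\<Union>((\<lambda>K. {x \<in> topspace X. r `` {x} \<in> K}) ` \<K>))"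
      using K by (intro openin_Union) blast
    ultimately show "openin X {x \<in> topspace X. r `` {x} \<in> \<Union>\<K>}"
      by simp
  qed
  then show ?thesis
    unfolding quotient_topology_def by (simp add: topology_inverse')
qed

definition realization :: "'c dcomplex \<Rightarrow> 'c dpoint set topology" where
  "realization X = quotient_topology (simplex_sum X) (glue X)"

definition realization_map :: "'d dcomplex \<Rightarrow> ('c \<Rightarrow> 'd) \<Rightarrow> 'c dpoint set \<Rightarrow> 'd dpoint set" where
  "realization_map Y f = (\<lambda>P. \<Union>((n, \<sigma>), t)\<in>P. glue Y `` {((n, f \<sigma>), t)})"


section \<open>Covering projections and oriented surfaces\<close>

definition covering_projection :: "'p topology \<Rightarrow> 'q topology \<Rightarrow> ('p \<Rightarrow> 'q) \<Rightarrow> bool" where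
  "covering_projection X Y p \<longleftrightarrow>
     continuous_map X Y p \<and> p ` topspace X = topspace Y \<and>
     (\<forall>y\<in>topspace Y. \<exists>U. openin Y U \<and> y \<in> U \<and>
        (\<exists>\<V>. \<Union>\<V> = {x \<in> topspace X. p x \<in> U} \<and> (\<forall>V\<in>\<V>. openin X V) \<and> disjoint \<V> \<and>
             (\<forall>V\<in>\<V>. homeomorphic_map (subtopology X V) (subtopology Y U) p)))"

definition surface :: "'p topology \<Rightarrow> bool" where
  "surface X \<longleftrightarrow>
     Hausdorff_space X \<and> second_countable X \<and> connected_space X \<and> topspace X \<noteq> {} \<and>
     (\<forall>x\<in>topspace X. \<exists>U (V :: (real \<times> real) set). openin X U \<and> x \<in> U \<and> open V \<and>
        subtopology X U homeomorphic_space top_of_set V)"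

text \<open>An orientation is given by a sign for every triangle, \<open>1\<close> meaning the orientation defined by
  the order of its vertices and \<open>- 1\<close> the opposite one. Each edge has to be a side of exactly
  two triangles (or twice a side of the same one), which induce opposite orientations on it.\<close>

definition sides :: "'c dcomplex \<Rightarrow> 'c \<Rightarrow> ('c \<times> nat) set" where
  "sides X e = {(\<tau>, k). \<tau> \<in> cells X 2 \<and> k \<le> 2 \<and> face X k \<tau> = e}"

definition orientation :: "'c dcomplex \<Rightarrow> ('c \<Rightarrow> int) \<Rightarrow> bool" where
  "orientation X \<epsilon> \<longleftrightarrow>
     (\<forall>\<tau>\<in>cells X 2. \<epsilon> \<tau> = 1 \<or> \<epsilon> \<tau> = - 1) \<and>
     (\<forall>e\<in>cells X 1. \<exists>\<tau> k \<tau>' k'. (\<tau>, k) \<noteq> (\<tau>', k') \<and> sides X e = {(\<tau>, k), (\<tau>', k')} \<and>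
        \<epsilon> \<tau> * (- 1) ^ k = - (\<epsilon> \<tau>' * (- 1) ^ k'))"

definition compact_oriented_surface :: "'c dcomplex \<Rightarrow> ('c \<Rightarrow> int) \<Rightarrow> bool" where
  "compact_oriented_surface X \<epsilon> \<longleftrightarrow>
     delta_complex X \<and> (\<forall>n>2. cells X n = {}) \<and> orientation X \<epsilon> \<and>
     compact_space (realization X) \<and> surface (realization X)"


section \<open>Elliptic surfaces\<close>

text \<open>\<open>V0 g\<close> is the simplex written \<open>g\<close>\<^bold>\<open>v\<close>, and so on; the subscript is the dimension. The vertex
  \<open>g\<close>\<^bold>\<open>c\<close>\<open>\<^sub>i\<close> is \<open>C0 i (g\<langle>g\<^sub>i\<rangle>)\<close>, with the coset as an argument.\<close>

datatype 'a esimplex =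
    V0 'a | O0 'a | C0 nat "'a set"
  | E1 nat 'a | R1 nat 'a | S1 nat 'a
  | F2 nat 'a | T2 nat 'a

text \<open>The triangle \<open>g\<close>\<^bold>\<open>t\<close>\<open>\<^sub>i = \<langle>g\<close>\<^bold>\<open>v\<close>\<open>, gg\<^sub>i\<dots>g\<^sub>d\<^sub>+\<^sub>1\<close>\<^bold>\<open>o\<close>\<open>, gg\<^sub>i\<close>\<^bold>\<open>v\<close>\<open>\<rangle>\<close> is written here with its last two
  vertices exchanged, so that its vertices are ordered compatibly with the order of the vertices of
  its edges \<open>gg\<^sub>i\<close>\<^bold>\<open>s\<close>\<open>\<^sub>i\<^sub>+\<^sub>1, g\<close>\<^bold>\<open>s\<close>\<open>\<^sub>i, g\<close>\<^bold>\<open>e\<close>\<open>\<^sub>i\<close>. The exchange is made up for by the sign in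
  \<open>elliptic_orientation\<close>.\<close>

fun elliptic_face ::
  "('a, 'b) monoid_scheme \<Rightarrow> 'a list \<Rightarrow> nat \<Rightarrow> 'a esimplex \<Rightarrow> 'a esimplex" where
  "elliptic_face G gs k (E1 i g) = (if k = 0 then V0 (g \<otimes>\<^bsub>G\<^esub> gs ! i) else V0 g)"
| "elliptic_face G gs k (R1 i g) = (if k = 0 then C0 i (g <#\<^bsub>G\<^esub> generate G {gs ! i}) else V0 g)"
| "elliptic_face G gs k (S1 i g) =
     (if k = 0 then O0 (g \<otimes>\<^bsub>G\<^esub> list_mult G (drop i gs)) else V0 g)"
| "elliptic_face G gs k (F2 i g) =
     (if k = 0 then R1 i (g \<otimes>\<^bsub>G\<^esub> gs ! i) else if k = 1 then R1 i g else E1 i g)"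
| "elliptic_face G gs k (T2 i g) =
     (if k = 0 then S1 (Suc i mod length gs) (g \<otimes>\<^bsub>G\<^esub> gs ! i)
      else if k = 1 then S1 i g else E1 i g)"
| "elliptic_face G gs k (V0 g) = V0 g"
| "elliptic_face G gs k (O0 g) = O0 g"
| "elliptic_face G gs k (C0 i A) = C0 i A"

definition elliptic_cells ::
  "('a, 'b) monoid_scheme \<Rightarrow> 'a list \<Rightarrow> nat \<Rightarrow> 'a esimplex set" where
  "elliptic_cells G gs n =
     (let I = {..<length gs} in
      if n = 0 then
        {V0 g | g. g \<in> carrier G} \<union> {O0 g | g. g \<in> carrier G} \<union>
        {C0 i (g <#\<^bsub>G\<^esub> generate G {gs ! i}) | i g. i \<in> I \<and> g \<in> carrier G}
      else if n = 1 then
        {E1 i g | i g. i \<in> I \<and> g \<in> carrier G} \<union> {R1 i g | i g. i \<in> I \<and> g \<in> carrier G} \<union>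
        {S1 i g | i g. i \<in> I \<and> g \<in> carrier G}
      else if n = 2 then
        {F2 i g | i g. i \<in> I \<and> g \<in> carrier G} \<union> {T2 i g | i g. i \<in> I \<and> g \<in> carrier G}
      else {})"

definition elliptic_surface :: "('a, 'b) monoid_scheme \<Rightarrow> 'a list \<Rightarrow> 'a esimplex dcomplex" where
  "elliptic_surface G gs = \<lparr>cells = elliptic_cells G gs, face = elliptic_face G gs\<rparr>"

definition elliptic_orientation :: "'a esimplex \<Rightarrow> int" where
  "elliptic_orientation \<tau> = (case \<tau> of T2 i g \<Rightarrow> - 1 | _ \<Rightarrow> 1)"

text \<open>The map \<open>h\<sigma> \<mapsto> \<pi>(h)\<sigma>\<close>. If \<open>\<pi>(h\<^sub>i) = g\<^sub>i\<close> then \<open>\<pi>\<close> maps the coset \<open>h\<langle>h\<^sub>i\<rangle>\<close> onto \<open>\<pi>(h)\<langle>g\<^sub>i\<rangle>\<close>.\<close>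

fun elliptic_map :: "('h \<Rightarrow> 'g) \<Rightarrow> 'h esimplex \<Rightarrow> 'g esimplex" where
  "elliptic_map \<pi> (V0 h) = V0 (\<pi> h)"
| "elliptic_map \<pi> (O0 h) = O0 (\<pi> h)"
| "elliptic_map \<pi> (C0 i A) = C0 i (\<pi> ` A)"
| "elliptic_map \<pi> (E1 i h) = E1 i (\<pi> h)"
| "elliptic_map \<pi> (R1 i h) = R1 i (\<pi> h)"
| "elliptic_map \<pi> (S1 i h) = S1 i (\<pi> h)"
| "elliptic_map \<pi> (F2 i h) = F2 i (\<pi> h)"
| "elliptic_map \<pi> (T2 i h) = T2 i (\<pi> h)"

end

theory Submission
  imports Defs "HOL-Analysis.Complex_Transcendental"
begin

text \<open>
  Why the group \<open>D = \<Delta>/[S, \<Delta>]\<close> is finite: it is a central extension of the finite group \<open>G\<close>, so an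
  element of \<open>D\<close> has at most \<open>|G|\<close> conjugates, and \<open>D\<close> is generated by the finitely many conjugates of
  the images of the \<open>y\<^sub>i\<close>, which have finite order. Dietzmann's lemma (\<open>Dietzmann\<close>) says that a finite
  conjugation invariant set of elements of finite order generates a finite group.

  Why an elliptic surface is a closed surface (\<open>closed_surface\<close>): every point lies in the open star of
  a vertex, and around each vertex the triangles follow each other in one cycle (\<open>vertex_cycle\<close>), so
  polar coordinates identify the open star with an open disc. The polar coordinates, multiplied by the
  barycentric coordinate at the vertex, extend by zero to continuous functions on the whole compact
  realization; these functions separate points, which gives the Hausdorff property, and
  a continuous map from a compact space to a Hausdorff space is closed, which makes the
  charts homeomorphisms (\<open>chart_homeomorphic_map\<close>). The cycle has \<open>4(d + 1)\<close> triangles around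
  \<open>g\<close>\<^bold>\<open>v\<close>, \<open>d + 1\<close> around \<open>g\<close>\<^bold>\<open>o\<close> and \<open>m\<^sub>i\<close> around \<open>g\<close>\<^bold>\<open>c\<close>\<open>\<^sub>i\<close> (\<open>v_cycle\<close>, \<open>o_cycle\<close>, \<open>c_cycle\<close>).
  The surface is connected because the \<open>g\<^sub>i\<close> generate \<open>G\<close>.

  Why the map of surfaces is a covering: the relation \<open>y\<^sub>i\<^bsup>m\<^sub>i\<^esup> = 1\<close> forces the image of \<open>y\<^sub>i\<close> in \<open>D\<close> to have
  the same order \<open>m\<^sub>i\<close> as \<open>g\<^sub>i\<close> (\<open>ord_ds\<close>). So the cycle of triangles around each vertex is carried
  bijectively onto the cycle around its image, and the map is the identity in polar coordinates;
  open stars of different vertices over the same vertex are disjoint (\<open>covering_projectionI\<close>).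

  Why every non-trivial finite group has an elliptic cover: take for the elliptic generating system the
  list \<open>(g, g\<inverse>, h, h\<inverse>, \<dots>)\<close> of all non-trivial elements with their inverses. Given a projective
  representation, choose over each \<open>g\<close> in this list a matrix of the same order, which is possible because complex
  numbers have roots, and over the adjacent \<open>g\<inverse>\<close> the inverse matrix. The product of the chosen
  matrices is then exactly \<open>1\<close>, so they define a representation of \<open>\<Delta>\<close>. It sends \<open>S\<close> to scalar
  matrices, hence kills \<open>[S, \<Delta>]\<close>, and descends to \<open>D\<close>.
\<close>

section \<open>Presented groups and their universal property\<close>

abbreviation word_class :: "'x set \<Rightarrow> ('x \<times> bool) list set \<Rightarrow> ('x \<times> bool) list \<Rightarrow> ('x \<times> bool) list set"
  where "word_class X R w \<equiv> word_rel X R `` {w}"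

lemma word_equiv_in_lists:
  "word_equiv X R u v \<Longrightarrow> u \<in> lists (X \<times> UNIV) \<and> v \<in> lists (X \<times> UNIV)"
  by (induction rule: word_equiv.induct) auto

lemma equiv_word_rel: "equiv (lists (X \<times> UNIV)) (word_rel X R)"
proof (rule equivI)
  show "word_rel X R \<subseteq> lists (X \<times> UNIV) \<times> lists (X \<times> UNIV)"
    using word_equiv_in_lists by (fastforce simp: word_rel_def)
  show "refl_on (lists (X \<times> UNIV)) (word_rel X R)"
    by (auto simp: refl_on_def word_rel_def intro: word_equiv.refl)
  show "sym (word_rel X R)"
    by (auto simp: sym_def word_rel_def intro: word_equiv.sym)
  show "trans (word_rel X R)"
    by (auto simp: trans_def word_rel_def intro: word_equiv.trans)
qed

lemma word_class_eq_iff: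
  assumes "u \<in> lists (X \<times> UNIV)" "v \<in> lists (X \<times> UNIV)"
  shows "word_class X R u = word_class X R v \<longleftrightarrow> word_equiv X R u v"
  using eq_equiv_class_iff[OF equiv_word_rel assms] by (simp add: word_rel_def)

lemma word_equiv_append:
  assumes "word_equiv X R u u'" "word_equiv X R v v'"
  shows "word_equiv X R (u @ v) (u' @ v')"
proof -
  have w: "u' \<in> lists (X \<times> UNIV)" "v \<in> lists (X \<times> UNIV)"
    using assms word_equiv_in_lists by blast+
  have "word_equiv X R ([] @ u @ v) ([] @ u' @ v)"
    by (rule word_equiv.cong[OF assms(1)]) (use w in auto)
  moreover have "word_equiv X R (u' @ v @ []) (u' @ v' @ [])"
    by (rule word_equiv.cong[OF assms(2)]) (use w in auto)
  ultimately show ?thesis by (auto intro: word_equiv.trans)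
qed

lemma presented_group_carrier:
  "carrier (presented_group X R) = {word_class X R w | w. w \<in> lists (X \<times> UNIV)}"
  by (auto simp: presented_group_def quotient_def)

lemma word_class_closed:
  "w \<in> lists (X \<times> UNIV) \<Longrightarrow> word_class X R w \<in> carrier (presented_group X R)"
  unfolding presented_group_carrier by blast

lemma presented_group_mult:
  assumes "u \<in> lists (X \<times> UNIV)" "v \<in> lists (X \<times> UNIV)"
  shows "word_class X R u \<otimes>\<^bsub>presented_group X R\<^esub> word_class X R v = word_class X R (u @ v)"
proof -
  have "congruent2 (word_rel X R) (word_rel X R) (\<lambda>a b. word_class X R (a @ b))"
  proof (rule congruent2I')
    fix y1 z1 y2 z2 assume "(y1, z1) \<in> word_rel X R" "(y2, z2) \<in> word_rel X R"
    then have e: "word_equiv X R (y1 @ y2) (z1 @ z2)"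
      by (simp add: word_rel_def word_equiv_append)
    show "word_class X R (y1 @ y2) = word_class X R (z1 @ z2)"
      using word_equiv_in_lists[OF e] e by (subst word_class_eq_iff) auto
  qed
  then show ?thesis
    unfolding presented_group_def monoid.simps
    by (rule UN_equiv_class2[OF equiv_word_rel equiv_word_rel _ assms])
qed

lemma presented_group_one: "\<one>\<^bsub>presented_group X R\<^esub> = word_class X R []"
  by (simp add: presented_group_def)

lemma group_presented_group: "group (presented_group X R)"
proof (rule groupI)
  let ?P = "presented_group X R"
  show "\<one>\<^bsub>?P\<^esub> \<in> carrier ?P" by (simp add: presented_group_one word_class_closed)
  fix x assume "x \<in> carrier ?P"
  then obtain u where u: "x = word_class X R u" "u \<in> lists (X \<times> UNIV)"
    by (auto simp: presented_group_carrier)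
  show "\<one>\<^bsub>?P\<^esub> \<otimes>\<^bsub>?P\<^esub> x = x" using u by (simp add: presented_group_one presented_group_mult)
  show "\<exists>y\<in>carrier ?P. y \<otimes>\<^bsub>?P\<^esub> x = \<one>\<^bsub>?P\<^esub>"
    unfolding u(1) using u(2)
  proof (induction u rule: list.induct)
    case Nil
    show ?case
      by (rule bexI[of _ "word_class X R []"])
        (simp_all add: presented_group_mult presented_group_one word_class_closed)
  next
    case (Cons a u)
    have "a \<in> X \<times> UNIV" using Cons.prems by auto
    then obtain x s where a: "a = (x, s)" "x \<in> X" by auto
    have u: "u \<in> lists (X \<times> UNIV)" using Cons.prems by auto
    from Cons.IH[OF u] obtain y where y: "y \<in> carrier ?P" "y \<otimes>\<^bsub>?P\<^esub> word_class X R u = \<one>\<^bsub>?P\<^esub>"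
      by blast
    from y(1) obtain w where w: "w \<in> lists (X \<times> UNIV)" "y = word_class X R w"
      unfolding presented_group_carrier by blast
    have wu: "word_class X R (w @ u) = word_class X R []"
      using y(2) unfolding w(2) presented_group_mult[OF w(1) u] presented_group_one .
    have "word_equiv X R (w @ [(x, \<not> s), (x, \<not> \<not> s)] @ u) (w @ [] @ u)"
      by (rule word_equiv.cong[OF word_equiv.cancel]) (use w u a in auto)
    then have "word_class X R (w @ [(x, \<not> s), (x, s)] @ u) = word_class X R (w @ u)"
      using w u a by (subst word_class_eq_iff) auto
    moreover have v: "w @ [(x, \<not> s)] \<in> lists (X \<times> UNIV)" using w a by auto
    ultimately have "word_class X R (w @ [(x, \<not> s)]) \<otimes>\<^bsub>?P\<^esub> word_class X R (a # u) = \<one>\<^bsub>?P\<^esub>"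
      using wu unfolding presented_group_mult[OF v Cons.prems] unfolding presented_group_one a(1) by simp
    then show ?case using v unfolding presented_group_carrier by blast
  qed
  fix y assume "y \<in> carrier ?P"
  then obtain v where v: "y = word_class X R v" "v \<in> lists (X \<times> UNIV)"
    by (auto simp: presented_group_carrier)
  have uv: "u @ v \<in> lists (X \<times> UNIV)" using u v by auto
  then show "x \<otimes>\<^bsub>?P\<^esub> y \<in> carrier ?P"
    unfolding u(1) v(1) presented_group_mult[OF u(2) v(2)] presented_group_carrier by blast
  fix z assume "z \<in> carrier ?P"
  then obtain w where w: "z = word_class X R w" "w \<in> lists (X \<times> UNIV)"
    by (auto simp: presented_group_carrier)
  have vw: "v @ w \<in> lists (X \<times> UNIV)" using v w by auto
  show "x \<otimes>\<^bsub>?P\<^esub> y \<otimes>\<^bsub>?P\<^esub> z = x \<otimes>\<^bsub>?P\<^esub> (y \<otimes>\<^bsub>?P\<^esub> z)"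
    using uv vw unfolding u(1) v(1) w(1)
    by (simp only: presented_group_mult u(2) v(2) w(2) append_assoc)
qed

lemma presented_gen_closed: "x \<in> X \<Longrightarrow> presented_gen X R x \<in> carrier (presented_group X R)"
  unfolding presented_gen_def by (rule word_class_closed) auto

lemma presented_gen_inv:
  assumes "x \<in> X"
  shows "inv\<^bsub>presented_group X R\<^esub> presented_gen X R x = word_class X R [(x, False)]"
proof (rule group.inv_equality[OF group_presented_group])
  have "word_equiv X R [(x, False), (x, \<not> False)] []"
    by (rule word_equiv.cancel) (use assms in auto)
  then have "word_class X R [(x, False), (x, True)] = word_class X R []"
    using assms by (subst word_class_eq_iff) auto
  then show "word_class X R [(x, False)] \<otimes>\<^bsub>presented_group X R\<^esub> presented_gen X R x
      = \<one>\<^bsub>presented_group X R\<^esub>"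
    using assms by (simp add: presented_gen_def presented_group_mult presented_group_one)
  show "word_class X R [(x, False)] \<in> carrier (presented_group X R)"
    using assms by (intro word_class_closed) auto
qed (use assms in \<open>simp add: presented_gen_closed\<close>)

lemma presented_group_generated:
  "generate (presented_group X R) (presented_gen X R ` X) = carrier (presented_group X R)"
    (is "generate ?P ?S = _")
proof
  interpret group ?P by (rule group_presented_group)
  show "generate ?P ?S \<subseteq> carrier ?P"
    by (rule generate_incl) (auto simp: presented_gen_closed)
  have "word_class X R w \<in> generate ?P ?S" if "w \<in> lists (X \<times> UNIV)" for w
    using that
  proof (induction w rule: list.induct)
    case Nil
    then show ?case using generate.one[of ?P ?S] by (simp add: presented_group_one)
  next
    case (Cons a w)
    have "a \<in> X \<times> UNIV" using Cons.prems by auto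
    then obtain x s where a: "a = (x, s)" "x \<in> X" by auto
    have "word_class X R [a] \<in> generate ?P ?S"
    proof (cases s)
      case True
      then show ?thesis using a generate.incl[of "presented_gen X R x" ?S ?P]
        by (simp add: presented_gen_def)
    next
      case False
      then show ?thesis using a generate.inv[of "presented_gen X R x" ?S ?P]
        by (simp add: presented_gen_inv)
    qed
    then have "word_class X R [a] \<otimes>\<^bsub>?P\<^esub> word_class X R w \<in> generate ?P ?S"
      using Cons.IH Cons.prems by (intro generate.eng) auto
    then show ?case using Cons.prems presented_group_mult[of "[a]" X w R] by auto
  qed
  then show "carrier ?P \<subseteq> generate ?P ?S" by (auto simp: presented_group_carrier)
qed

lemma presented_group_relator:
  assumes "r \<in> R" "r \<in> lists (X \<times> UNIV)"
  shows "word_class X R r = \<one>\<^bsub>presented_group X R\<^esub>"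
  unfolding presented_group_one using assms word_equiv.relator[OF assms]
  by (subst word_class_eq_iff) auto

lemma word_class_positive:
  assumes "set xs \<subseteq> X"
  shows "word_class X R (map (\<lambda>x. (x, True)) xs) =
    list_mult (presented_group X R) (map (presented_gen X R) xs)"
  using assms
proof (induction xs)
  case (Cons x xs)
  then have "(x, True) # map (\<lambda>x. (x, True)) xs \<in> lists (X \<times> UNIV)" by auto
  then show ?case
    using Cons presented_group_mult[of "[(x, True)]" X "map (\<lambda>x. (x, True)) xs" R]
    by (auto simp: list_mult_def presented_gen_def)
qed (simp add: list_mult_def presented_group_one)

definition word_eval :: "('c, 'd) monoid_scheme \<Rightarrow> ('x \<Rightarrow> 'c) \<Rightarrow> ('x \<times> bool) list \<Rightarrow> 'c" where
  "word_eval H h w = list_mult H (map (\<lambda>(x, s). if s then h x else inv\<^bsub>H\<^esub> h x) w)"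

context group
begin

lemma list_mult_closed: "set xs \<subseteq> carrier G \<Longrightarrow> list_mult G xs \<in> carrier G"
  by (induction xs) (auto simp: list_mult_def)

lemma list_mult_append:
  "set xs \<subseteq> carrier G \<Longrightarrow> set ys \<subseteq> carrier G
    \<Longrightarrow> list_mult G (xs @ ys) = list_mult G xs \<otimes> list_mult G ys"
proof (induction xs)
  case Nil
  then show ?case using list_mult_closed[of ys] by (simp add: list_mult_def)
next
  case (Cons a xs)
  then show ?case using list_mult_closed[of xs] list_mult_closed[of ys]
    by (simp add: list_mult_def m_assoc)
qed

lemma list_mult_replicate: "x \<in> carrier G \<Longrightarrow> list_mult G (replicate n x) = x [^] n"
proof (induction n)
  case (Suc n)
  then show ?case using nat_pow_Suc2[of x n] by (simp add: list_mult_def)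
qed (simp add: list_mult_def)

lemma word_eval_append:
  assumes "h ` X \<subseteq> carrier G" "u \<in> lists (X \<times> UNIV)" "v \<in> lists (X \<times> UNIV)"
  shows "word_eval G h (u @ v) = word_eval G h u \<otimes> word_eval G h v"
  unfolding word_eval_def map_append
  by (rule list_mult_append) (use assms in fastforce)+

lemma word_eval_closed:
  assumes "h ` X \<subseteq> carrier G" "u \<in> lists (X \<times> UNIV)"
  shows "word_eval G h u \<in> carrier G"
  unfolding word_eval_def
  by (rule list_mult_closed) (use assms in fastforce)+

text \<open>The words with the same value form a congruence that satisfies the defining relations, so the value
  of a word depends only on its class.\<close>

lemma presented_group_universal:
  assumes h: "h ` X \<subseteq> carrier G"
    and rel: "\<And>r. r \<in> R \<Longrightarrow> r \<in> lists (X \<times> UNIV) \<Longrightarrow> word_eval G h r = \<one>"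
  obtains \<psi> where "\<psi> \<in> hom (presented_group X R) G"
    and "\<And>x. x \<in> X \<Longrightarrow> \<psi> (presented_gen X R x) = h x"
proof -
  let ?P = "presented_group X R"
  have eq: "word_eval G h u = word_eval G h v" if "word_equiv X R u v" for u v
    using that
  proof (induction rule: word_equiv.induct)
    case (cong u v a b)
    then have "u \<in> lists (X \<times> UNIV)" "v \<in> lists (X \<times> UNIV)"
      using word_equiv_in_lists by blast+
    then show ?case using cong
      by (simp add: word_eval_append[OF h])
  next
    case (cancel x s)
    then show ?case using h
      by (cases s) (auto simp: word_eval_def list_mult_def image_subset_iff)
  next
    case (relator r)
    then show ?case using rel by (simp add: word_eval_def list_mult_def)
  qed auto
  define \<psi> where "\<psi> A = the_elem (word_eval G h ` A)" for A
  have \<psi>: "\<psi> (word_class X R w) = word_eval G h w" if "w \<in> lists (X \<times> UNIV)" for w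
  proof -
    have "word_eval G h ` word_class X R w = {word_eval G h w}"
    proof (intro equalityI subsetI)
      fix z assume "z \<in> word_eval G h ` word_class X R w"
      then obtain v where v: "word_equiv X R w v" "z = word_eval G h v"
        unfolding word_rel_def by blast
      show "z \<in> {word_eval G h w}" using eq[OF v(1)] v(2) by simp
    next
      fix z assume "z \<in> {word_eval G h w}"
      moreover have "w \<in> word_class X R w"
        using word_equiv.refl[OF that, of R] by (simp add: word_rel_def)
      ultimately show "z \<in> word_eval G h ` word_class X R w" by blast
    qed
    then show ?thesis unfolding \<psi>_def by simp
  qed
  show thesis
  proof
    show "\<psi> \<in> hom ?P G"
    proof (rule homI)
      fix x assume "x \<in> carrier ?P"
      then obtain u where u: "x = word_class X R u" "u \<in> lists (X \<times> UNIV)"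
        unfolding presented_group_carrier by blast
      show "\<psi> x \<in> carrier G"
        unfolding u(1) \<psi>[OF u(2)] by (rule word_eval_closed[OF h u(2)])
      fix y assume "y \<in> carrier ?P"
      then obtain v where v: "y = word_class X R v" "v \<in> lists (X \<times> UNIV)"
        unfolding presented_group_carrier by blast
      have "u @ v \<in> lists (X \<times> UNIV)" using u v by auto
      then show "\<psi> (x \<otimes>\<^bsub>?P\<^esub> y) = \<psi> x \<otimes> \<psi> y"
        unfolding u(1) v(1) presented_group_mult[OF u(2) v(2)]
        by (simp only: \<psi> u(2) v(2) word_eval_append[OF h])
    qed
    fix x assume "x \<in> X"
    then have "h x \<in> carrier G" "[(x, True)] \<in> lists (X \<times> UNIV)" using h by auto
    then show "\<psi> (presented_gen X R x) = h x"
      unfolding presented_gen_def by (subst \<psi>) (simp_all add: word_eval_def list_mult_def)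
  qed
qed

end

lemma hom_eq_on_generate:
  assumes "group G" "group H" "\<phi> \<in> hom G H" "\<psi> \<in> hom G H" "S \<subseteq> carrier G"
    and "\<And>s. s \<in> S \<Longrightarrow> \<phi> s = \<psi> s" and "x \<in> generate G S"
  shows "\<phi> x = \<psi> x"
proof -
  interpret A: group_hom G H \<phi> using assms by (simp add: group_hom_def group_hom_axioms_def)
  interpret B: group_hom G H \<psi> using assms by (simp add: group_hom_def group_hom_axioms_def)
  have "x \<in> carrier G \<and> \<phi> x = \<psi> x"
    using assms(7)
    by (induction rule: generate.induct) (use assms(5,6) in auto)
  then show ?thesis ..
qed

lemma hom_image_generate:
  assumes "group G" "group H" "\<phi> \<in> hom G H" "S \<subseteq> carrier G"
  shows "\<phi> ` generate G S = generate H (\<phi> ` S)"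
proof -
  interpret A: group_hom G H \<phi> using assms by (simp add: group_hom_def group_hom_axioms_def)
  show ?thesis using A.generate_img[OF assms(4)] by simp
qed

lemma hom_list_mult:
  assumes "group G" "group H" "\<phi> \<in> hom G H" "set xs \<subseteq> carrier G"
  shows "\<phi> (list_mult G xs) = list_mult H (map \<phi> xs)"
  using assms(4)
proof (induction xs)
  case Nil
  then show ?case using hom_one[OF assms(3,1,2)] by (simp add: list_mult_def)
next
  case (Cons x xs)
  then show ?case using hom_mult[OF assms(3)] group.list_mult_closed[OF assms(1), of xs]
    by (simp add: list_mult_def)
qed

section \<open>Commutator subgroups and finiteness of central extensions\<close>

context group
begin

lemma commutator_subgroup_normal:
  assumes "H \<lhd> G"
  shows "commutator_subgroup G H (carrier G) \<lhd> G"
  unfolding commutator_subgroup_def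
proof (rule normal_generateI)
  interpret H: normal H G by (rule assms)
  show "{h \<otimes> k \<otimes> inv h \<otimes> inv k |h k. h \<in> H \<and> k \<in> carrier G} \<subseteq> carrier G"
    using H.subset by auto
  fix c g assume "c \<in> {h \<otimes> k \<otimes> inv h \<otimes> inv k |h k. h \<in> H \<and> k \<in> carrier G}"
    and g: "g \<in> carrier G"
  then obtain h k where hk: "h \<in> H" "k \<in> carrier G" "c = h \<otimes> k \<otimes> inv h \<otimes> inv k" by auto
  have h: "h \<in> carrier G" using hk H.subset by auto
  have can: "inv g \<otimes> (g \<otimes> x) = x" if "x \<in> carrier G" for x
    using g that by (simp add: m_assoc[symmetric])
  have "g \<otimes> c \<otimes> inv g =
      (g \<otimes> h \<otimes> inv g) \<otimes> (g \<otimes> k \<otimes> inv g) \<otimes> inv (g \<otimes> h \<otimes> inv g) \<otimes> inv (g \<otimes> k \<otimes> inv g)"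
    using g h hk by (simp add: m_assoc inv_mult_group can)
  moreover have "g \<otimes> h \<otimes> inv g \<in> H" using hk g by (simp add: H.inv_op_closed2)
  moreover have "g \<otimes> k \<otimes> inv g \<in> carrier G" using hk g by simp
  ultimately show "g \<otimes> c \<otimes> inv g \<in> {h \<otimes> k \<otimes> inv h \<otimes> inv k |h k. h \<in> H \<and> k \<in> carrier G}"
    by blast
qed

lemma commutator_mem:
  assumes "h \<in> H" "k \<in> K"
  shows "h \<otimes> k \<otimes> inv h \<otimes> inv k \<in> commutator_subgroup G H K"
  unfolding commutator_subgroup_def using assms by (blast intro: generate.incl)

end

text \<open>A homomorphism under which the subgroup becomes central kills its commutators. This is applied to the
  projection \<open>\<Delta> \<rightarrow> G\<close>, which kills \<open>S\<close>, and to representations of \<open>\<Delta>\<close> that send \<open>S\<close> to scalars.\<close>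

lemma (in group_hom) commutator_subgroup_in_kernel:
  assumes "K \<subseteq> carrier G"
    and "\<And>k x. k \<in> K \<Longrightarrow> x \<in> carrier G \<Longrightarrow> h k \<otimes>\<^bsub>H\<^esub> h x = h x \<otimes>\<^bsub>H\<^esub> h k"
  shows "commutator_subgroup G K (carrier G) \<subseteq> kernel G H h"
  unfolding commutator_subgroup_def
proof (rule G.generate_subgroup_incl[OF _ subgroup_kernel], clarify)
  fix k x assume k: "k \<in> K" and x: "x \<in> carrier G"
  have kG: "k \<in> carrier G" using k assms(1) by auto
  have "h (k \<otimes> x \<otimes> inv k \<otimes> inv x) = h x \<otimes>\<^bsub>H\<^esub> h k \<otimes>\<^bsub>H\<^esub> inv\<^bsub>H\<^esub> h k \<otimes>\<^bsub>H\<^esub> inv\<^bsub>H\<^esub> h x"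
    using x kG assms(2)[OF k x] by simp
  also have "\<dots> = \<one>\<^bsub>H\<^esub>"
    using x kG by (simp add: H.m_assoc)
  finally show "k \<otimes> x \<otimes> inv k \<otimes> inv x \<in> kernel G H h"
    using x kG by (simp add: kernel_def)
qed

context group
begin

text \<open>Collecting all occurrences of one letter at the front conjugates the letters that it passes,
  which keeps them in a conjugation invariant set.\<close>

lemma list_mult_collect:
  assumes X: "X \<subseteq> carrier G" and conj: "\<And>g x. g \<in> carrier G \<Longrightarrow> x \<in> X \<Longrightarrow> g \<otimes> x \<otimes> inv g \<in> X"
    and x: "x \<in> X" and "set xs \<subseteq> X"
  shows "\<exists>ys. set ys \<subseteq> X \<and> list_mult G xs = x [^] count_list xs x \<otimes> list_mult G ys \<and>
    length ys + count_list xs x = length xs"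
  using \<open>set xs \<subseteq> X\<close>
proof (induction xs)
  case Nil
  then show ?case by (intro exI[of _ "[]"]) (simp add: list_mult_def)
next
  case (Cons a xs)
  then obtain ys where ys: "set ys \<subseteq> X" "list_mult G xs = x [^] count_list xs x \<otimes> list_mult G ys"
    "length ys + count_list xs x = length xs" by auto
  define c where "c = x [^] count_list xs x"
  have xG: "x \<in> carrier G" and aX: "a \<in> X" and aG: "a \<in> carrier G" and cG: "c \<in> carrier G"
    and yG: "list_mult G ys \<in> carrier G"
    using x X Cons.prems ys(1) by (auto simp: c_def intro!: list_mult_closed)
  show ?case
  proof (cases "a = x")
    case True
    have "list_mult G (a # xs) = x [^] Suc (count_list xs x) \<otimes> list_mult G ys"
      using ys(2) xG yG nat_pow_Suc2[OF xG, of "count_list xs x"]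
      by (simp add: list_mult_def True m_assoc)
    then show ?thesis using ys True by (intro exI[of _ ys]) auto
  next
    case False
    have e: "inv c \<otimes> a \<otimes> c \<in> X" using conj[of "inv c" a] cG aX by simp
    have "c \<otimes> ((inv c \<otimes> a \<otimes> c) \<otimes> list_mult G ys) = (c \<otimes> inv c) \<otimes> a \<otimes> c \<otimes> list_mult G ys"
      using cG aG yG by (simp only: m_assoc m_closed inv_closed)
    also have "\<dots> = a \<otimes> (c \<otimes> list_mult G ys)" using cG aG yG by (simp add: m_assoc)
    also have "\<dots> = list_mult G (a # xs)" using ys(2) by (simp add: list_mult_def c_def)
    finally show ?thesis using ys False e
      by (intro exI[of _ "(inv c \<otimes> a \<otimes> c) # ys"]) (auto simp: list_mult_def c_def)
  qed
qed

lemma inverse_is_positive_power: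
  assumes "x \<in> carrier G" "0 < n" "x [^] (n::nat) = \<one>"
  shows "inv x = x [^] (n - 1)"
proof (rule inv_equality)
  show "x [^] (n - 1) \<otimes> x = \<one>"
    using assms nat_pow_Suc[of x "n - 1"] by simp
qed (use assms in auto)

text \<open>Dietzmann's lemma. If \<open>e\<close> kills all letters, a word with at least \<open>e\<close> occurrences of one letter
  represents the same element as a shorter word; so words of bounded length suffice.\<close>

lemma Dietzmann:
  assumes "finite X" and X: "X \<subseteq> carrier G"
    and conj: "\<And>g x. g \<in> carrier G \<Longrightarrow> x \<in> X \<Longrightarrow> g \<otimes> x \<otimes> inv g \<in> X"
    and "\<And>x. x \<in> X \<Longrightarrow> ord x \<noteq> 0"
  shows "finite (generate G X)"
proof -
  define e where "e = (\<Prod>x\<in>X. ord x)"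
  have e0: "0 < e" using assms by (simp add: e_def prod_pos)
  have kill: "x [^] e = \<one>" if "x \<in> X" for x
    using that assms(1) X by (subst pow_eq_id) (auto simp: e_def dvd_prodI)
  have words: "\<exists>xs. set xs \<subseteq> X \<and> list_mult G xs = g" if "g \<in> generate G X" for g
    using that
  proof (induction rule: generate.induct)
    case one
    then show ?case by (intro exI[of _ "[]"]) (simp add: list_mult_def)
  next
    case (incl h)
    then show ?case using X by (intro exI[of _ "[h]"]) (auto simp: list_mult_def)
  next
    case (inv h)
    then have "h \<in> carrier G" using X by auto
    then show ?case using inverse_is_positive_power[OF _ e0 kill[OF inv]] inv
      by (intro exI[of _ "replicate (e - 1) h"]) (auto simp: list_mult_replicate)
  next
    case (eng h1 h2)
    then obtain xs ys where "set xs \<subseteq> X" "list_mult G xs = h1" "set ys \<subseteq> X" "list_mult G ys = h2"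
      by auto
    then show ?case using X list_mult_append[of xs ys]
      by (intro exI[of _ "xs @ ys"]) auto
  qed
  have short: "\<exists>ys. set ys \<subseteq> X \<and> list_mult G ys = list_mult G xs \<and> length ys \<le> card X * e"
    if "set xs \<subseteq> X" for xs
    using that
  proof (induction xs rule: length_induct)
    case (1 xs)
    show ?case
    proof (cases "length xs \<le> card X * e")
      case True
      then show ?thesis using 1 by blast
    next
      case False
      have "\<exists>x\<in>X. e \<le> count_list xs x"
      proof (rule ccontr)
        assume "\<not> ?thesis"
        then have "sum (count_list xs) X \<le> card X * e"
          by (intro sum_bounded_above[of X _ e, simplified]) (auto simp: not_le less_imp_le)
        then show False using False sum_count_set[OF 1(2) assms(1)] by simp
      qed
      then obtain x where x: "x \<in> X" "e \<le> count_list xs x" by auto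
      then obtain ys where ys: "set ys \<subseteq> X"
        "list_mult G xs = x [^] count_list xs x \<otimes> list_mult G ys"
        "length ys + count_list xs x = length xs"
        using list_mult_collect[OF X conj x(1) 1(2)] by auto
      define zs where "zs = replicate (count_list xs x - e) x @ ys"
      have xG: "x \<in> carrier G" using x X by auto
      have "x [^] count_list xs x = x [^] e \<otimes> x [^] (count_list xs x - e)"
        using x(2) xG by (simp add: nat_pow_mult)
      then have "x [^] count_list xs x = x [^] (count_list xs x - e)"
        using kill[OF x(1)] xG by simp
      then have "list_mult G zs = list_mult G xs"
        using ys X xG x(1) by (subst zs_def, subst list_mult_append) (auto simp: list_mult_replicate)
      moreover have "set zs \<subseteq> X" using ys x by (auto simp: zs_def)
      moreover have "length zs < length xs" using ys(3) x(2) e0 by (simp add: zs_def)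
      ultimately show ?thesis using 1(1) by metis
    qed
  qed
  have "generate G X \<subseteq> list_mult G ` {xs. set xs \<subseteq> X \<and> length xs \<le> card X * e}"
  proof
    fix g assume "g \<in> generate G X"
    then obtain xs where "set xs \<subseteq> X" "list_mult G xs = g" using words by blast
    then obtain ys where "set ys \<subseteq> X" "list_mult G ys = g" "length ys \<le> card X * e"
      using short[of xs] by auto
    then show "g \<in> list_mult G ` {xs. set xs \<subseteq> X \<and> length xs \<le> card X * e}" by blast
  qed
  moreover have "finite {xs. set xs \<subseteq> X \<and> length xs \<le> card X * e}"
    by (rule finite_lists_length_le[OF assms(1)])
  ultimately show ?thesis by (meson finite_imageI finite_subset)
qed

end

text \<open>A central extension of a finite group has only finitely many conjugates of each element, so
  Dietzmann's lemma applies to the conjugates of a finite set of generators of finite order.\<close>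

lemma finite_central_extension:
  assumes "central_extension A E G \<pi>" and "finite (carrier G)"
    and "finite S" "S \<subseteq> carrier E" "generate E S = carrier E"
    and "\<And>x. x \<in> S \<Longrightarrow> group.ord E x \<noteq> 0"
  shows "finite (carrier E)"
proof -
  have E: "group E" and G: "group G" and \<pi>: "\<pi> \<in> hom E G" and A: "kernel E G \<pi> = A"
    and central: "\<And>a x. a \<in> A \<Longrightarrow> x \<in> carrier E \<Longrightarrow> a \<otimes>\<^bsub>E\<^esub> x = x \<otimes>\<^bsub>E\<^esub> a"
    using assms(1) by (auto simp: central_extension_def)
  interpret group_hom E G \<pi> using E G \<pi> by (simp add: group_hom_def group_hom_axioms_def)
  let ?c = "\<lambda>g x. g \<otimes>\<^bsub>E\<^esub> x \<otimes>\<^bsub>E\<^esub> inv\<^bsub>E\<^esub> g"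
  define X where "X = (\<Union>x\<in>S. (\<lambda>g. ?c g x) ` carrier E)"
  have same: "?c g x = ?c h x" if "g \<in> carrier E" "h \<in> carrier E" "x \<in> carrier E" "\<pi> g = \<pi> h" for g h x
  proof -
    define a where "a = g \<otimes>\<^bsub>E\<^esub> inv\<^bsub>E\<^esub> h"
    have aE: "a \<in> carrier E" using that by (simp add: a_def)
    have "\<pi> a = \<one>\<^bsub>G\<^esub>" using that by (simp add: a_def)
    then have aA: "a \<in> A" using aE by (simp add: A[symmetric] kernel_def)
    have g: "g = a \<otimes>\<^bsub>E\<^esub> h" using that by (simp add: a_def G.m_assoc)
    have "?c g x = a \<otimes>\<^bsub>E\<^esub> (?c h x) \<otimes>\<^bsub>E\<^esub> inv\<^bsub>E\<^esub> a"
      using that aE by (simp add: g G.inv_mult_group G.m_assoc)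
    also have "\<dots> = ?c h x"
      using central[OF aA, of "?c h x"] that aE by (simp add: G.m_assoc)
    finally show ?thesis .
  qed
  have fin: "finite ((\<lambda>g. ?c g x) ` carrier E)" if x: "x \<in> carrier E" for x
  proof (rule finite_subset)
    show "(\<lambda>g. ?c g x) ` carrier E \<subseteq> (\<lambda>q. ?c (SOME g. g \<in> carrier E \<and> \<pi> g = q) x) ` carrier G"
    proof
      fix y assume "y \<in> (\<lambda>g. ?c g x) ` carrier E"
      then obtain g where g: "g \<in> carrier E" "y = ?c g x" by auto
      let ?g = "SOME h. h \<in> carrier E \<and> \<pi> h = \<pi> g"
      have "?g \<in> carrier E \<and> \<pi> ?g = \<pi> g" by (rule someI[of _ g]) (use g in auto)
      then have "y = ?c ?g x" using same[OF g(1), of ?g x] x g by auto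
      then show "y \<in> (\<lambda>q. ?c (SOME g. g \<in> carrier E \<and> \<pi> g = q) x) ` carrier G"
        using g(1) by (intro image_eqI[of _ _ "\<pi> g"]) auto
    qed
  qed (use assms(2) in simp)
  have XE: "X \<subseteq> carrier E" using assms(4) by (auto simp: X_def)
  have "finite (generate E X)"
  proof (rule G.Dietzmann[OF _ XE])
    show "finite X" unfolding X_def using assms(3,4) fin by (intro finite_UN_I) auto
    fix g y assume g: "g \<in> carrier E" and "y \<in> X"
    then obtain x h where h: "x \<in> S" "h \<in> carrier E" "y = ?c h x" by (auto simp: X_def)
    then have "?c g y = ?c (g \<otimes>\<^bsub>E\<^esub> h) x"
      using g assms(4) by (auto simp: G.inv_mult_group G.m_assoc subset_iff)
    then show "?c g y \<in> X" using h g by (auto simp: X_def)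
  next
    fix y assume "y \<in> X"
    then obtain x h where h: "x \<in> S" "h \<in> carrier E" "y = ?c h x" by (auto simp: X_def)
    have xE: "x \<in> carrier E" using h assms(4) by auto
    have p: "?c h x [^]\<^bsub>E\<^esub> n = ?c h (x [^]\<^bsub>E\<^esub> n)" for n :: nat
    proof (induction n)
      case (Suc n)
      have "inv\<^bsub>E\<^esub> h \<otimes>\<^bsub>E\<^esub> (h \<otimes>\<^bsub>E\<^esub> z) = z" if "z \<in> carrier E" for z
        using h that by (simp add: G.m_assoc[symmetric])
      then show ?case using Suc h xE by (simp add: G.m_assoc)
    qed (use h xE in simp)
    have "y [^]\<^bsub>E\<^esub> G.ord x = \<one>\<^bsub>E\<^esub>" using h xE p[of "G.ord x"] by simp
    then have "G.ord y dvd G.ord x" using XE \<open>y \<in> X\<close> G.pow_eq_id by blast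
    then show "G.ord y \<noteq> 0" using assms(6)[OF h(1)] by auto
  qed
  moreover have "carrier E \<subseteq> generate E X"
  proof -
    have "S \<subseteq> X"
    proof
      fix x assume x: "x \<in> S"
      then have "x = ?c \<one>\<^bsub>E\<^esub> x" using assms(4) by auto
      then show "x \<in> X" using x unfolding X_def by blast
    qed
    then show ?thesis using G.mono_generate[of S X] assms(5) by simp
  qed
  ultimately show ?thesis by (rule rev_finite_subset)
qed

section \<open>Elliptic presentations and their central quotients\<close>

lemma Delta_relators_in_lists: "Delta_relators ms \<subseteq> lists ({..<length ms} \<times> UNIV)"
  by (auto simp: Delta_relators_def in_set_replicate)

lemma group_Delta: "group (Delta ms)"
  unfolding Delta_def by (rule group_presented_group)

lemma Delta_gen_closed: "i < length ms \<Longrightarrow> Delta_gen ms i \<in> carrier (Delta ms)"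
  unfolding Delta_def Delta_gen_def by (rule presented_gen_closed) simp

lemma Delta_generated: "generate (Delta ms) (Delta_gen ms ` {..<length ms}) = carrier (Delta ms)"
  using presented_group_generated[of "{..<length ms}" "Delta_relators ms"]
  by (simp add: Delta_def Delta_gen_def[abs_def])

lemma Delta_product: "list_mult (Delta ms) (map (Delta_gen ms) [0..<length ms]) = \<one>\<^bsub>Delta ms\<^esub>"
proof -
  let ?X = "{..<length ms}" and ?r = "map (\<lambda>i. (i, True)) [0..<length ms]"
  have r: "?r \<in> Delta_relators ms" by (simp add: Delta_relators_def)
  then have "word_class ?X (Delta_relators ms) ?r = \<one>\<^bsub>Delta ms\<^esub>"
    unfolding Delta_def using Delta_relators_in_lists by (intro presented_group_relator) auto
  moreover have "set [0..<length ms] \<subseteq> ?X" by auto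
  ultimately show ?thesis
    using word_class_positive[of "[0..<length ms]" ?X "Delta_relators ms"]
    by (simp add: Delta_def Delta_gen_def[abs_def])
qed

lemma Delta_gen_pow:
  assumes "i < length ms"
  shows "Delta_gen ms i [^]\<^bsub>Delta ms\<^esub> (ms ! i) = \<one>\<^bsub>Delta ms\<^esub>"
proof -
  interpret group "Delta ms" by (rule group_Delta)
  let ?X = "{..<length ms}" and ?r = "replicate (ms ! i) (i, True)"
  have r: "?r \<in> Delta_relators ms" using assms by (auto simp: Delta_relators_def)
  then have "word_class ?X (Delta_relators ms) ?r = \<one>\<^bsub>Delta ms\<^esub>"
    unfolding Delta_def using Delta_relators_in_lists by (intro presented_group_relator) auto
  moreover have "set (replicate (ms ! i) i) \<subseteq> ?X" using assms by auto
  ultimately have "list_mult (Delta ms) (replicate (ms ! i) (Delta_gen ms i)) = \<one>\<^bsub>Delta ms\<^esub>"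
    using word_class_positive[of "replicate (ms ! i) i" ?X "Delta_relators ms"]
    by (simp add: Delta_def Delta_gen_def)
  then show ?thesis using Delta_gen_closed[OF assms] by (simp add: list_mult_replicate)
qed

lemma (in group) Delta_universal:
  assumes h: "\<And>i. i < length ms \<Longrightarrow> h i \<in> carrier G"
    and pow: "\<And>i. i < length ms \<Longrightarrow> h i [^] (ms ! i) = \<one>"
    and prod: "list_mult G (map h [0..<length ms]) = \<one>"
  obtains \<psi> where "\<psi> \<in> hom (Delta ms) G" and "\<And>i. i < length ms \<Longrightarrow> \<psi> (Delta_gen ms i) = h i"
proof -
  have "h ` {..<length ms} \<subseteq> carrier G" using h by auto
  moreover have "word_eval G h r = \<one>" if "r \<in> Delta_relators ms" for r
    using that pow h prod
    by (auto simp: Delta_relators_def word_eval_def comp_def list_mult_replicate)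
  ultimately obtain \<psi> where "\<psi> \<in> hom (presented_group {..<length ms} (Delta_relators ms)) G"
    "\<And>i. i \<in> {..<length ms} \<Longrightarrow> \<psi> (presented_gen {..<length ms} (Delta_relators ms) i) = h i"
    using presented_group_universal[of h "{..<length ms}" "Delta_relators ms"] by blast
  then show thesis by (intro that[of \<psi>]) (simp_all add: Delta_def Delta_gen_def)
qed

locale elliptic_extension =
  fixes G :: "('a, 'b) monoid_scheme" (structure) and gs :: "'a list" and \<phi>
  assumes group_G: "group G" and presentation: "elliptic_presentation G gs \<phi>"
begin

abbreviation \<Delta> where "\<Delta> \<equiv> Delta (signature G gs)"
abbreviation y where "y \<equiv> Delta_gen (signature G gs)"
abbreviation N where "N \<equiv> elliptic_commutator G gs \<phi>"
abbreviation D where "D \<equiv> elliptic_central G gs \<phi>"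
abbreviation ds where "ds \<equiv> elliptic_central_system G gs \<phi>"
abbreviation \<pi> where "\<pi> \<equiv> elliptic_central_proj \<phi>"

lemma elliptic: "elliptic_system G gs"
  and phi_hom: "\<phi> \<in> hom \<Delta> G"
  and phi_gen: "i < length gs \<Longrightarrow> \<phi> (y i) = gs ! i"
  using presentation by (auto simp: elliptic_presentation_def)

lemma length_signature [simp]: "length (signature G gs) = length gs"
  by (simp add: signature_def)

sublocale \<phi>: group_hom \<Delta> G \<phi>
  using group_G group_Delta phi_hom by (simp add: group_hom_def group_hom_axioms_def)

lemma N_eq: "N = commutator_subgroup \<Delta> (kernel \<Delta> G \<phi>) (carrier \<Delta>)"
  by (simp add: elliptic_commutator_def Let_def)

sublocale N: normal N \<Delta>
  unfolding N_eq by (rule \<phi>.G.commutator_subgroup_normal[OF \<phi>.normal_kernel])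

lemma D_eq: "D = \<Delta> Mod N"
  by (simp add: elliptic_central_def)

lemma group_D: "group D"
  unfolding D_eq by (rule N.factorgroup_is_group)

lemma N_in_kernel: "N \<subseteq> kernel \<Delta> G \<phi>"
  unfolding N_eq by (rule \<phi>.commutator_subgroup_in_kernel) (auto simp: kernel_def)

lemma coset_hom: "(\<lambda>x. N #>\<^bsub>\<Delta>\<^esub> x) \<in> hom \<Delta> D"
  unfolding D_eq by (rule N.r_coset_hom_Mod)

lemma D_carrier: "carrier D = (\<lambda>x. N #>\<^bsub>\<Delta>\<^esub> x) ` carrier \<Delta>"
  by (simp add: D_eq carrier_FactGroup)

lemma proj_coset:
  assumes "x \<in> carrier \<Delta>"
  shows "\<pi> (N #>\<^bsub>\<Delta>\<^esub> x) = \<phi> x"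
proof -
  have "\<phi> z = \<phi> x" if "z \<in> N #>\<^bsub>\<Delta>\<^esub> x" for z
  proof -
    obtain n where n: "n \<in> N" "z = n \<otimes>\<^bsub>\<Delta>\<^esub> x" using \<open>z \<in> N #>\<^bsub>\<Delta>\<^esub> x\<close> by (auto simp: r_coset_def)
    then have "n \<in> kernel \<Delta> G \<phi>" using N_in_kernel by blast
    then show ?thesis using n assms by (auto simp: kernel_def)
  qed
  moreover have "x \<in> N #>\<^bsub>\<Delta>\<^esub> x" by (rule \<phi>.G.rcos_self[OF assms N.subgroup_axioms])
  ultimately have "\<phi> ` (N #>\<^bsub>\<Delta>\<^esub> x) = {\<phi> x}" by blast
  then show ?thesis by (simp add: elliptic_central_proj_def)
qed

lemma proj_hom: "\<pi> \<in> hom D G"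
proof (rule homI)
  fix a assume "a \<in> carrier D"
  then obtain x where x: "x \<in> carrier \<Delta>" "a = N #>\<^bsub>\<Delta>\<^esub> x" by (auto simp: D_carrier)
  then show "\<pi> a \<in> carrier G" by (simp add: proj_coset)
  fix b assume "b \<in> carrier D"
  then obtain z where z: "z \<in> carrier \<Delta>" "b = N #>\<^bsub>\<Delta>\<^esub> z" by (auto simp: D_carrier)
  have "a \<otimes>\<^bsub>D\<^esub> b = N #>\<^bsub>\<Delta>\<^esub> (x \<otimes>\<^bsub>\<Delta>\<^esub> z)"
    using x z hom_mult[OF coset_hom] by simp
  then show "\<pi> (a \<otimes>\<^bsub>D\<^esub> b) = \<pi> a \<otimes> \<pi> b" using x z by (simp add: proj_coset)
qed

lemma phi_surj: "\<phi> ` carrier \<Delta> = carrier G"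
proof
  have "\<phi> ` (y ` {..<length gs}) = set gs"
    using phi_gen by (force simp: image_image set_conv_nth)
  moreover have "y ` {..<length gs} \<subseteq> carrier \<Delta>" by (auto simp: Delta_gen_closed)
  ultimately have "\<phi> ` generate \<Delta> (y ` {..<length gs}) = generate G (set gs)"
    using hom_image_generate[OF group_Delta group_G phi_hom] by simp
  then show "carrier G \<subseteq> \<phi> ` carrier \<Delta>"
    using elliptic Delta_generated[of "signature G gs"] by (simp add: elliptic_system_def)
qed auto

lemma proj_surj: "\<pi> ` carrier D = carrier G"
  unfolding D_carrier image_image phi_surj[symmetric] by (auto simp: proj_coset)

lemma proj_kernel: "kernel D G \<pi> = elliptic_central_kernel G gs \<phi>"
  by (auto simp: kernel_def elliptic_central_kernel_def D_carrier proj_coset Let_def)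

text \<open>For \<open>s \<in> S\<close> and \<open>z \<in> \<Delta>\<close>, the products \<open>sz\<close> and \<open>zs\<close> differ by the commutator of \<open>s\<close> and \<open>z\<close>, which
  is trivial in \<open>D\<close>.\<close>

lemma central_extension_D: "central_extension (elliptic_central_kernel G gs \<phi>) D G \<pi>"
proof -
  have "a \<otimes>\<^bsub>D\<^esub> x = x \<otimes>\<^bsub>D\<^esub> a" 
    if "a \<in> elliptic_central_kernel G gs \<phi>" "x \<in> carrier D" for a x
  proof -
    obtain s where s: "s \<in> kernel \<Delta> G \<phi>" "a = N #>\<^bsub>\<Delta>\<^esub> s"
      using \<open>a \<in> _\<close> unfolding elliptic_central_kernel_def Let_def by blast
    obtain z where z: "z \<in> carrier \<Delta>" "x = N #>\<^bsub>\<Delta>\<^esub> z" using \<open>x \<in> _\<close> by (auto simp: D_carrier)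
    have sc: "s \<in> carrier \<Delta>" using s by (simp add: kernel_def)
    let ?c = "s \<otimes>\<^bsub>\<Delta>\<^esub> z \<otimes>\<^bsub>\<Delta>\<^esub> inv\<^bsub>\<Delta>\<^esub> s \<otimes>\<^bsub>\<Delta>\<^esub> inv\<^bsub>\<Delta>\<^esub> z"
    have c: "?c \<in> N" unfolding N_eq using s z by (intro \<phi>.G.commutator_mem) auto
    have can: "inv\<^bsub>\<Delta>\<^esub> u \<otimes>\<^bsub>\<Delta>\<^esub> (u \<otimes>\<^bsub>\<Delta>\<^esub> v) = v" if "u \<in> carrier \<Delta>" "v \<in> carrier \<Delta>" for u v
      using that by (simp add: \<phi>.G.m_assoc[symmetric])
    have "s \<otimes>\<^bsub>\<Delta>\<^esub> z = ?c \<otimes>\<^bsub>\<Delta>\<^esub> (z \<otimes>\<^bsub>\<Delta>\<^esub> s)"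
      using z sc by (simp add: \<phi>.G.m_assoc can)
    then obtain c where c: "c \<in> N" "s \<otimes>\<^bsub>\<Delta>\<^esub> z = c \<otimes>\<^bsub>\<Delta>\<^esub> (z \<otimes>\<^bsub>\<Delta>\<^esub> s)" using c by blast
    have "N #>\<^bsub>\<Delta>\<^esub> c #>\<^bsub>\<Delta>\<^esub> (z \<otimes>\<^bsub>\<Delta>\<^esub> s) = N #>\<^bsub>\<Delta>\<^esub> (c \<otimes>\<^bsub>\<Delta>\<^esub> (z \<otimes>\<^bsub>\<Delta>\<^esub> s))"
      by (rule \<phi>.G.coset_mult_assoc[OF N.subset]) (use z sc c(1) N.subset in auto)
    then have "N #>\<^bsub>\<Delta>\<^esub> (s \<otimes>\<^bsub>\<Delta>\<^esub> z) = N #>\<^bsub>\<Delta>\<^esub> (z \<otimes>\<^bsub>\<Delta>\<^esub> s)"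
      by (simp add: c(2) N.rcos_const[OF group_Delta c(1)])
    then show ?thesis using s(2) z sc hom_mult[OF coset_hom] by simp
  qed
  then show ?thesis
    unfolding central_extension_def
    using group_D group_G proj_hom proj_surj proj_kernel by blast
qed

lemma length_ds [simp]: "length ds = length gs"
  by (simp add: elliptic_central_system_def Let_def)

lemma ds_nth: "i < length gs \<Longrightarrow> ds ! i = N #>\<^bsub>\<Delta>\<^esub> y i"
  by (simp add: elliptic_central_system_def Let_def)

lemma set_ds: "set ds = (\<lambda>x. N #>\<^bsub>\<Delta>\<^esub> x) ` y ` {..<length gs}"
  by (auto simp: elliptic_central_system_def Let_def)

lemma ds_closed: "set ds \<subseteq> carrier D"
  unfolding set_ds D_carrier by (auto simp: Delta_gen_closed)

lemma proj_ds: "i < length gs \<Longrightarrow> \<pi> (ds ! i) = gs ! i"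
  by (simp add: ds_nth proj_coset Delta_gen_closed phi_gen)

lemma ds_generate: "generate D (set ds) = carrier D"
proof -
  have "y ` {..<length gs} \<subseteq> carrier \<Delta>" by (auto simp: Delta_gen_closed)
  then show ?thesis
    using hom_image_generate[OF group_Delta group_D coset_hom, of "y ` {..<length gs}"]
      Delta_generated[of "signature G gs"]
    by (simp add: set_ds D_carrier)
qed

lemma ds_product: "list_mult D ds = \<one>\<^bsub>D\<^esub>"
proof -
  have ds: "ds = map (\<lambda>x. N #>\<^bsub>\<Delta>\<^esub> x) (map y [0..<length gs])"
    by (simp add: elliptic_central_system_def Let_def)
  have "set (map y [0..<length gs]) \<subseteq> carrier \<Delta>" by (auto simp: Delta_gen_closed)
  then show ?thesis
    unfolding ds
    using hom_list_mult[OF group_Delta group_D coset_hom, of "map y [0..<length gs]"]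
      Delta_product[of "signature G gs"] hom_one[OF coset_hom group_Delta group_D]
    by simp
qed

text \<open>The relation \<open>y\<^sub>i\<^bsup>m\<^sub>i\<^esup> = 1\<close> bounds the order of the image of \<open>y\<^sub>i\<close> in \<open>D\<close> from above, and its image
  in \<open>G\<close> bounds it from below: the projection preserves the orders of the generators, so that
  the map of surfaces has no branch points.\<close>

lemma ord_ds:
  assumes "i < length gs"
  shows "group.ord D (ds ! i) = group.ord G (gs ! i)"
proof (rule dvd_antisym)
  interpret D: group D by (rule group_D)
  have c: "ds ! i \<in> carrier D" using ds_closed assms by (auto simp: subset_iff)
  have g: "gs ! i \<in> carrier G" using elliptic assms by (auto simp: elliptic_system_def)
  have sig: "signature G gs ! i = group.ord G (gs ! i)" using assms by (simp add: signature_def)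
  have "ds ! i [^]\<^bsub>D\<^esub> group.ord G (gs ! i) = N #>\<^bsub>\<Delta>\<^esub> (y i [^]\<^bsub>\<Delta>\<^esub> (signature G gs ! i))"
    using assms by (simp add: ds_nth D_eq N.FactGroup_pow Delta_gen_closed sig)
  also have "\<dots> = \<one>\<^bsub>D\<^esub>"
    using Delta_gen_pow[of i "signature G gs"] hom_one[OF coset_hom group_Delta group_D] assms by simp
  finally show "D.ord (ds ! i) dvd \<phi>.H.ord (gs ! i)" using c by (simp add: D.pow_eq_id)
  interpret p: group_hom D G \<pi>
    using group_D group_G proj_hom by (simp add: group_hom_def group_hom_axioms_def)
  have "gs ! i [^] D.ord (ds ! i) = \<pi> (ds ! i [^]\<^bsub>D\<^esub> D.ord (ds ! i))"
    by (simp only: p.hom_nat_pow[OF c] proj_ds[OF assms])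
  then show "\<phi>.H.ord (gs ! i) dvd D.ord (ds ! i)"
    using c g by (simp add: \<phi>.H.pow_eq_id)
qed

lemma elliptic_system_D: "elliptic_system D ds"
  unfolding elliptic_system_def
proof (intro conjI ballI)
  show "ds \<noteq> []" using elliptic length_ds by (metis elliptic_system_def length_0_conv)
  fix g assume "g \<in> set ds"
  then obtain i where "i < length gs" "g = ds ! i" by (auto simp: in_set_conv_nth)
  then show "1 < group.ord D g" using elliptic by (auto simp: ord_ds elliptic_system_def)
qed (use ds_closed ds_generate ds_product in auto)

lemma finite_D:
  assumes "finite (carrier G)"
  shows "finite (carrier D)"
  using finite_central_extension[OF central_extension_D assms _ ds_closed ds_generate]
    elliptic_system_D by (fastforce simp: elliptic_system_def)

end

section \<open>Lifting projective representations\<close>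

lemma group_GL: "group (GL n)"
proof -
  interpret ring "ring_mat TYPE(complex) n ()" by (rule ring_mat)
  show ?thesis unfolding GL_def by (rule units_group)
qed

lemma GL_mult [simp]: "A \<otimes>\<^bsub>GL n\<^esub> B = A * B"
  and GL_one [simp]: "\<one>\<^bsub>GL n\<^esub> = 1\<^sub>m n"
  by (simp_all add: GL_def units_of_def ring_mat_def)

lemma GL_carrier_mat: "A \<in> carrier (GL n) \<Longrightarrow> A \<in> carrier_mat n n"
  by (auto simp: GL_def units_of_def Units_def ring_mat_def)

lemma scalar_mult_scalar: "(c \<cdot>\<^sub>m 1\<^sub>m n) * (d \<cdot>\<^sub>m 1\<^sub>m n) = (c * d) \<cdot>\<^sub>m (1\<^sub>m n :: complex mat)"
proof -
  have "c \<cdot>\<^sub>m (d \<cdot>\<^sub>m 1\<^sub>m n) = (c * d) \<cdot>\<^sub>m (1\<^sub>m n :: complex mat)" by (rule eq_matI) auto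
  then show ?thesis
    using mult_smult_assoc_mat[of "1\<^sub>m n" n n "d \<cdot>\<^sub>m 1\<^sub>m n" n c] by simp
qed

lemma smult_one_mat: "1 \<cdot>\<^sub>m 1\<^sub>m n = (1\<^sub>m n :: complex mat)"
  by (rule eq_matI) auto

lemma scalar_in_GL:
  assumes "c \<noteq> 0"
  shows "c \<cdot>\<^sub>m 1\<^sub>m n \<in> carrier (GL n)"
  unfolding GL_def units_of_def Units_def ring_mat_def
  using assms scalar_mult_scalar[of c n "inverse c"] scalar_mult_scalar[of "inverse c" n c]
  by (auto simp: smult_one_mat intro!: bexI[of _ "inverse c \<cdot>\<^sub>m 1\<^sub>m n"])

lemma scalar_mats_subset_GL: "scalar_mats n \<subseteq> carrier (GL n)"
  by (auto simp: scalar_mats_def scalar_in_GL)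

lemma scalar_mats_central:
  assumes "A \<in> carrier_mat n n" "s \<in> scalar_mats n"
  shows "s * A = A * s"
  using assms by (auto simp: scalar_mats_def)

lemma scalar_pow: "(c \<cdot>\<^sub>m 1\<^sub>m n) [^]\<^bsub>GL n\<^esub> (k::nat) = (c ^ k) \<cdot>\<^sub>m 1\<^sub>m n"
proof (induction k)
  case 0
  show ?case by (simp add: nat_pow_def smult_one_mat)
next
  case (Suc k)
  interpret group "GL n" by (rule group_GL)
  show ?case using Suc by (simp add: scalar_mult_scalar mult.commute)
qed

lemma scalar_mats_normal: "scalar_mats n \<lhd> GL n"
proof -
  interpret group "GL n" by (rule group_GL)
  have inverse: "inv\<^bsub>GL n\<^esub> (c \<cdot>\<^sub>m 1\<^sub>m n) = inverse c \<cdot>\<^sub>m 1\<^sub>m n" if "c \<noteq> 0" for c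
    by (rule inv_equality) (use that in \<open>auto simp: scalar_mult_scalar scalar_in_GL smult_one_mat\<close>)
  have "subgroup (scalar_mats n) (GL n)"
  proof (rule subgroupI)
    show "scalar_mats n \<noteq> {}" using zero_neq_one by (auto simp: scalar_mats_def)
    fix a assume "a \<in> scalar_mats n"
    then obtain c where c: "a = c \<cdot>\<^sub>m 1\<^sub>m n" "c \<noteq> 0" by (auto simp: scalar_mats_def)
    then have "inv\<^bsub>GL n\<^esub> a = inverse c \<cdot>\<^sub>m 1\<^sub>m n" "inverse c \<noteq> 0" by (auto simp: inverse)
    then show "inv\<^bsub>GL n\<^esub> a \<in> scalar_mats n" unfolding scalar_mats_def by blast
    fix b assume "b \<in> scalar_mats n"
    then obtain d where d: "b = d \<cdot>\<^sub>m 1\<^sub>m n" "d \<noteq> 0" by (auto simp: scalar_mats_def)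
    have "a \<otimes>\<^bsub>GL n\<^esub> b = (c * d) \<cdot>\<^sub>m 1\<^sub>m n" "c * d \<noteq> 0"
      using c d by (auto simp: scalar_mult_scalar)
    then show "a \<otimes>\<^bsub>GL n\<^esub> b \<in> scalar_mats n" unfolding scalar_mats_def by blast
  qed (rule scalar_mats_subset_GL)
  moreover have "x \<otimes>\<^bsub>GL n\<^esub> h \<otimes>\<^bsub>GL n\<^esub> inv\<^bsub>GL n\<^esub> x \<in> scalar_mats n"
    if x: "x \<in> carrier (GL n)" and h: "h \<in> scalar_mats n" for x h
  proof -
    have "x \<otimes>\<^bsub>GL n\<^esub> h = h \<otimes>\<^bsub>GL n\<^esub> x" using scalar_mats_central[OF GL_carrier_mat[OF x] h] by simp
    moreover have "h \<in> carrier (GL n)" using h scalar_mats_subset_GL by blast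
    ultimately have "x \<otimes>\<^bsub>GL n\<^esub> h \<otimes>\<^bsub>GL n\<^esub> inv\<^bsub>GL n\<^esub> x = h"
      using x by (metis m_assoc inv_closed r_inv r_one)
    then show ?thesis using h by simp
  qed
  ultimately show ?thesis by (rule normal_invI)
qed

lemma PGL_group: "group (PGL n)"
  unfolding PGL_def by (rule normal.factorgroup_is_group[OF scalar_mats_normal])

lemma PGL_coset_hom: "(\<lambda>A. scalar_mats n #>\<^bsub>GL n\<^esub> A) \<in> hom (GL n) (PGL n)"
  unfolding PGL_def by (rule normal.r_coset_hom_Mod[OF scalar_mats_normal])

lemma complex_root_exists:
  fixes c :: complex
  assumes "c \<noteq> 0" "0 < m"
  obtains d where "d \<noteq> 0" "d ^ m = c"
proof (rule that[of "exp (Ln c / of_nat m)"])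
  show "exp (Ln c / of_nat m) \<noteq> 0" by simp
  show "exp (Ln c / of_nat m) ^ m = c"
    using assms by (simp flip: exp_of_nat_mult)
qed

text \<open>The \<open>m\<close>-th power of a matrix over an element of order dividing \<open>m\<close> is a scalar, and dividing
  the matrix by an \<open>m\<close>-th root of this scalar makes the power trivial.\<close>

lemma PGL_lift_preserving_exponent:
  assumes q: "q \<in> carrier (PGL n)" and m: "0 < m" "q [^]\<^bsub>PGL n\<^esub> (m::nat) = \<one>\<^bsub>PGL n\<^esub>"
  obtains M where "M \<in> carrier (GL n)" "scalar_mats n #>\<^bsub>GL n\<^esub> M = q" "M [^]\<^bsub>GL n\<^esub> m = \<one>\<^bsub>GL n\<^esub>"
proof -
  interpret group "GL n" by (rule group_GL)
  interpret S: normal "scalar_mats n" "GL n" by (rule scalar_mats_normal)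
  obtain A where A: "A \<in> carrier (GL n)" "q = scalar_mats n #>\<^bsub>GL n\<^esub> A"
    using q by (auto simp: PGL_def carrier_FactGroup)
  have "scalar_mats n #>\<^bsub>GL n\<^esub> (A [^]\<^bsub>GL n\<^esub> m) = scalar_mats n"
    using m(2) A by (simp add: PGL_def S.FactGroup_pow)
  then have "A [^]\<^bsub>GL n\<^esub> m \<in> scalar_mats n"
    by (rule coset_join1) (use A S.subgroup_axioms in auto)
  then obtain c where c: "A [^]\<^bsub>GL n\<^esub> m = c \<cdot>\<^sub>m 1\<^sub>m n" "c \<noteq> 0" by (auto simp: scalar_mats_def)
  obtain d where d: "d \<noteq> 0" "d ^ m = c" using complex_root_exists[OF c(2) m(1)] .
  define s where "s = inverse d \<cdot>\<^sub>m (1\<^sub>m n :: complex mat)"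
  have sS: "s \<in> scalar_mats n" unfolding s_def scalar_mats_def using d by force
  then have sG: "s \<in> carrier (GL n)" using scalar_mats_subset_GL by blast
  have comm: "s \<otimes>\<^bsub>GL n\<^esub> A = A \<otimes>\<^bsub>GL n\<^esub> s"
    using scalar_mats_central[OF GL_carrier_mat[OF A(1)] sS] by simp
  show thesis
  proof
    show "s \<otimes>\<^bsub>GL n\<^esub> A \<in> carrier (GL n)" using sG A(1) by (rule m_closed)
    have "scalar_mats n #>\<^bsub>GL n\<^esub> s #>\<^bsub>GL n\<^esub> A = scalar_mats n #>\<^bsub>GL n\<^esub> (s \<otimes>\<^bsub>GL n\<^esub> A)"
      by (rule coset_mult_assoc[OF S.subset sG A(1)])
    then show "scalar_mats n #>\<^bsub>GL n\<^esub> (s \<otimes>\<^bsub>GL n\<^esub> A) = q"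
      by (simp only: S.rcos_const[OF group_GL sS] A(2))
    have "(s \<otimes>\<^bsub>GL n\<^esub> A) [^]\<^bsub>GL n\<^esub> m = s [^]\<^bsub>GL n\<^esub> m \<otimes>\<^bsub>GL n\<^esub> (A [^]\<^bsub>GL n\<^esub> m)"
      by (rule pow_mult_distrib[OF comm sG A(1)])
    also have "\<dots> = (inverse d ^ m * c) \<cdot>\<^sub>m 1\<^sub>m n"
      by (simp add: s_def scalar_pow c(1) scalar_mult_scalar)
    also have "inverse d ^ m * c = 1" using d by (simp add: power_inverse flip: d(2))
    finally show "(s \<otimes>\<^bsub>GL n\<^esub> A) [^]\<^bsub>GL n\<^esub> m = \<one>\<^bsub>GL n\<^esub>" by (simp add: smult_one_mat)
  qed
qed

lemma (in group) ord_inverse: "x \<in> carrier G \<Longrightarrow> ord (inv x) = ord x"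
  by (rule dvd_antisym) (simp_all add: nat_pow_inv flip: pow_eq_id)

definition inverse_pairs :: "('a, 'b) monoid_scheme \<Rightarrow> 'a list \<Rightarrow> 'a list" where
  "inverse_pairs G xs = concat (map (\<lambda>x. [x, inv\<^bsub>G\<^esub> x]) xs)"

lemma (in group) inverse_pairs_product:
  "set xs \<subseteq> carrier G \<Longrightarrow> list_mult G (inverse_pairs G xs) = \<one>"
  by (induction xs) (simp_all add: inverse_pairs_def list_mult_def)

lemma inverse_pairs_nth:
  assumes "i < 2 * length xs"
  shows "inverse_pairs G xs ! i = (if even i then xs ! (i div 2) else inv\<^bsub>G\<^esub> (xs ! (i div 2)))"
  using assms
proof (induction xs arbitrary: i)
  case (Cons x xs)
  have e: "inverse_pairs G (x # xs) = x # inv\<^bsub>G\<^esub> x # inverse_pairs G xs"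
    by (simp add: inverse_pairs_def)
  consider "i = 0" | "i = 1" | j where "i = Suc (Suc j)" by (metis One_nat_def not0_implies_Suc)
  then show ?case
    by cases (use Cons e in auto)
qed simp

lemma length_inverse_pairs [simp]: "length (inverse_pairs G xs) = 2 * length xs"
  by (induction xs) (simp_all add: inverse_pairs_def)

lemma set_inverse_pairs: "set (inverse_pairs G xs) = set xs \<union> (\<lambda>x. inv\<^bsub>G\<^esub> x) ` set xs"
  by (auto simp: inverse_pairs_def)

context group
begin

lemma inverse_pairs_elliptic:
  assumes "finite (carrier G)" "set xs = carrier G - {\<one>}" "carrier G \<noteq> {\<one>}"
  shows "elliptic_system G (inverse_pairs G xs)"
  unfolding elliptic_system_def
proof (intro conjI ballI)
  have xs: "set xs \<subseteq> carrier G" using assms(2) by auto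
  have "xs \<noteq> []"
  proof
    assume "xs = []"
    then have "carrier G \<subseteq> {\<one>}" using assms(2) by simp
    then show False using assms(3) one_closed by blast
  qed
  then show "inverse_pairs G xs \<noteq> []" by (cases xs) (simp_all add: inverse_pairs_def)
  show sub: "set (inverse_pairs G xs) \<subseteq> carrier G" using xs by (auto simp: set_inverse_pairs)
  show "generate G (set (inverse_pairs G xs)) = carrier G"
  proof
    show "generate G (set (inverse_pairs G xs)) \<subseteq> carrier G" by (rule generate_incl[OF sub])
    show "carrier G \<subseteq> generate G (set (inverse_pairs G xs))"
    proof
      fix g assume "g \<in> carrier G"
      then have "g = \<one> \<or> g \<in> set (inverse_pairs G xs)" using assms(2) by (auto simp: set_inverse_pairs)
      then show "g \<in> generate G (set (inverse_pairs G xs))"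
        by (auto intro: generate.incl generate.one)
    qed
  qed
  show "list_mult G (inverse_pairs G xs) = \<one>" by (rule inverse_pairs_product[OF xs])
  fix g assume "g \<in> set (inverse_pairs G xs)"
  then obtain x where x: "x \<in> carrier G" "x \<noteq> \<one>" "g = x \<or> g = inv x"
    using assms(2) by (auto simp: set_inverse_pairs)
  have "ord x \<noteq> 1" using x ord_eq_1 by blast
  then show "1 < ord g" using x ord_ge_1[OF assms(1) x(1)] by (auto simp: ord_inverse)
qed

end

text \<open>The generators of \<open>\<Delta>\<close> are sent to lifts of the same orders, and to mutually inverse lifts in
  each pair; their product is then exactly \<open>1\<close>, and not merely a scalar.\<close>

lemma inverse_pairs_projective_lift:
  assumes "group G" "finite (carrier G)" "set xs \<subseteq> carrier G"
    and gs: "gs = inverse_pairs G xs"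
    and pres: "elliptic_presentation G gs \<phi>"
    and \<rho>: "\<rho> \<in> hom G (PGL n)"
  obtains \<psi> where "\<psi> \<in> hom (Delta (signature G gs)) (GL n)"
    "\<And>x. x \<in> carrier (Delta (signature G gs)) \<Longrightarrow> scalar_mats n #>\<^bsub>GL n\<^esub> \<psi> x = \<rho> (\<phi> x)"
proof -
  interpret G: group G by fact
  interpret GL: group "GL n" by (rule group_GL)
  interpret P: group "PGL n" by (rule PGL_group)
  interpret \<rho>: group_hom G "PGL n" \<rho>
    using assms(1) PGL_group \<rho> by (simp add: group_hom_def group_hom_axioms_def)
  interpret q: group_hom "GL n" "PGL n" "\<lambda>A. scalar_mats n #>\<^bsub>GL n\<^esub> A"
    using group_GL PGL_group PGL_coset_hom by (simp add: group_hom_def group_hom_axioms_def)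
  interpret X: elliptic_extension G gs \<phi> by unfold_locales (use assms in auto)
  let ?\<Delta> = "Delta (signature G gs)"
  have "\<exists>M. M \<in> carrier (GL n) \<and> scalar_mats n #>\<^bsub>GL n\<^esub> M = \<rho> g \<and> M [^]\<^bsub>GL n\<^esub> G.ord g = \<one>\<^bsub>GL n\<^esub>"
    if g: "g \<in> carrier G" for g
  proof -
    have "0 < G.ord g" using G.ord_ge_1[OF assms(2) g] by simp
    moreover have "\<rho> g [^]\<^bsub>PGL n\<^esub> G.ord g = \<one>\<^bsub>PGL n\<^esub>"
      using g \<rho>.hom_nat_pow[OF g, of "G.ord g"] by simp
    ultimately show ?thesis
      using PGL_lift_preserving_exponent[of "\<rho> g" n "G.ord g"] g by (metis \<rho>.hom_closed)
  qed
  then obtain M where M: "\<And>g. g \<in> carrier G \<Longrightarrow> M g \<in> carrier (GL n) \<and>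
      scalar_mats n #>\<^bsub>GL n\<^esub> M g = \<rho> g \<and> M g [^]\<^bsub>GL n\<^esub> G.ord g = \<one>\<^bsub>GL n\<^esub>"
    by metis
  define Ms where "Ms = inverse_pairs (GL n) (map M xs)"
  have len: "length gs = 2 * length xs" "length Ms = 2 * length xs" by (simp_all add: gs Ms_def)
  have nth: "Ms ! i \<in> carrier (GL n) \<and> scalar_mats n #>\<^bsub>GL n\<^esub> (Ms ! i) = \<rho> (gs ! i) \<and>
      Ms ! i [^]\<^bsub>GL n\<^esub> (signature G gs ! i) = \<one>\<^bsub>GL n\<^esub>" if i: "i < length gs" for i
  proof -
    define g where "g = xs ! (i div 2)"
    have i2: "i div 2 < length xs" "i < 2 * length xs" "i < 2 * length (map M xs)"
      using i len by auto
    then have g: "g \<in> carrier G" using assms(3) by (auto simp: g_def)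
    have sig: "signature G gs ! i = G.ord (gs ! i)" using i by (simp add: signature_def)
    have a: "gs ! i = (if even i then g else inv\<^bsub>G\<^esub> g)"
      unfolding gs g_def by (rule inverse_pairs_nth[OF i2(2)])
    have b: "Ms ! i = (if even i then M g else inv\<^bsub>GL n\<^esub> M g)"
      unfolding Ms_def g_def using inverse_pairs_nth[OF i2(3), of "GL n"] i2(1) by simp
    show ?thesis
      unfolding sig a b using M[OF g] g
      by (auto simp: G.ord_inverse GL.nat_pow_inv q.hom_inv \<rho>.hom_inv simp del: GL_mult GL_one)
  qed
  have "map ((!) Ms) [0..<length (signature G gs)] = Ms"
    using len by (metis X.length_signature map_nth)
  moreover have "list_mult (GL n) Ms = \<one>\<^bsub>GL n\<^esub>"
    unfolding Ms_def by (rule GL.inverse_pairs_product) (use M assms(3) in auto)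
  ultimately obtain \<psi> where \<psi>: "\<psi> \<in> hom ?\<Delta> (GL n)"
    "\<And>i. i < length gs \<Longrightarrow> \<psi> (Delta_gen (signature G gs) i) = Ms ! i"
    using GL.Delta_universal[of "signature G gs" "(!) Ms"] nth by auto
  show thesis
  proof (rule that[OF \<psi>(1)])
    fix x assume x: "x \<in> carrier ?\<Delta>"
    have h1: "(\<lambda>x. scalar_mats n #>\<^bsub>GL n\<^esub> \<psi> x) \<in> hom ?\<Delta> (PGL n)"
      using hom_compose[OF \<psi>(1) PGL_coset_hom] by (simp add: comp_def)
    have h2: "(\<lambda>x. \<rho> (\<phi> x)) \<in> hom ?\<Delta> (PGL n)"
      using hom_compose[OF X.phi_hom \<rho>] by (simp add: comp_def)
    show "scalar_mats n #>\<^bsub>GL n\<^esub> \<psi> x = \<rho> (\<phi> x)"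
    proof (rule hom_eq_on_generate[OF group_Delta PGL_group h1 h2])
      show "Delta_gen (signature G gs) ` {..<length gs} \<subseteq> carrier ?\<Delta>"
        by (auto simp: Delta_gen_closed)
      show "x \<in> generate ?\<Delta> (Delta_gen (signature G gs) ` {..<length gs})"
        using x Delta_generated[of "signature G gs"] by simp
    qed (use nth \<psi>(2) X.phi_gen in auto)
  qed
qed

text \<open>A lift to \<open>\<Delta>\<close> sends \<open>S\<close> to scalar matrices, which are central, and so kills \<open>[S, \<Delta>]\<close>.\<close>

lemma (in elliptic_extension) projective_lift_descends:
  assumes \<psi>: "\<psi> \<in> hom \<Delta> (GL n)" and \<rho>: "\<rho> \<in> hom G (PGL n)"
    and lift: "\<And>x. x \<in> carrier \<Delta> \<Longrightarrow> scalar_mats n #>\<^bsub>GL n\<^esub> \<psi> x = \<rho> (\<phi> x)"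
  obtains \<sigma> where "\<sigma> \<in> hom D (GL n)"
    "\<And>x. x \<in> carrier D \<Longrightarrow> scalar_mats n #>\<^bsub>GL n\<^esub> \<sigma> x = \<rho> (\<pi> x)"
proof -
  interpret GL: group "GL n" by (rule group_GL)
  interpret S: normal "scalar_mats n" "GL n" by (rule scalar_mats_normal)
  interpret \<psi>: group_hom \<Delta> "GL n" \<psi>
    using group_Delta group_GL \<psi> by (simp add: group_hom_def group_hom_axioms_def)
  have scalar: "\<psi> s \<in> scalar_mats n" if "s \<in> kernel \<Delta> G \<phi>" for s
  proof -
    have s: "s \<in> carrier \<Delta>" "\<phi> s = \<one>" using that by (auto simp: kernel_def)
    have "scalar_mats n #>\<^bsub>GL n\<^esub> \<psi> s = scalar_mats n"
      using lift[OF s(1)] hom_one[OF \<rho> group_G PGL_group] s by (simp add: PGL_def)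
    then show ?thesis by (rule GL.coset_join1) (use s S.subgroup_axioms in auto)
  qed
  have "N \<subseteq> kernel \<Delta> (GL n) \<psi>"
    unfolding N_eq
  proof (rule \<psi>.commutator_subgroup_in_kernel)
    fix k x assume k: "k \<in> kernel \<Delta> G \<phi>" and x: "x \<in> carrier \<Delta>"
    show "\<psi> k \<otimes>\<^bsub>GL n\<^esub> \<psi> x = \<psi> x \<otimes>\<^bsub>GL n\<^esub> \<psi> k"
      using scalar_mats_central[OF GL_carrier_mat[OF \<psi>.hom_closed[OF x]] scalar[OF k]] by simp
  qed (auto simp: kernel_def)
  then have wd: "\<psi> x = \<psi> z" if xz: "x \<in> carrier \<Delta>" "z \<in> carrier \<Delta>" "N #>\<^bsub>\<Delta>\<^esub> x = N #>\<^bsub>\<Delta>\<^esub> z" for x z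
  proof -
    have "x \<in> N #>\<^bsub>\<Delta>\<^esub> z" using \<phi>.G.rcos_self[OF xz(1) N.subgroup_axioms] xz(3) by simp
    then obtain m where m: "m \<in> N" "x = m \<otimes>\<^bsub>\<Delta>\<^esub> z" by (auto simp: r_coset_def)
    then have "m \<in> carrier \<Delta>" "\<psi> m = \<one>\<^bsub>GL n\<^esub>"
      using \<open>N \<subseteq> kernel \<Delta> (GL n) \<psi>\<close> by (auto simp: kernel_def)
    then show ?thesis using m(2) xz(2) by (simp only: \<psi>.hom_mult GL.l_one \<psi>.hom_closed)
  qed
  obtain \<sigma> where \<sigma>: "\<sigma> \<in> hom (\<Delta> Mod N) (GL n)" "\<And>x. x \<in> carrier \<Delta> \<Longrightarrow> \<sigma> (N #>\<^bsub>\<Delta>\<^esub> x) = \<psi> x"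
    using FactGroup_universal[OF \<psi> N.normal_axioms wd] by metis
  show thesis
    by (rule that[of \<sigma>]) (use \<sigma> lift in \<open>auto simp: D_eq carrier_FactGroup proj_coset\<close>)
qed

theorem elliptic_cover_exists:
  assumes "group G" "finite (carrier G)" "carrier G \<noteq> {\<one>\<^bsub>G\<^esub>}"
  shows "\<exists>gs \<phi>. elliptic_presentation G gs \<phi> \<and>
    group_cover (elliptic_central_kernel G gs \<phi>) (elliptic_central G gs \<phi>) G
      (elliptic_central_proj \<phi>)"
proof -
  interpret group G by fact
  obtain xs where xs: "set xs = carrier G - {\<one>\<^bsub>G\<^esub>}"
    using finite_list[of "carrier G - {\<one>\<^bsub>G\<^esub>}"] assms(2) by auto
  define gs where "gs = inverse_pairs G xs"
  have ell: "elliptic_system G gs"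
    unfolding gs_def by (rule inverse_pairs_elliptic[OF assms(2) xs assms(3)])
  then have gs: "set gs \<subseteq> carrier G" "list_mult G gs = \<one>\<^bsub>G\<^esub>" by (auto simp: elliptic_system_def)
  have len: "length (signature G gs) = length gs" by (simp add: signature_def)
  have nth: "gs ! i \<in> carrier G" if "i < length gs" for i using gs(1) that by auto
  obtain \<phi> where \<phi>: "\<phi> \<in> hom (Delta (signature G gs)) G"
    "\<And>i. i < length (signature G gs) \<Longrightarrow> \<phi> (Delta_gen (signature G gs) i) = gs ! i"
  proof (rule Delta_universal[of "signature G gs" "(!) gs"])
    show "list_mult G (map ((!) gs) [0..<length (signature G gs)]) = \<one>\<^bsub>G\<^esub>"
      using gs(2) by (simp add: len map_nth)
  qed (auto simp: len signature_def nth)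
  then have pres: "elliptic_presentation G gs \<phi>"
    using ell by (simp add: elliptic_presentation_def len)
  interpret X: elliptic_extension G gs \<phi> using assms(1) pres by unfold_locales
  have "\<exists>\<sigma>\<in>hom X.D (GL n). \<forall>x\<in>carrier X.D. scalar_mats n #>\<^bsub>GL n\<^esub> \<sigma> x = \<rho> (X.\<pi> x)"
    if \<rho>: "\<rho> \<in> hom G (PGL n)" for n \<rho>
  proof -
    obtain \<psi> where "\<psi> \<in> hom X.\<Delta> (GL n)"
      "\<And>x. x \<in> carrier X.\<Delta> \<Longrightarrow> scalar_mats n #>\<^bsub>GL n\<^esub> \<psi> x = \<rho> (\<phi> x)"
      using inverse_pairs_projective_lift[OF assms(1,2) _ gs_def pres \<rho>] xs by auto
    then show ?thesis using X.projective_lift_descends[OF _ \<rho>] by metis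
  qed
  then have "group_cover (elliptic_central_kernel G gs \<phi>) X.D G X.\<pi>"
    unfolding group_cover_def using X.central_extension_D X.finite_D[OF assms(2)] by blast
  then show ?thesis using pres by blast
qed

section \<open>Geometric realizations\<close>

text \<open>The point of the realization with barycentric coordinates \<open>t\<close> in the \<open>n\<close>-simplex \<open>\<sigma>\<close>.\<close>

definition pt :: "'c dcomplex \<Rightarrow> nat \<Rightarrow> 'c \<Rightarrow> (nat \<Rightarrow> real) \<Rightarrow> 'c dpoint set" where
  "pt X n \<sigma> t = glue X `` {((n, \<sigma>), t)}"

lemma simplex_topology:
  "subtopology (powertop_real UNIV) (standard_simplex n) = top_of_set (standard_simplex n)"
  by (simp only: euclidean_product_topology)

lemma topspace_simplex_sum:
  "topspace (simplex_sum X) = {((n, \<sigma>), t) | n \<sigma> t. \<sigma> \<in> cells X n \<and> t \<in> standard_simplex n}"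
  by (auto simp: simplex_sum_def topspace_standard_simplex)

lemma mem_topspace_simplex_sum [simp]:
  "((n, \<sigma>), t) \<in> topspace (simplex_sum X) \<longleftrightarrow> \<sigma> \<in> cells X n \<and> t \<in> standard_simplex n"
  by (simp add: topspace_simplex_sum)

lemma openin_simplex_sum:
  "openin (simplex_sum X) U \<longleftrightarrow> U \<subseteq> topspace (simplex_sum X) \<and>
    (\<forall>n. \<forall>\<sigma>\<in>cells X n. openin (top_of_set (standard_simplex n)) {t. ((n, \<sigma>), t) \<in> U})"
proof -
  have "openin (simplex_sum X) U \<longleftrightarrow>
      U \<subseteq> topspace (simplex_sum X) \<and> (\<forall>i \<in> (SIGMA n:UNIV. cells X n).
        openin (case i of (n, \<sigma>) \<Rightarrow> subtopology (powertop_real UNIV) (standard_simplex n)) {x. (i, x) \<in> U})"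
    unfolding simplex_sum_def openin_sum_topology topspace_sum_topology ..
  then show ?thesis by (simp add: simplex_topology split_paired_Ball_Sigma)
qed

lemma standard_simplex_face:
  "t \<in> standard_simplex n \<Longrightarrow> k \<le> Suc n \<Longrightarrow> simplical_face k t \<in> standard_simplex (Suc n)"
  using simplical_face_in_standard_simplex[of "Suc n" k t] by simp

lemma equiv_glue: "equiv (topspace (simplex_sum X)) (glue X)"
proof (rule equivI)
  let ?R = "(face_rel X \<union> (face_rel X)\<inverse>)\<^sup>*"
  show "glue X \<subseteq> topspace (simplex_sum X) \<times> topspace (simplex_sum X)" by (auto simp: glue_def)
  show "refl_on (topspace (simplex_sum X)) (glue X)" by (auto simp: refl_on_def glue_def)
  have "sym ?R" by (intro sym_rtrancl) (auto simp: sym_def)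
  then show "sym (glue X)" by (auto simp: glue_def sym_def)
  have "trans ?R" by (rule trans_rtrancl)
  then show "trans (glue X)" unfolding glue_def trans_def by blast
qed

text \<open>To see that a function is constant on the points of the realization, it suffices to compare its
  values on a face with those on the simplex.\<close>

lemma glue_invariant:
  assumes "(a, b) \<in> glue X" and inv: "\<And>a b. (a, b) \<in> face_rel X \<Longrightarrow> f a = f b"
  shows "f a = f b"
proof -
  have "(a, b) \<in> (face_rel X \<union> (face_rel X)\<inverse>)\<^sup>*" using assms by (simp add: glue_def)
  then show ?thesis by (induction rule: rtrancl_induct) (auto dest: inv)
qed

lemma realization_quotient_map:
  "quotient_map (simplex_sum X) (realization X) (\<lambda>p. glue X `` {p})"
  and topspace_realization: "topspace (realization X) = topspace (simplex_sum X) // glue X"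
proof -
  let ?Z = "simplex_sum X"
  have o: "openin (realization X) U \<longleftrightarrow>
      U \<subseteq> topspace ?Z // glue X \<and> openin ?Z {x \<in> topspace ?Z. glue X `` {x} \<in> U}" for U
    unfolding realization_def by (rule openin_quotient_topology)
  have e: "{x \<in> topspace ?Z. glue X `` {x} \<in> topspace ?Z // glue X} = topspace ?Z"
    by (blast intro: quotientI)
  have "openin (realization X) (topspace ?Z // glue X)"
    unfolding o e by (simp only: openin_topspace subset_refl simp_thms)
  then have "topspace ?Z // glue X \<subseteq> topspace (realization X)" by (rule openin_subset)
  moreover have "topspace (realization X) \<subseteq> topspace ?Z // glue X"
    using openin_topspace[of "realization X"] unfolding o by (rule conjunct1)
  ultimately show t: "topspace (realization X) = topspace ?Z // glue X" by (rule subset_antisym[rotated])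
  show "quotient_map ?Z (realization X) (\<lambda>p. glue X `` {p})"
    unfolding quotient_map_def t
  proof (intro conjI allI impI)
    show "(\<lambda>p. glue X `` {p}) ` topspace ?Z = topspace ?Z // glue X" unfolding quotient_def by blast
    fix U assume "U \<subseteq> topspace ?Z // glue X"
    then show "openin ?Z {x \<in> topspace ?Z. glue X `` {x} \<in> U} = openin (realization X) U"
      using o by blast
  qed
qed

lemma pt_in_realization:
  "\<sigma> \<in> cells X n \<Longrightarrow> t \<in> standard_simplex n \<Longrightarrow> pt X n \<sigma> t \<in> topspace (realization X)"
  unfolding pt_def topspace_realization by (rule quotientI) simp

lemma realization_point:
  assumes "P \<in> topspace (realization X)"
  obtains n \<sigma> t where "\<sigma> \<in> cells X n" "t \<in> standard_simplex n" "P = pt X n \<sigma> t"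
proof -
  obtain p where p: "p \<in> topspace (simplex_sum X)" "P = glue X `` {p}"
    using assms unfolding topspace_realization by (rule quotientE)
  then obtain n \<sigma> t where "p = ((n, \<sigma>), t)" "\<sigma> \<in> cells X n" "t \<in> standard_simplex n"
    unfolding topspace_simplex_sum by blast
  then show thesis using p(2) that unfolding pt_def by blast
qed

lemma continuous_map_realization:
  assumes "\<And>n \<sigma>. \<sigma> \<in> cells X n \<Longrightarrow>
    continuous_map (top_of_set (standard_simplex n)) Z (\<lambda>t. f (pt X n \<sigma> t))"
  shows "continuous_map (realization X) Z f"
proof -
  have "continuous_map (simplex_sum X) Z (\<lambda>p. f (glue X `` {p}))"
    unfolding continuous_map_def
  proof (intro conjI allI impI)
    show "(\<lambda>p. f (glue X `` {p})) \<in> topspace (simplex_sum X) \<rightarrow> topspace Z"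
      using assms by (fastforce simp: topspace_simplex_sum continuous_map_def pt_def)
    fix U assume U: "openin Z U"
    show "openin (simplex_sum X) {p \<in> topspace (simplex_sum X). f (glue X `` {p}) \<in> U}"
      unfolding openin_simplex_sum
    proof (intro conjI allI ballI)
      fix n \<sigma> assume \<sigma>: "\<sigma> \<in> cells X n"
      have "openin (top_of_set (standard_simplex n))
          {t \<in> topspace (top_of_set (standard_simplex n)). f (pt X n \<sigma> t) \<in> U}"
        using assms[OF \<sigma>] U by (rule openin_continuous_map_preimage)
      then show "openin (top_of_set (standard_simplex n))
          {t. ((n, \<sigma>), t) \<in> {p \<in> topspace (simplex_sum X). f (glue X `` {p}) \<in> U}}"
        using \<sigma> by (simp add: pt_def)
    qed blast
  qed
  then show ?thesis
    using continuous_compose_quotient_map_eq[OF realization_quotient_map, of X Z f]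
    by (simp add: comp_def)
qed

lemma continuous_map_pt:
  assumes "\<sigma> \<in> cells X n"
  shows "continuous_map (top_of_set (standard_simplex n)) (realization X) (pt X n \<sigma>)"
proof -
  have "continuous_map (top_of_set (standard_simplex n)) (simplex_sum X) (\<lambda>t. ((n, \<sigma>), t))"
    unfolding continuous_map_def
  proof (intro conjI allI impI)
    fix U assume "openin (simplex_sum X) U"
    then have o: "openin (top_of_set (standard_simplex n)) {t. ((n, \<sigma>), t) \<in> U}"
      using assms by (auto simp: openin_simplex_sum)
    then have "{t \<in> topspace (top_of_set (standard_simplex n)). ((n, \<sigma>), t) \<in> U} = {t. ((n, \<sigma>), t) \<in> U}"
      using openin_subset by fastforce
    then show "openin (top_of_set (standard_simplex n))
        {t \<in> topspace (top_of_set (standard_simplex n)). ((n, \<sigma>), t) \<in> U}" using o by simp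
  qed (use assms in auto)
  then have "continuous_map (top_of_set (standard_simplex n)) (realization X)
      ((\<lambda>p. glue X `` {p}) \<circ> (\<lambda>t. ((n, \<sigma>), t)))"
    by (rule continuous_map_compose[OF _ quotient_imp_continuous_map[OF realization_quotient_map]])
  then show ?thesis by (simp add: comp_def pt_def[abs_def])
qed

lemma pt_eq_iff:
  assumes "\<sigma> \<in> cells X n" "t \<in> standard_simplex n" "\<tau> \<in> cells X m" "s \<in> standard_simplex m"
  shows "pt X n \<sigma> t = pt X m \<tau> s \<longleftrightarrow> (((n, \<sigma>), t), ((m, \<tau>), s)) \<in> glue X"
  unfolding pt_def by (rule eq_equiv_class_iff[OF equiv_glue]) (use assms in auto)

lemma pt_face:
  assumes "delta_complex X" "\<sigma> \<in> cells X (Suc n)" "k \<le> Suc n" "t \<in> standard_simplex n"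
  shows "pt X n (face X k \<sigma>) t = pt X (Suc n) \<sigma> (simplical_face k t)"
proof -
  have f: "face X k \<sigma> \<in> cells X n" using assms by (simp add: delta_complex_def)
  have "(((n, face X k \<sigma>), t), ((Suc n, \<sigma>), simplical_face k t)) \<in> face_rel X"
    using assms unfolding face_rel_def by blast
  then have "(((n, face X k \<sigma>), t), ((Suc n, \<sigma>), simplical_face k t)) \<in> glue X"
    unfolding glue_def using assms f standard_simplex_face[of t n k] by auto
  then show ?thesis
    using pt_eq_iff[OF f assms(4,2)] standard_simplex_face[OF assms(4,3)] by simp
qed

lemma compact_realization:
  assumes "finite (SIGMA n:UNIV. cells X n)"
  shows "compact_space (realization X)"
proof -
  let ?I = "SIGMA n:UNIV. cells X n"
  have "compactin (realization X) (pt X (fst i) (snd i) ` standard_simplex (fst i))" if "i \<in> ?I" for i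
  proof (rule image_compactin)
    show "compactin (top_of_set (standard_simplex (fst i))) (standard_simplex (fst i))"
      using compactin_standard_simplex[of "fst i"] by (simp add: compactin_subtopology euclidean_product_topology)
    show "continuous_map (top_of_set (standard_simplex (fst i))) (realization X) (pt X (fst i) (snd i))"
      by (rule continuous_map_pt) (use that in auto)
  qed
  then have "compactin (realization X) (\<Union>i\<in>?I. pt X (fst i) (snd i) ` standard_simplex (fst i))"
    using assms by (intro compactin_Union) auto
  moreover have "(\<Union>i\<in>?I. pt X (fst i) (snd i) ` standard_simplex (fst i)) = topspace (realization X)"
    by (auto simp: pt_in_realization elim!: realization_point) force
  ultimately show ?thesis by (simp add: compact_space_def)
qed

text \<open>A function on the disjoint union of the simplices that respects the gluing, viewed as a function
  on the realization.\<close>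

definition descend :: "('c dpoint \<Rightarrow> 'v) \<Rightarrow> 'c dpoint set \<Rightarrow> 'v" where
  "descend f P = the_elem (f ` P)"

lemma descend_pt:
  assumes "\<And>n k \<sigma> t. \<lbrakk>\<sigma> \<in> cells X (Suc n); k \<le> Suc n; t \<in> standard_simplex n\<rbrakk>
      \<Longrightarrow> f ((n, face X k \<sigma>), t) = f ((Suc n, \<sigma>), simplical_face k t)"
    and "\<sigma> \<in> cells X n" "t \<in> standard_simplex n"
  shows "descend f (pt X n \<sigma> t) = f ((n, \<sigma>), t)"
proof -
  have inv: "f a = f b" if "(a, b) \<in> face_rel X" for a b
    using that assms(1) by (auto simp: face_rel_def)
  have "f ` pt X n \<sigma> t = {f ((n, \<sigma>), t)}"
  proof (intro equalityI subsetI)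
    fix v assume "v \<in> f ` pt X n \<sigma> t"
    then obtain q where q: "(((n, \<sigma>), t), q) \<in> glue X" "v = f q" unfolding pt_def by blast
    have "f ((n, \<sigma>), t) = f q" by (rule glue_invariant[OF q(1)]) (rule inv)
    then show "v \<in> {f ((n, \<sigma>), t)}" using q(2) by simp
  next
    fix v assume "v \<in> {f ((n, \<sigma>), t)}"
    moreover have "((n, \<sigma>), t) \<in> pt X n \<sigma> t"
      unfolding pt_def by (rule equiv_class_self[OF equiv_glue]) (use assms in auto)
    ultimately show "v \<in> f ` pt X n \<sigma> t" by blast
  qed
  then show ?thesis by (simp add: descend_def)
qed

lemma realization_map_pt:
  assumes "delta_complex Y" and simp: "simplicial X Y f"
    and \<sigma>: "\<sigma> \<in> cells X n" "t \<in> standard_simplex n"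
  shows "realization_map Y f (pt X n \<sigma> t) = pt Y n (f \<sigma>) t"
proof -
  let ?g = "\<lambda>((n, \<sigma>), t). pt Y n (f \<sigma>) t"
  have inv: "?g a = ?g b" if rel: "(a, b) \<in> face_rel X" for a b
  proof -
    obtain n k \<sigma> t where ab: "a = ((n, face X k \<sigma>), t)" "b = ((Suc n, \<sigma>), simplical_face k t)"
      "\<sigma> \<in> cells X (Suc n)" "k \<le> Suc n" "t \<in> standard_simplex n"
      using rel by (auto simp: face_rel_def)
    have "f \<sigma> \<in> cells Y (Suc n)" "face Y k (f \<sigma>) = f (face X k \<sigma>)"
      using simp ab by (auto simp: simplicial_def)
    then show ?thesis using pt_face[OF assms(1) _ ab(4,5), of "f \<sigma>"] by (simp add: ab)
  qed
  have "?g q = pt Y n (f \<sigma>) t" if "q \<in> pt X n \<sigma> t" for q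
  proof -
    have "?g ((n, \<sigma>), t) = ?g q"
      by (rule glue_invariant[where X = X]) (use that inv in \<open>auto simp: pt_def\<close>)
    then show ?thesis by simp
  qed
  moreover have "((n, \<sigma>), t) \<in> pt X n \<sigma> t"
    unfolding pt_def by (rule equiv_class_self[OF equiv_glue]) (use \<sigma> in auto)
  moreover have "realization_map Y f (pt X n \<sigma> t) = (\<Union>q\<in>pt X n \<sigma> t. ?g q)"
    unfolding realization_map_def pt_def by (simp add: case_prod_beta)
  ultimately show ?thesis by blast
qed

lemma realization_map_continuous:
  assumes "delta_complex Y" "simplicial X Y f"
  shows "continuous_map (realization X) (realization Y) (realization_map Y f)"
proof (rule continuous_map_realization)
  fix n \<sigma> assume \<sigma>: "\<sigma> \<in> cells X n"
  then have "f \<sigma> \<in> cells Y n" using assms(2) by (auto simp: simplicial_def)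
  then show "continuous_map (top_of_set (standard_simplex n)) (realization Y)
      (\<lambda>t. realization_map Y f (pt X n \<sigma> t))"
    by (rule continuous_map_eq[OF continuous_map_pt]) (simp add: realization_map_pt[OF assms \<sigma>])
qed

section \<open>Triangulated complexes and barycentric coordinates\<close>

(* keeps the dimension and face number 1 from being rewritten to Suc 0 *)
declare One_nat_def [simp del]

text \<open>Vertex number \<open>k\<close> of a triangle; other choices of the two faces give the same vertices
  by the simplicial identities.\<close>

definition corner :: "'c dcomplex \<Rightarrow> 'c \<Rightarrow> nat \<Rightarrow> 'c" where
  "corner X \<tau> k = (if k = 0 then face X 1 (face X 2 \<tau>)
     else if k = 1 then face X 0 (face X 2 \<tau>) else face X 0 (face X 1 \<tau>))"

lemma simplex0: "t \<in> standard_simplex 0 \<Longrightarrow> t 0 = 1 \<and> (\<forall>i>0. t i = 0)"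
  by (auto simp: standard_simplex_def)

lemma simplex1: "t \<in> standard_simplex 1 \<Longrightarrow> 0 \<le> t 0 \<and> 0 \<le> t 1 \<and> t 0 + t 1 = 1 \<and> (\<forall>i>1. t i = 0)"
  by (auto simp: standard_simplex_def One_nat_def)

lemma atMost_2: "{..2} = {0, 1, 2::nat}"
  by auto

lemma le_2_cases: "(k::nat) \<le> 2 \<longleftrightarrow> k = 0 \<or> k = 1 \<or> k = 2"
  by auto

lemma simplex2:
  "t \<in> standard_simplex 2 \<longleftrightarrow>
     0 \<le> t 0 \<and> 0 \<le> t 1 \<and> 0 \<le> t 2 \<and> t 0 + t 1 + t 2 = 1 \<and> (\<forall>i>2. t i = 0)"
  (is "_ \<longleftrightarrow> ?R")
proof
  assume "t \<in> standard_simplex 2"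
  then show ?R by (auto simp: standard_simplex_def atMost_2)
next
  assume R: ?R
  have "0 \<le> t i \<and> t i \<le> 1" for i
  proof (cases "i \<le> 2")
    case True then show ?thesis using R unfolding le_2_cases by auto
  next
    case False then show ?thesis using R by simp
  qed
  then show "t \<in> standard_simplex 2" using R by (auto simp: standard_simplex_def atMost_2)
qed

text \<open>The tool for polar coordinates: the angular factor \<open>g\<close> is bounded, so its discontinuity at the zeros
  of the radial factor \<open>f\<close> does no harm.\<close>

lemma continuous_on_mult_bounded:
  fixes f :: "'a::topological_space \<Rightarrow> real" and g :: "'a \<Rightarrow> complex"
  assumes f: "continuous_on S f" and g: "continuous_on {x \<in> S. f x \<noteq> 0} g" and b: "\<And>x. norm (g x) \<le> 1"
  shows "continuous_on S (\<lambda>x. of_real (f x) * g x)"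
  unfolding continuous_on_def
proof
  fix x assume x: "x \<in> S"
  have fx: "(f \<longlongrightarrow> f x) (at x within S)" using f x by (simp add: continuous_on_def)
  show "((\<lambda>x. of_real (f x) * g x) \<longlongrightarrow> of_real (f x) * g x) (at x within S)"
  proof (cases "f x = 0")
    case True
    have "((\<lambda>y. \<bar>f y\<bar>) \<longlongrightarrow> 0) (at x within S)" using tendsto_rabs[OF fx] True by simp
    moreover have "eventually (\<lambda>y. norm (of_real (f y) * g y) \<le> \<bar>f y\<bar>) (at x within S)"
      using mult_left_mono[OF b] by (intro always_eventually) (fastforce simp: norm_mult)
    ultimately have "((\<lambda>x. of_real (f x) * g x) \<longlongrightarrow> 0) (at x within S)"
      by (rule Lim_null_comparison[rotated])
    then show ?thesis using True by simp
  next
    case False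
    have "(g \<longlongrightarrow> g x) (at x within {x \<in> S. f x \<noteq> 0})"
      using g x False by (simp add: continuous_on_def)
    moreover have "eventually (\<lambda>y. f y \<noteq> 0) (at x within S)"
      using tendsto_imp_eventually_ne[OF fx] False by simp
    ultimately have "(g \<longlongrightarrow> g x) (at x within S)"
      unfolding tendsto_def eventually_at_filter by (auto elim: eventually_elim2)
    then show ?thesis by (intro tendsto_intros fx)
  qed
qed

text \<open>Since the two ends of an edge differ, the three corners of a triangle are distinct, so that
  a triangle meets the star of a vertex in at most one corner. Several triangles may have the same corners.\<close>

locale triangulated =
  fixes X :: "'c dcomplex"
  assumes delta: "delta_complex X"
    and dim: "\<And>n. 2 < n \<Longrightarrow> cells X n = {}"
    and finite_cells: "\<And>n. finite (cells X n)"
    and vertex_on_edge: "\<And>v. v \<in> cells X 0 \<Longrightarrow> \<exists>e\<in>cells X 1. \<exists>k\<le>1. face X k e = v"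
    and edge_on_triangle: "\<And>e. e \<in> cells X 1 \<Longrightarrow> \<exists>\<tau>\<in>cells X 2. \<exists>k\<le>2. face X k \<tau> = e"
    and edge_ends: "\<And>e. e \<in> cells X 1 \<Longrightarrow> face X 0 e \<noteq> face X 1 e"
begin

lemma face_cells: "\<sigma> \<in> cells X (Suc n) \<Longrightarrow> k \<le> Suc n \<Longrightarrow> face X k \<sigma> \<in> cells X n"
  using delta by (simp add: delta_complex_def)

lemma face_1: "e \<in> cells X 1 \<Longrightarrow> k \<le> 1 \<Longrightarrow> face X k e \<in> cells X 0"
  using face_cells[of e 0 k] by (simp add: One_nat_def)

lemma face_2: "\<tau> \<in> cells X 2 \<Longrightarrow> k \<le> 2 \<Longrightarrow> face X k \<tau> \<in> cells X 1"
  using face_cells[of \<tau> 1 k] by (simp add: numeral_2_eq_2 One_nat_def)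

lemma face_face:
  assumes "\<tau> \<in> cells X 2"
  shows "face X 1 (face X 0 \<tau>) = corner X \<tau> 1" "face X 0 (face X 0 \<tau>) = corner X \<tau> 2"
    "face X 1 (face X 1 \<tau>) = corner X \<tau> 0" "face X 0 (face X 1 \<tau>) = corner X \<tau> 2"
    "face X 1 (face X 2 \<tau>) = corner X \<tau> 0" "face X 0 (face X 2 \<tau>) = corner X \<tau> 1"
proof -
  have d: "face X k (face X l \<tau>) = face X (l - 1) (face X k \<tau>)" if "k < l" "l \<le> 2" for k l
    using delta assms that unfolding delta_complex_def by (metis numeral_2_eq_2)
  show "face X 1 (face X 0 \<tau>) = corner X \<tau> 1" "face X 0 (face X 0 \<tau>) = corner X \<tau> 2"
    "face X 1 (face X 1 \<tau>) = corner X \<tau> 0" "face X 0 (face X 1 \<tau>) = corner X \<tau> 2"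
    "face X 1 (face X 2 \<tau>) = corner X \<tau> 0" "face X 0 (face X 2 \<tau>) = corner X \<tau> 1"
    using d[of 0 1] d[of 0 2] d[of 1 2] by (auto simp: corner_def One_nat_def)
qed

lemma corner_cells: "\<tau> \<in> cells X 2 \<Longrightarrow> corner X \<tau> k \<in> cells X 0"
  by (auto simp: corner_def intro!: face_1 face_2)

lemma corner_inj:
  assumes "\<tau> \<in> cells X 2" "k \<le> 2" "l \<le> 2" "corner X \<tau> k = corner X \<tau> l"
  shows "k = l"
proof -
  have "corner X \<tau> 2 \<noteq> corner X \<tau> 1" "corner X \<tau> 2 \<noteq> corner X \<tau> 0" "corner X \<tau> 1 \<noteq> corner X \<tau> 0"
    using edge_ends[OF face_2[OF assms(1)], of 0] edge_ends[OF face_2[OF assms(1)], of 1]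
      edge_ends[OF face_2[OF assms(1)], of 2] by (simp_all add: face_face[OF assms(1)])
  then show ?thesis using assms(2-4) unfolding le_2_cases by (auto dest: not_sym)
qed

lemma pt_triangle_face:
  "\<tau> \<in> cells X 2 \<Longrightarrow> k \<le> 2 \<Longrightarrow> t \<in> standard_simplex 1 \<Longrightarrow>
    pt X 1 (face X k \<tau>) t = pt X 2 \<tau> (simplical_face k t)"
  using pt_face[OF delta, of \<tau> 1 k t] by (simp add: numeral_2_eq_2 One_nat_def)

lemma pt_edge_face:
  "e \<in> cells X 1 \<Longrightarrow> k \<le> 1 \<Longrightarrow> t \<in> standard_simplex 0 \<Longrightarrow>
    pt X 0 (face X k e) t = pt X 1 e (simplical_face k t)"
  using pt_face[OF delta, of e 0 k t] by (simp add: One_nat_def)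

lemma simplical_face_2: "t \<in> standard_simplex 1 \<Longrightarrow> k \<le> 2 \<Longrightarrow> simplical_face k t \<in> standard_simplex 2"
  using standard_simplex_face[of t 1 k] by (simp add: numeral_2_eq_2 One_nat_def)

lemma simplical_face_1: "t \<in> standard_simplex 0 \<Longrightarrow> k \<le> 1 \<Longrightarrow> simplical_face k t \<in> standard_simplex 1"
  using standard_simplex_face[of t 0 k] by (simp add: One_nat_def)

lemma edge_point_in_triangle:
  assumes "e \<in> cells X 1" "t \<in> standard_simplex 1"
  obtains \<tau> s where "\<tau> \<in> cells X 2" "s \<in> standard_simplex 2" "pt X 1 e t = pt X 2 \<tau> s"
proof -
  obtain \<tau> k where "\<tau> \<in> cells X 2" "k \<le> 2" "face X k \<tau> = e" using edge_on_triangle[OF assms(1)] by blast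
  then show thesis
    using that[of \<tau> "simplical_face k t"] pt_triangle_face[of \<tau> k t] simplical_face_2[OF assms(2)] assms
    by auto
qed

text \<open>Every simplex is a face of a triangle, so triangles suffice to describe the points.\<close>

lemma point_in_triangle:
  assumes "P \<in> topspace (realization X)"
  obtains \<tau> t where "\<tau> \<in> cells X 2" "t \<in> standard_simplex 2" "P = pt X 2 \<tau> t"
proof -
  obtain n \<sigma> s where s: "\<sigma> \<in> cells X n" "s \<in> standard_simplex n" "P = pt X n \<sigma> s"
    using assms by (rule realization_point)
  consider "n = 0" | "n = 1" | "n = 2" using dim[of n] s(1) by fastforce
  then show thesis
  proof cases
    case 1
    obtain e k where "e \<in> cells X 1" "k \<le> 1" "face X k e = \<sigma>" using vertex_on_edge s(1) 1 by blast
    then have "P = pt X 1 e (simplical_face k s)" "simplical_face k s \<in> standard_simplex 1"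
      using pt_edge_face[of e k s] s 1 simplical_face_1[of s k] by auto
    then show thesis using that edge_point_in_triangle[OF \<open>e \<in> cells X 1\<close>] by metis
  next
    case 2
    then show thesis using that edge_point_in_triangle[of \<sigma> s] s by metis
  next
    case 3
    then show thesis using that s by blast
  qed
qed

lemma compact: "compact_space (realization X)"
proof (rule compact_realization)
  have "(SIGMA n:UNIV. cells X n) \<subseteq> (SIGMA n:{..2}. cells X n)"
    using dim by (auto simp: not_le[symmetric])
  then show "finite (SIGMA n:UNIV. cells X n)"
    by (rule finite_subset) (simp add: finite_cells)
qed

text \<open>The barycentric coordinate at the vertex \<open>x\<close>. It is defined in each dimension separately and
  agrees along faces; a point of the open star of \<open>x\<close> is one with positive weight at \<open>x\<close>.\<close>

fun bary :: "'c \<Rightarrow> 'c dpoint \<Rightarrow> real" where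
  "bary x ((n, \<sigma>), t) =
     (if n = 0 then if \<sigma> = x then t 0 else 0
      else if n = 1 then (if face X 1 \<sigma> = x then t 0 else 0) + (if face X 0 \<sigma> = x then t 1 else 0)
      else \<Sum>k\<le>2. if corner X \<sigma> k = x then t k else 0)"

definition weight :: "'c \<Rightarrow> 'c dpoint set \<Rightarrow> real" where
  "weight x = descend (bary x)"

abbreviation star :: "'c \<Rightarrow> 'c dpoint set set" where
  "star x \<equiv> {P \<in> topspace (realization X). 0 < weight x P}"

abbreviation star_space :: "'c \<Rightarrow> 'c dpoint set topology" where
  "star_space x \<equiv> subtopology (realization X) (star x)"

lemma weight_pt:
  assumes "\<sigma> \<in> cells X n" "t \<in> standard_simplex n"
  shows "weight x (pt X n \<sigma> t) = bary x ((n, \<sigma>), t)"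
  unfolding weight_def
proof (rule descend_pt[OF _ assms])
  fix n k \<sigma> t assume \<sigma>: "\<sigma> \<in> cells X (Suc n)" and k: "k \<le> Suc n" and t: "t \<in> standard_simplex n"
  have "n = 0 \<or> n = 1" using dim[of "Suc n"] \<sigma> by fastforce
  then show "bary x ((n, face X k \<sigma>), t) = bary x ((Suc n, \<sigma>), simplical_face k t)"
  proof
    assume "n = 0"
    then have "k = 0 \<or> k = 1" using k by auto
    then show ?thesis using \<open>n = 0\<close> simplex0[of t] t by (auto simp: simplical_face_def)
  next
    assume n: "n = 1"
    then have \<sigma>2: "\<sigma> \<in> cells X 2" using \<sigma> by (simp add: numeral_2_eq_2 One_nat_def)
    have "k = 0 \<or> k = 1 \<or> k = 2" using k n by auto
    then have "bary x ((1, face X k \<sigma>), t) = bary x ((2, \<sigma>), simplical_face k t)"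
      by (elim disjE) (simp_all add: simplical_face_def face_face[OF \<sigma>2] atMost_2 One_nat_def[symmetric])
    moreover have "Suc n = 2" using n by simp
    ultimately show ?thesis using n by (simp only:)
  qed
qed

lemma weight_triangle:
  assumes "\<tau> \<in> cells X 2" "t \<in> standard_simplex 2" "k \<le> 2" "corner X \<tau> k = x"
  shows "weight x (pt X 2 \<tau> t) = t k"
proof -
  have "weight x (pt X 2 \<tau> t) = (\<Sum>l\<le>2. if corner X \<tau> l = x then t l else 0)"
    using assms by (simp add: weight_pt)
  also have "\<dots> = (\<Sum>l\<le>2. if k = l then t l else 0)"
    using corner_inj[OF assms(1,3)] assms(4) by (intro sum.cong) auto
  finally show ?thesis using assms(3) by simp
qed

lemma weight_nonzero_corner:
  assumes "\<tau> \<in> cells X 2" "t \<in> standard_simplex 2" "weight x (pt X 2 \<tau> t) \<noteq> 0"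
  obtains k where "k \<le> 2" "corner X \<tau> k = x" "t k = weight x (pt X 2 \<tau> t)"
proof -
  have "\<exists>k\<le>2. corner X \<tau> k = x"
  proof (rule ccontr)
    assume "\<not> ?thesis"
    then have "weight x (pt X 2 \<tau> t) = 0" using assms by (simp add: weight_pt)
    then show False using assms(3) by simp
  qed
  then show thesis using that weight_triangle[OF assms(1,2)] by metis
qed

lemma weight_bounds:
  assumes "P \<in> topspace (realization X)"
  shows "0 \<le> weight x P" "weight x P \<le> 1"
proof -
  obtain \<tau> t where t: "\<tau> \<in> cells X 2" "t \<in> standard_simplex 2" "P = pt X 2 \<tau> t"
    using point_in_triangle[OF assms] .
  have "weight x P = 0 \<or> (\<exists>k\<le>2. weight x P = t k)"
    using weight_nonzero_corner[OF t(1,2), of x] t(3) by metis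
  then show "0 \<le> weight x P" "weight x P \<le> 1"
    using t(2) by (auto simp: simplex2 le_2_cases)
qed

lemma weight_continuous: "continuous_map (realization X) euclideanreal (weight x)"
proof (rule continuous_map_realization)
  fix n \<sigma> assume \<sigma>: "\<sigma> \<in> cells X n"
  have c: "continuous_on S (\<lambda>t. if B then t k else 0)" for S :: "(nat \<Rightarrow> real) set" and B k
    by (cases B) (auto intro: continuous_on_product_coordinates continuous_on_const continuous_on_subset)
  have "continuous_on (standard_simplex n) (\<lambda>t. bary x ((n, \<sigma>), t))"
    by (cases "n = 0"; cases "n = 1") (auto intro!: c continuous_on_add continuous_on_sum simp del: One_nat_def)
  then have "continuous_on (standard_simplex n) (\<lambda>t. weight x (pt X n \<sigma> t))"
    by (rule continuous_on_eq) (simp only: weight_pt[OF \<sigma>])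
  then show "continuous_map (top_of_set (standard_simplex n)) euclideanreal (\<lambda>t. weight x (pt X n \<sigma> t))"
    by simp
qed

lemma some_weight_positive:
  assumes "P \<in> topspace (realization X)"
  shows "\<exists>x\<in>cells X 0. 0 < weight x P"
proof -
  obtain \<tau> t where t: "\<tau> \<in> cells X 2" "t \<in> standard_simplex 2" "P = pt X 2 \<tau> t"
    using point_in_triangle[OF assms] .
  have "\<exists>k\<le>2. 0 < t k"
  proof (rule ccontr)
    assume "\<not> ?thesis"
    then have "t 0 \<le> 0" "t 1 \<le> 0" "t 2 \<le> 0" by (auto simp: not_less)
    then show False using t(2) by (simp add: simplex2)
  qed
  then obtain k where "k \<le> 2" "0 < t k" by blast
  then show ?thesis using weight_triangle[OF t(1,2)] t(3) corner_cells[OF t(1)] by metis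
qed

lemma pt_at_corner:
  assumes "\<tau> \<in> cells X 2" "t \<in> standard_simplex 2" "k \<le> 2" "t k = 1"
  shows "pt X 2 \<tau> t = pt X 0 (corner X \<tau> k) (\<lambda>i. if i = 0 then 1 else 0)"
proof -
  let ?o = "\<lambda>i. if i = (0::nat) then 1 else (0::real)"
  have o: "?o \<in> standard_simplex 0" by simp
  have t: "t i = (if i = k then 1 else 0)" for i
  proof (cases "i \<le> 2")
    case True
    moreover have "0 \<le> t 0" "0 \<le> t 1" "0 \<le> t 2" "t 0 + t 1 + t 2 = 1"
      using assms(2) by (auto simp: simplex2)
    ultimately show ?thesis using assms(3,4) unfolding le_2_cases by (elim disjE) auto
  next
    case False
    then show ?thesis using assms(2,3) by (simp add: simplex2)
  qed
  define m l where "m = (if k = 2 then 1 else 2::nat)" and "l = (if k = 0 then 1 else 0::nat)"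
  have m: "m \<le> 2" "l \<le> 1" by (auto simp: m_def l_def)
  have "face X l (face X m \<tau>) = corner X \<tau> k"
    using assms(3) unfolding le_2_cases by (auto simp: m_def l_def face_face[OF assms(1)] simp del: One_nat_def)
  moreover have "pt X 0 (face X l (face X m \<tau>)) ?o = pt X 2 \<tau> (simplical_face m (simplical_face l ?o))"
    using pt_edge_face[OF face_2[OF assms(1) m(1)] m(2) o]
      pt_triangle_face[OF assms(1) m(1) simplical_face_1[OF o m(2)]] by simp
  moreover have "simplical_face m (simplical_face l ?o) = t"
    using assms(3) unfolding le_2_cases by (auto simp: m_def l_def simplical_face_def t fun_eq_iff)
  ultimately show ?thesis by simp
qed

end

section \<open>Polar coordinates around a vertex\<close>

text \<open>The triangles \<open>T 0, \<dots>, T (N - 1)\<close> around the vertex \<open>x\<close> in cyclic order: \<open>T j\<close> lies between the edges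
  \<open>\<epsilon> j\<close> and \<open>\<epsilon> (j + 1)\<close>, the index being read modulo \<open>N\<close>. Faces are numbered by the opposite vertices,
  so \<open>\<epsilon> j\<close> joins \<open>x\<close> to vertex number \<open>b j\<close> of \<open>T j\<close> and \<open>\<epsilon> (j + 1)\<close> joins it to vertex number \<open>c j\<close>;
  the remaining vertex number, \<open>3 - b j - c j\<close>, is that of \<open>x\<close>.\<close>

locale vertex_cycle = triangulated X for X :: "'c dcomplex" +
  fixes x :: 'c and N :: nat and \<epsilon> T :: "nat \<Rightarrow> 'c" and b c :: "nat \<Rightarrow> nat"
  assumes N_pos: "0 < N"
    and T_cells: "\<And>j. j < N \<Longrightarrow> T j \<in> cells X 2"
    and bc: "\<And>j. j < N \<Longrightarrow> b j \<le> 2 \<and> c j \<le> 2 \<and> b j \<noteq> c j"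
    and apex: "\<And>j. j < N \<Longrightarrow> corner X (T j) (3 - b j - c j) = x"
    and left_edge: "\<And>j. j < N \<Longrightarrow> face X (c j) (T j) = \<epsilon> j"
    and right_edge: "\<And>j. j < N \<Longrightarrow> face X (b j) (T j) = \<epsilon> (Suc j mod N)"
    and inj_edges: "inj_on \<epsilon> {..<N}"
    and inj_triangles: "inj_on T {..<N}"
    and all_triangles: "\<And>\<tau> k. \<tau> \<in> cells X 2 \<Longrightarrow> k \<le> 2 \<Longrightarrow> corner X \<tau> k = x \<Longrightarrow> \<exists>j<N. \<tau> = T j"
begin

definition a where "a j = 3 - b j - c j"

lemma apex_a: "j < N \<Longrightarrow> corner X (T j) (a j) = x"
  by (simp only: a_def apex)

lemma abc:
  assumes "j < N"
  shows "(a j = 0 \<and> b j = 1 \<and> c j = 2) \<or> (a j = 0 \<and> b j = 2 \<and> c j = 1) \<or>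
    (a j = 1 \<and> b j = 0 \<and> c j = 2) \<or> (a j = 1 \<and> b j = 2 \<and> c j = 0) \<or>
    (a j = 2 \<and> b j = 0 \<and> c j = 1) \<or> (a j = 2 \<and> b j = 1 \<and> c j = 0)"
  using bc[OF assms] unfolding le_2_cases a_def by (elim conjE disjE) simp_all

lemma a_le: "j < N \<Longrightarrow> a j \<le> 2"
  using abc by fastforce

lemma abc_distinct:
  "j < N \<Longrightarrow> a j \<le> 2 \<and> b j \<le> 2 \<and> c j \<le> 2 \<and> a j \<noteq> b j \<and> a j \<noteq> c j \<and> b j \<noteq> c j"
  using abc[of j] by auto

lemma abc_all: "j < N \<Longrightarrow> k \<le> 2 \<Longrightarrow> k = a j \<or> k = b j \<or> k = c j"
  using abc[of j] unfolding le_2_cases by auto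

lemma abc_sum:
  assumes "j < N" "t \<in> standard_simplex 2"
  shows "t (a j) + t (b j) + t (c j) = 1"
  using abc[OF assms(1)] assms(2) unfolding simplex2 by (elim disjE conjE) simp_all

lemma abc_nonneg: "t \<in> standard_simplex 2 \<Longrightarrow> k \<le> 2 \<Longrightarrow> 0 \<le> t k"
  unfolding simplex2 le_2_cases by auto

definition left_index where "left_index e = inv_into {..<N} \<epsilon> e"
definition triangle_index where "triangle_index \<tau> = inv_into {..<N} T \<tau>"

lemma left_index [simp]: "j < N \<Longrightarrow> left_index (\<epsilon> j) = j"
  unfolding left_index_def by (rule inv_into_f_f[OF inj_edges]) simp

lemma triangle_index [simp]: "j < N \<Longrightarrow> triangle_index (T j) = j"
  unfolding triangle_index_def by (rule inv_into_f_f[OF inj_triangles]) simp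

text \<open>In polar coordinates: the modulus \<open>u + v\<close> is the sum of the barycentric coordinates at the two
  vertices of \<open>T j\<close> other than \<open>x\<close>, and the angle moves from \<open>2\<pi>j/N\<close> on one edge to \<open>2\<pi>(j + 1)/N\<close> on the
  other.\<close>

definition sector :: "nat \<Rightarrow> real \<Rightarrow> real \<Rightarrow> complex" where
  "sector j u v = of_real (u + v) * cis (2 * pi * (real j + v / (u + v)) / real N)"

text \<open>The polar coordinate, multiplied by the barycentric coordinate at \<open>x\<close>. With this factor it vanishes on
  the edges opposite to \<open>x\<close> and extends by zero to the complement of the star. On an edge \<open>\<epsilon> j\<close> the
  formula is symmetric in the two ends, so it need not say which of them is \<open>x\<close>.\<close>

definition swirl_pt :: "'c dpoint \<Rightarrow> complex" where
  "swirl_pt = (\<lambda>((n, \<sigma>), t).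
     if n = 1 \<and> \<sigma> \<in> \<epsilon> ` {..<N} then of_real (t 0) * sector (left_index \<sigma>) (t 1) 0
     else if n = 2 \<and> \<sigma> \<in> T ` {..<N} then
       let j = triangle_index \<sigma> in of_real (t (a j)) * sector j (t (b j)) (t (c j))
     else 0)"

definition swirl :: "'c dpoint set \<Rightarrow> complex" where
  "swirl = descend swirl_pt"

lemma sector_left: "sector j u 0 = of_real u * cis (2 * pi * real j / real N)"
  by (simp add: sector_def)

lemma sector_right: "j < N \<Longrightarrow> sector j 0 v = of_real v * cis (2 * pi * real (Suc j mod N) / real N)"
proof -
  assume j: "j < N"
  have "cis (2 * pi * (real j + 1) / real N) = cis (2 * pi * real (Suc j mod N) / real N)"
  proof (cases "Suc j = N")
    case True
    then have "real j + 1 = real N" by simp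
    then have "2 * pi * (real j + 1) / real N = 2 * pi" using N_pos by simp
    then show ?thesis using True by (simp add: cis.ctr complex_eq_iff)
  next
    case False
    then have "Suc j mod N = Suc j" using j by simp
    then show ?thesis by (simp add: add.commute)
  qed
  then show ?thesis by (cases "v = 0") (simp_all add: sector_def)
qed

lemma edge_contains_apex:
  assumes "j < N"
  shows "face X 0 (\<epsilon> j) = x \<or> face X 1 (\<epsilon> j) = x"
proof -
  have T: "T j \<in> cells X 2" using T_cells assms .
  have "face X 0 (face X (c j) (T j)) = x \<or> face X 1 (face X (c j) (T j)) = x"
    using abc[OF assms] apex_a[OF assms]
    by (elim disjE conjE) (auto simp: face_face[OF T])
  then show ?thesis using left_edge[OF assms] by simp
qed

lemma edge_in_star:
  assumes \<tau>: "\<tau> \<in> cells X 2" "k \<le> 2" and e: "face X k \<tau> \<in> \<epsilon> ` {..<N}"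
  obtains l where "l \<le> 2" "l \<noteq> k" "corner X \<tau> l = x"
proof -
  obtain i where "i < N" "face X k \<tau> = \<epsilon> i" using e by auto
  then have "face X 0 (face X k \<tau>) = x \<or> face X 1 (face X k \<tau>) = x"
    using edge_contains_apex[of i] by simp
  moreover have "k = 0 \<or> k = 1 \<or> k = 2" using \<tau>(2) by auto
  ultimately have "(corner X \<tau> 0 = x \<and> 0 \<noteq> k) \<or> (corner X \<tau> 1 = x \<and> 1 \<noteq> k) \<or>
      (corner X \<tau> 2 = x \<and> 2 \<noteq> k)"
    by (elim disjE) (simp_all add: face_face[OF \<tau>(1)])
  then show thesis using that[of 0] that[of 1] that[of 2] by (elim disjE conjE) simp_all
qed

text \<open>The angle of \<open>T j\<close> on its side \<open>\<epsilon> (j + 1)\<close> agrees with that of the edge modulo \<open>2\<pi>\<close>, also where the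
  numbering of the cycle jumps from \<open>N - 1\<close> to \<open>0\<close>.\<close>

lemma swirl_face:
  assumes \<tau>: "\<tau> \<in> cells X 2" and k: "k \<le> 2" and t: "t \<in> standard_simplex 1"
  shows "swirl_pt ((1, face X k \<tau>), t) = swirl_pt ((2, \<tau>), simplical_face k t)"
proof (cases "\<tau> \<in> T ` {..<N}")
  case False
  then have "\<not> (\<exists>l\<le>2. corner X \<tau> l = x)" using all_triangles[OF \<tau>] by blast
  then have "face X k \<tau> \<notin> \<epsilon> ` {..<N}" using edge_in_star[OF \<tau> k] by metis
  then show ?thesis using False by (simp add: swirl_pt_def)
next
  case True
  then obtain j where j: "j < N" "\<tau> = T j" by auto
  let ?s = "simplical_face k t"
  have rhs: "swirl_pt ((2, \<tau>), ?s) = of_real (?s (a j)) * sector j (?s (b j)) (?s (c j))"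
    using j by (simp add: swirl_pt_def Let_def)
  have zero: "?s k = 0" by (simp add: simplical_face_def)
  have prod: "?s l * ?s m = t 0 * t 1" if "l \<le> 2" "m \<le> 2" "k \<noteq> l" "k \<noteq> m" "l \<noteq> m" for l m
    using k that unfolding le_2_cases
    by (elim disjE) (simp_all add: simplical_face_def One_nat_def[symmetric])
  consider "k = a j" | "k = b j" | "k = c j" using abc_all[OF j(1) k] by blast
  then show ?thesis
  proof cases
    case 1
    have "face X k \<tau> \<notin> \<epsilon> ` {..<N}"
    proof
      assume "face X k \<tau> \<in> \<epsilon> ` {..<N}"
      then obtain l where "l \<le> 2" "l \<noteq> k" "corner X \<tau> l = x" using edge_in_star[OF \<tau> k] by metis
      then show False using corner_inj[OF \<tau>, of l k] apex_a[OF j(1)] j 1 k by simp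
    qed
    then show ?thesis using rhs zero 1 by (simp add: swirl_pt_def)
  next
    case 2
    have e: "face X k \<tau> = \<epsilon> (Suc j mod N)" using right_edge j 2 by simp
    have "Suc j mod N < N" using N_pos by simp
    then have "swirl_pt ((1, face X k \<tau>), t) = of_real (t 0 * t 1) * cis (2 * pi * real (Suc j mod N) / real N)"
      unfolding e by (simp add: swirl_pt_def sector_left)
    moreover have "?s (a j) * ?s (c j) = t 0 * t 1"
      using abc_distinct[OF j(1)] 2 by (intro prod) auto
    ultimately show ?thesis using rhs zero 2 sector_right[OF j(1)]
      by (simp flip: of_real_mult)
  next
    case 3
    have e: "face X k \<tau> = \<epsilon> j" using left_edge j 3 by simp
    have "swirl_pt ((1, face X k \<tau>), t) = of_real (t 0 * t 1) * cis (2 * pi * real j / real N)"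
      unfolding e using j(1) by (simp add: swirl_pt_def sector_left)
    moreover have "?s (a j) * ?s (b j) = t 0 * t 1"
      using abc_distinct[OF j(1)] 3 by (intro prod) auto
    ultimately show ?thesis using rhs zero 3
      by (simp add: sector_left flip: of_real_mult)
  qed
qed

lemma swirl_point:
  assumes "\<sigma> \<in> cells X n" "t \<in> standard_simplex n"
  shows "swirl (pt X n \<sigma> t) = swirl_pt ((n, \<sigma>), t)"
  unfolding swirl_def
proof (rule descend_pt[OF _ assms])
  fix n k \<sigma> t assume \<sigma>: "\<sigma> \<in> cells X (Suc n)" and k: "k \<le> Suc n" and t: "t \<in> standard_simplex n"
  have "n = 0 \<or> n = 1" using dim[of "Suc n"] \<sigma> by fastforce
  then show "swirl_pt ((n, face X k \<sigma>), t) = swirl_pt ((Suc n, \<sigma>), simplical_face k t)"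
  proof
    assume n: "n = 0"
    then have "k = 0 \<or> k = 1" using k by auto
    then have "simplical_face k t 0 = 0 \<or> simplical_face k t 1 = 0"
      using n simplex0[of t] t by (auto simp: simplical_face_def)
    then show ?thesis using n by (auto simp: swirl_pt_def sector_left)
  next
    assume n: "n = 1"
    then have "Suc n = 2" by simp
    then show ?thesis using swirl_face[of \<sigma> k t] \<sigma> k t n by (simp only:)
  qed
qed

lemma swirl_triangle:
  assumes "j < N" "t \<in> standard_simplex 2"
  shows "swirl (pt X 2 (T j) t) = of_real (t (a j)) * sector j (t (b j)) (t (c j))"
  using swirl_point[OF T_cells[OF assms(1)] assms(2)] assms by (simp add: swirl_pt_def Let_def)

lemma sector_continuous: "continuous_on (standard_simplex 2) (\<lambda>t. sector j (t k) (t l))"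
proof -
  have c: "continuous_on S (\<lambda>t. t i)" for S :: "(nat \<Rightarrow> real) set" and i
    by (auto intro: continuous_on_product_coordinates continuous_on_subset)
  show ?thesis unfolding sector_def
    by (rule continuous_on_mult_bounded) (use N_pos in \<open>auto intro!: continuous_intros c\<close>)
qed

lemma swirl_continuous: "continuous_map (realization X) euclidean swirl"
proof (rule continuous_map_realization)
  fix n \<sigma> assume \<sigma>: "\<sigma> \<in> cells X n"
  have c: "continuous_on S (\<lambda>t. t i)" for S :: "(nat \<Rightarrow> real) set" and i
    by (auto intro: continuous_on_product_coordinates continuous_on_subset)
  have "continuous_on (standard_simplex n) (\<lambda>t. swirl_pt ((n, \<sigma>), t))"
  proof (cases "n = 1 \<and> \<sigma> \<in> \<epsilon> ` {..<N}")
    case True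
    then show ?thesis by (simp add: swirl_pt_def sector_left) (intro continuous_intros c)
  next
    case False
    show ?thesis
    proof (cases "n = 2 \<and> \<sigma> \<in> T ` {..<N}")
      case True
      then show ?thesis by (simp add: swirl_pt_def Let_def) (intro continuous_intros c sector_continuous)
    next
      case no_triangle: False
      show ?thesis using False no_triangle by (simp add: swirl_pt_def cong: conj_cong if_cong)
    qed
  qed
  then have "continuous_on (standard_simplex n) (\<lambda>t. swirl (pt X n \<sigma> t))"
    by (rule continuous_on_eq) (simp only: swirl_point[OF \<sigma>])
  then show "continuous_map (top_of_set (standard_simplex n)) euclidean (\<lambda>t. swirl (pt X n \<sigma> t))"
    by simp
qed

text \<open>The point at distance \<open>r\<close> from \<open>x\<close> in direction \<open>j + u\<close>, measured in units of one triangle.\<close>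

definition spoke :: "nat \<Rightarrow> real \<Rightarrow> real \<Rightarrow> 'c dpoint set" where
  "spoke j u r = pt X 2 (T j)
     (\<lambda>i. if i = b j then r * (1 - u) else if i = c j then r * u else if i = a j then 1 - r else 0)"

lemma spoke_simplex:
  assumes "j < N" "0 \<le> u" "u \<le> 1" "0 \<le> r" "r \<le> 1"
  shows "(\<lambda>i. if i = b j then r * (1 - u) else if i = c j then r * u else if i = a j then 1 - r else 0)
    \<in> standard_simplex 2"
  using abc[OF assms(1)] assms(2-)
  by (elim disjE conjE) (auto simp: simplex2 algebra_simps mult_left_le)

lemma spoke_values:
  assumes "j < N" "0 \<le> u" "u \<le> 1" "0 \<le> r" "r \<le> 1"
  shows "spoke j u r \<in> topspace (realization X)" "weight x (spoke j u r) = 1 - r"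
    "swirl (spoke j u r) = of_real ((1 - r) * r) * cis (2 * pi * (real j + u) / real N)"
proof -
  let ?t = "\<lambda>i. if i = b j then r * (1 - u) else if i = c j then r * u else if i = a j then 1 - r else 0"
  note t = spoke_simplex[OF assms]
  have v: "?t (a j) = 1 - r" "?t (b j) = r * (1 - u)" "?t (c j) = r * u"
    using abc[OF assms(1)] by auto
  show "spoke j u r \<in> topspace (realization X)"
    unfolding spoke_def by (rule pt_in_realization[OF T_cells[OF assms(1)] t])
  show "weight x (spoke j u r) = 1 - r"
    unfolding spoke_def
    using weight_triangle[OF T_cells[OF assms(1)] t a_le[OF assms(1)] apex_a[OF assms(1)]] v by simp
  have "swirl (spoke j u r) = of_real (?t (a j)) * sector j (?t (b j)) (?t (c j))"
    unfolding spoke_def by (rule swirl_triangle[OF assms(1) t])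
  also have "\<dots> = of_real (1 - r) * sector j (r * (1 - u)) (r * u)" by (simp only: v)
  also have "sector j (r * (1 - u)) (r * u) = of_real r * cis (2 * pi * (real j + u) / real N)"
    by (cases "r = 0") (simp_all add: sector_def algebra_simps)
  finally show "swirl (spoke j u r) = of_real ((1 - r) * r) * cis (2 * pi * (real j + u) / real N)"
    by simp
qed

lemma spoke_center:
  assumes "j < N"
  shows "spoke j u 0 = pt X 0 x (\<lambda>i. if i = 0 then 1 else 0)"
proof -
  have "spoke j u 0 = pt X 2 (T j) (\<lambda>i. if i = a j then 1 else 0)"
    unfolding spoke_def using abc[OF assms] by (intro arg_cong[of _ _ "pt X 2 (T j)"]) (auto simp: fun_eq_iff)
  also have "\<dots> = pt X 0 (corner X (T j) (a j)) (\<lambda>i. if i = 0 then 1 else 0)"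
    by (rule pt_at_corner) (use T_cells[OF assms] a_le[OF assms] in auto)
  finally show ?thesis by (simp add: apex_a[OF assms])
qed

lemma simplex_eqI:
  assumes "j < N" "t \<in> standard_simplex 2" "s \<in> standard_simplex 2"
    and "t (b j) = s (b j)" "t (c j) = s (c j)"
  shows "t = s"
proof
  have "t (a j) = s (a j)" using abc_sum[OF assms(1)] assms(2-) by (metis add_right_cancel)
  then have "t k = s k" if "k \<le> 2" for k using abc_all[OF assms(1) that] assms(4,5) by auto
  moreover have "t k = s k" if "\<not> k \<le> 2" for k using that assms(2,3) by (simp add: simplex2)
  ultimately show "t k = s k" for k by blast
qed

text \<open>Each point of the star has polar coordinates with \<open>u < 1\<close>: the side where \<open>u = 1\<close> also belongs to the
  next triangle, where \<open>u = 0\<close>.\<close>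

lemma star_spoke:
  assumes "P \<in> star x"
  obtains j u r where "j < N" "0 \<le> u" "u < 1" "0 \<le> r" "r < 1" "P = spoke j u r"
proof -
  obtain \<tau> t where t: "\<tau> \<in> cells X 2" "t \<in> standard_simplex 2" "P = pt X 2 \<tau> t"
    using point_in_triangle assms by blast
  obtain k where k: "k \<le> 2" "corner X \<tau> k = x" "t k = weight x P"
    using weight_nonzero_corner[OF t(1,2), of x] assms t(3) by force
  obtain j where j: "j < N" "\<tau> = T j" using all_triangles[OF t(1) k(1,2)] by auto
  have ka: "k = a j" using corner_inj[OF t(1) k(1) a_le[OF j(1)]] k(2) apex_a[OF j(1)] j(2) by simp
  define r where "r = 1 - weight x P"
  have r: "0 \<le> r" "r < 1" "t (a j) = 1 - r" using assms weight_bounds[of P x] k(3) ka by (auto simp: r_def)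
  have sum: "t (b j) + t (c j) = r" using abc_sum[OF j(1) t(2)] r(3) by simp
  have nonneg: "0 \<le> t (b j)" "0 \<le> t (c j)" using abc_nonneg[OF t(2)] bc[OF j(1)] by auto
  have eq: "P = spoke j u r" if "t (b j) = r * (1 - u)" "t (c j) = r * u" "0 \<le> u" "u \<le> 1" for u
    unfolding spoke_def t(3) j(2)
    using that r bc[OF j(1)] by (intro arg_cong[of _ _ "pt X 2 (T j)"] simplex_eqI[OF j(1) t(2)] spoke_simplex j) auto
  show thesis
  proof (cases "t (b j) = 0 \<and> r \<noteq> 0")
    case False
    define u where "u = (if r = 0 then 0 else t (c j) / r)"
    have u: "0 \<le> u" "u < 1"
      using False sum nonneg r(1) by (auto simp: u_def divide_less_eq)
    have "t (c j) = r * u" using sum nonneg by (auto simp: u_def)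
    moreover have "t (b j) = r * (1 - u)" using calculation sum by (simp add: algebra_simps)
    ultimately show thesis using that[OF j(1) u r(1,2)] eq u by simp
  next
    case True
    \<comment> \<open>The point lies on the edge shared with the next triangle of the cycle; there the weight
      at \<open>x\<close> is the only coordinate that has to be known.\<close>
    define i where "i = Suc j mod N"
    have i: "i < N" using N_pos by (simp add: i_def)
    define s where "s = (\<lambda>i. if i < b j then t i else t (Suc i))"
    have z: "t (b j) = 0" using True by simp
    have "b j = 0 \<or> b j = 1 \<or> b j = 2" using bc[OF j(1)] unfolding le_2_cases by simp
    then have "(\<forall>i. 0 \<le> s i \<and> s i \<le> 1) \<and> (\<forall>i>1. s i = 0) \<and> s 0 + s 1 = 1"
      unfolding s_def using t(2) z
      by (elim disjE) (auto simp: standard_simplex_def atMost_2 One_nat_def[symmetric] eval_nat_numeral(2)[symmetric])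
    moreover have "sum s {..1} = s 0 + s 1" by (simp add: One_nat_def)
    ultimately have "s \<in> standard_simplex 1" unfolding standard_simplex_def by simp
    moreover have "t = simplical_face (b j) s" using z by (auto simp: s_def simplical_face_def fun_eq_iff)
    ultimately have s: "s \<in> standard_simplex 1" "t = simplical_face (b j) s" .
    have "P = pt X 1 (\<epsilon> i) s"
      using pt_triangle_face[OF t(1) _ s(1), of "b j"] bc[OF j(1)] right_edge[OF j(1)] t(3) s(2) j(2)
      by (simp add: i_def)
    also have "\<dots> = pt X 2 (T i) (simplical_face (c i) s)"
      using pt_triangle_face[OF T_cells[OF i] _ s(1), of "c i"] bc[OF i] left_edge[OF i] by simp
    finally have P: "P = pt X 2 (T i) (simplical_face (c i) s)" .
    let ?t = "simplical_face (c i) s"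
    have t': "?t \<in> standard_simplex 2" using simplical_face_2[OF s(1)] bc[OF i] by blast
    have "?t (a i) = weight x P"
      using weight_triangle[OF T_cells[OF i] t' a_le[OF i] apex_a[OF i]] P by simp
    moreover have "?t (c i) = 0" by (simp add: simplical_face_def)
    ultimately have "?t (b i) = r" using abc_sum[OF i t'] by (simp add: r_def)
    then have "P = spoke i 0 r"
      unfolding spoke_def P using r bc[OF i] \<open>?t (c i) = 0\<close>
        spoke_simplex[OF i, of 0 r]
      by (intro arg_cong[of _ _ "pt X 2 (T i)"] simplex_eqI[OF i t']) auto
    then show thesis using that[OF i _ _ r(1,2), of 0] by simp
  qed
qed

end

text \<open>If \<open>w\<close> is the weight of a point at \<open>x\<close> and \<open>p\<close> its polar coordinate, then the norm of \<open>p\<close> is \<open>1 - w\<close>,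
  and the pair \<open>(w, wp)\<close> ranges over the following set. Dividing by \<open>w\<close> identifies it with the open
  unit disc.\<close>

definition star_model :: "(real \<times> complex) set" where
  "star_model = {(w, z). 0 < w \<and> w \<le> 1 \<and> norm z = w * (1 - w)}"

lemma prod_topology_euclidean:
  "prod_topology (euclidean :: 'a::topological_space topology) (euclidean :: 'b::topological_space topology)
    = euclidean"
  by (simp add: topology_eq openin_prod_topology_alt open_prod_def)

lemma star_model_homeomorphic_disc: "top_of_set star_model homeomorphic_space top_of_set (ball (0 :: real \<times> real) 1)"
proof -
  let ?f = "\<lambda>(w, z). (Re z / w, Im z / w)"
  let ?g = "\<lambda>(p, q). (1 - norm (p, q), of_real (1 - norm (p, q)) * Complex p q)"
  have n: "norm (p / w, q / w) = 1 - w" if "norm (Complex p q) = w * (1 - w)" "0 < w" for p q w :: real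
  proof -
    have "norm (p / w, q / w) = norm ((1 / w) *\<^sub>R (p, q))" by simp
    also have "\<dots> = norm (p, q) / w" using that(2) by (simp only: norm_scaleR) simp
    also have "norm (p, q) = w * (1 - w)" using that(1) by (simp add: norm_Pair cmod_def)
    finally show ?thesis using that(2) by simp
  qed
  have f: "?f ` star_model \<subseteq> ball 0 1"
    using n by (fastforce simp: star_model_def)
  have g: "?g ` ball 0 1 \<subseteq> star_model"
  proof (rule image_subsetI)
    fix v :: "real \<times> real" assume v: "v \<in> ball 0 1"
    obtain p q where pq: "v = (p, q)" by (cases v)
    have l: "norm (p, q) < 1" using v pq by (simp add: mem_ball_0)
    have "norm (of_real (1 - norm (p, q)) * Complex p q) = \<bar>1 - norm (p, q)\<bar> * norm (Complex p q)"
      by (simp only: norm_mult norm_of_real)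
    also have "\<dots> = (1 - norm (p, q)) * norm (p, q)" using l by (simp add: norm_Pair cmod_def)
    finally show "?g v \<in> star_model"
      unfolding pq using l by (simp only: star_model_def mem_Collect_eq case_prod_conv) simp
  qed
  have "continuous_on star_model ?f"
    unfolding case_prod_beta by (intro continuous_intros) (auto simp: star_model_def)
  moreover have "continuous_on (ball 0 1) ?g"
    unfolding case_prod_beta Complex_eq by (intro continuous_intros)
  moreover have "?g (?f v) = v" if vc: "v \<in> star_model" for v
  proof -
    obtain w z where v: "v = (w, z)" "0 < w" "norm z = w * (1 - w)" using vc by (auto simp: star_model_def)
    have "1 - norm (Re z / w, Im z / w) = w" using n[of "Re z" "Im z" w] v by simp
    then show ?thesis using v(2) by (simp add: v(1) complex_eq_iff)
  qed
  moreover have "?f (?g v) = v" if "v \<in> ball 0 1" for v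
    using that by (cases v) auto
  ultimately have "homeomorphic_maps (top_of_set star_model) (top_of_set (ball 0 1)) ?f ?g"
    using f g by (auto simp: homeomorphic_maps_def continuous_map_in_subtopology image_subset_iff)
  then show ?thesis by (rule homeomorphic_maps_imp_homeomorphic_space)
qed

context vertex_cycle
begin

definition chart :: "'c dpoint set \<Rightarrow> real \<times> complex" where
  "chart P = (weight x P, swirl P)"

lemma chart_continuous: "continuous_map (realization X) euclidean chart"
  unfolding chart_def[abs_def] prod_topology_euclidean[symmetric]
  by (intro continuous_map_pairedI weight_continuous swirl_continuous)

lemma chart_spoke:
  assumes "j < N" "0 \<le> u" "u \<le> 1" "0 \<le> r" "r \<le> 1"
  shows "chart (spoke j u r) = (1 - r, of_real ((1 - r) * r) * cis (2 * pi * (real j + u) / real N))"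
  using spoke_values[OF assms] by (simp add: chart_def)

text \<open>The angle determines \<open>j + u\<close>, and hence \<open>j\<close> and \<open>u\<close>.\<close>

lemma spoke_angle:
  assumes "i < N" "0 \<le> u" "u < 1"
  shows "Arg2pi (cis (2 * pi * (real i + u) / real N)) = 2 * pi * (real i + u) / real N"
proof (rule Arg2pi_unique[of 1])
  show "of_real 1 * exp (\<i> * of_real (2 * pi * (real i + u) / real N))
      = cis (2 * pi * (real i + u) / real N)"
    by (simp add: cis_conv_exp)
  show "0 \<le> 2 * pi * (real i + u) / real N" using assms by simp
  have "real i + u < real N" using assms by linarith
  then have "2 * pi * (real i + u) < 2 * pi * real N" by simp
  then show "2 * pi * (real i + u) / real N < 2 * pi" using N_pos by (simp add: divide_less_eq)
qed simp

lemma chart_inj: "inj_on chart (star x)"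
proof (rule inj_onI)
  fix P Q assume P: "P \<in> star x" and Q: "Q \<in> star x" and eq: "chart P = chart Q"
  obtain j u r where p: "j < N" "0 \<le> u" "u < 1" "0 \<le> r" "r < 1" "P = spoke j u r"
    using star_spoke[OF P] .
  obtain i v s where q: "i < N" "0 \<le> v" "v < 1" "0 \<le> s" "s < 1" "Q = spoke i v s"
    using star_spoke[OF Q] .
  let ?\<alpha> = "\<lambda>j u. 2 * pi * (real j + u) / real N"
  have pair: "(1 - r, of_real ((1 - r) * r) * cis (?\<alpha> j u)) = (1 - s, of_real ((1 - s) * s) * cis (?\<alpha> i v))"
    using eq chart_spoke[OF p(1,2) less_imp_le[OF p(3)] p(4) less_imp_le[OF p(5)]]
      chart_spoke[OF q(1,2) less_imp_le[OF q(3)] q(4) less_imp_le[OF q(5)]]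
    unfolding p(6) q(6) by (simp only:)
  then have rs: "r = s" by simp
  have e: "of_real ((1 - r) * r) * cis (?\<alpha> j u) = of_real ((1 - s) * s) * cis (?\<alpha> i v)"
    using pair by (rule Pair_inject)
  show "P = Q"
  proof (cases "r = 0")
    case True
    then show ?thesis using p q rs spoke_center by simp
  next
    case False
    then have "of_real ((1 - r) * r) \<noteq> (0 :: complex)" using p(5) by (simp del: of_real_mult)
    then have "cis (?\<alpha> j u) = cis (?\<alpha> i v)" using e unfolding rs by (rule mult_left_cancel[THEN iffD1])
    then have "Arg2pi (cis (?\<alpha> j u)) = Arg2pi (cis (?\<alpha> i v))" by (rule arg_cong)
    then have "?\<alpha> j u = ?\<alpha> i v" unfolding spoke_angle[OF p(1-3)] spoke_angle[OF q(1-3)] .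
    then have "real j + u = real i + v" using N_pos by simp
    then have "j = i" using p(2,3) q(2,3) by linarith
    then show ?thesis using \<open>real j + u = real i + v\<close> p(6) q(6) rs by simp
  qed
qed

lemma chart_image: "chart ` star x = star_model"
proof (intro equalityI subsetI)
  fix v assume "v \<in> chart ` star x"
  then obtain P where P: "P \<in> star x" "v = chart P" by auto
  obtain j u r where "j < N" "0 \<le> u" "u < 1" "0 \<le> r" "r < 1" "P = spoke j u r"
    using star_spoke[OF P(1)] .
  then show "v \<in> star_model" using P(2) chart_spoke[of j u r]
    by (simp add: star_model_def norm_mult abs_mult del: of_real_mult of_real_diff)
next
  fix v assume "v \<in> star_model"
  then obtain w z where v: "v = (w, z)" "0 < w" "w \<le> 1" "norm z = w * (1 - w)" by (auto simp: star_model_def)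
  define \<theta> where "\<theta> = Arg2pi z * real N / (2 * pi)"
  have \<theta>: "0 \<le> \<theta>" "\<theta> < real N"
    using Arg2pi_ge_0[of z] Arg2pi_lt_2pi[of z] N_pos by (auto simp: \<theta>_def field_simps)
  define j where "j = nat \<lfloor>\<theta>\<rfloor>"
  have j: "real j = of_int \<lfloor>\<theta>\<rfloor>" using \<theta>(1) by (simp add: j_def)
  have jN: "j < N" using \<theta> by (simp add: j_def nat_less_iff floor_less_iff)
  have u: "0 \<le> frac \<theta>" "frac \<theta> < 1" by (simp_all add: frac_lt_1)
  have "real j + frac \<theta> = \<theta>" using j by (simp add: frac_def)
  then have "2 * pi * (real j + frac \<theta>) / real N = Arg2pi z" using N_pos by (simp add: \<theta>_def)
  then have "of_real ((1 - (1 - w)) * (1 - w)) * cis (2 * pi * (real j + frac \<theta>) / real N)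
      = of_real (norm z) * exp (\<i> * of_real (Arg2pi z))"
    by (simp add: v(4) cis_conv_exp)
  also have "\<dots> = z" by (rule Arg2pi_eq[symmetric])
  finally have "chart (spoke j (frac \<theta>) (1 - w)) = v"
    using chart_spoke[of j "frac \<theta>" "1 - w"] jN u v by simp
  moreover have "spoke j (frac \<theta>) (1 - w) \<in> star x"
    using spoke_values(1,2)[of j "frac \<theta>" "1 - w"] jN u v by simp
  ultimately show "v \<in> chart ` star x" by blast
qed

lemma openin_star: "openin (realization X) (star x)"
proof -
  have "openin (realization X) {P \<in> topspace (realization X). weight x P \<in> {0<..}}"
    by (rule openin_continuous_map_preimage[OF weight_continuous]) simp
  then show ?thesis by simp
qed

text \<open>Both components of the chart are defined on the whole compact realization, so the chart is a closed
  map there; the star is the preimage of the half space \<open>w > 0\<close>, and so the restriction to it is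
  closed as well.\<close>

lemma chart_homeomorphic_map:
  "homeomorphic_map (star_space x) (top_of_set star_model) chart"
proof -
  let ?V = "{0<..} \<times> (UNIV :: complex set)"
  have "closed_map (realization X) euclidean chart"
    by (rule continuous_imp_closed_map[OF chart_continuous compact]) simp
  then have "closed_map (star_space x) (top_of_set ?V) chart"
    by (rule closed_map_restriction) (auto simp: chart_def)
  moreover have "continuous_map (star_space x) (top_of_set ?V) chart"
    by (rule continuous_map_into_subtopology[OF continuous_map_from_subtopology[OF chart_continuous]])
      (auto simp: chart_def)
  moreover have top: "topspace (star_space x) = star x" by auto
  ultimately have "embedding_map (star_space x) (top_of_set ?V) chart"
    using chart_inj by (intro injective_closed_imp_embedding_map) simp_all
  then have "homeomorphic_map (star_space x)
      (subtopology (top_of_set ?V) (chart ` (star x))) chart"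
    unfolding embedding_map_def top .
  moreover have "?V \<inter> star_model = star_model" by (auto simp: star_model_def)
  ultimately show ?thesis by (simp add: chart_image subtopology_subtopology)
qed

lemma star_disc: "star_space x homeomorphic_space top_of_set (ball (0 :: real \<times> real) 1)"
  using homeomorphic_map_imp_homeomorphic_space[OF chart_homeomorphic_map] star_model_homeomorphic_disc
  by (rule homeomorphic_space_trans)

end

section \<open>Closed surfaces and coverings of closed surfaces\<close>

locale closed_surface = triangulated X for X :: "'c dcomplex" +
  assumes cycles: "\<And>x. x \<in> cells X 0 \<Longrightarrow> \<exists>N \<epsilon> T b c. vertex_cycle X x N \<epsilon> T b c"
begin

text \<open>Two points of one star are separated by its chart. A point outside the star of \<open>x\<close> has weight \<open>0\<close>
  at \<open>x\<close>, so the same chart separates it from the points of the star.\<close>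

lemma Hausdorff: "Hausdorff_space (realization X)"
  unfolding Hausdorff_space_def
proof (intro allI impI)
  fix P Q assume PQ: "P \<in> topspace (realization X) \<and> Q \<in> topspace (realization X) \<and> P \<noteq> Q"
  obtain x where x: "x \<in> cells X 0" "0 < weight x P" using some_weight_positive PQ by blast
  obtain N \<epsilon> T b c where "vertex_cycle X x N \<epsilon> T b c" using cycles[OF x(1)] by blast
  then interpret vertex_cycle X x N \<epsilon> T b c .
  have "chart P \<noteq> chart Q"
  proof
    assume e: "chart P = chart Q"
    then have "0 < weight x Q" using x(2) by (simp add: chart_def)
    then have "P = Q" using PQ x(2) by (intro inj_onD[OF chart_inj e]) auto
    then show False using PQ by simp
  qed
  then obtain U V where UV: "open U" "open V" "chart P \<in> U" "chart Q \<in> V" "U \<inter> V = {}"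
    unfolding separation_t2 by blast
  let ?p = "\<lambda>U. {R \<in> topspace (realization X). chart R \<in> U}"
  show "\<exists>U V. openin (realization X) U \<and> openin (realization X) V \<and> P \<in> U \<and> Q \<in> V \<and> disjnt U V"
  proof (intro exI conjI)
    show "openin (realization X) (?p U)" "openin (realization X) (?p V)"
      using UV by (auto intro: openin_continuous_map_preimage[OF chart_continuous])
    show "P \<in> ?p U" "Q \<in> ?p V" using PQ UV by auto
    show "disjnt (?p U) (?p V)" using UV(5) by (auto simp: disjnt_def)
  qed
qed

lemma star_disc_properties:
  assumes "x \<in> cells X 0"
  shows "second_countable (star_space x)"
    and "openin (realization X) (star x)"
    and "star_space x
      homeomorphic_space top_of_set (ball (0 :: real \<times> real) 1)"
proof -
  obtain N \<epsilon> T b c where "vertex_cycle X x N \<epsilon> T b c" using cycles[OF assms] by blast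
  then interpret vertex_cycle X x N \<epsilon> T b c .
  show "openin (realization X) (star x)" by (rule openin_star)
  show h: "star_space x homeomorphic_space top_of_set (ball (0 :: real \<times> real) 1)"
    by (rule star_disc)
  have "second_countable (euclidean :: (real \<times> real) topology)"
  proof -
    obtain \<B> :: "(real \<times> real) set set" where B: "countable \<B>" "topological_basis \<B>"
      using ex_countable_basis by blast
    have "\<exists>V\<in>\<B>. p \<in> V \<and> V \<subseteq> U" if U: "open U" "p \<in> U" for U p
      by (rule topological_basisE[OF B(2) U]) (rule bexI, rule conjI)
    then show ?thesis unfolding second_countable_def
      using B(1) topological_basis_open[OF B(2)] by (intro exI[of _ \<B>]) simp
  qed
  then have "second_countable (top_of_set (ball (0 :: real \<times> real) 1))" by (rule second_countable_subtopology)
  then show "second_countable (star_space x)"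
    using homeomorphic_space_second_countability[OF h] by blast
qed

lemma second_countable: "second_countable (realization X)"
proof -
  define Q where "Q x \<B> \<longleftrightarrow> countable \<B> \<and> (\<forall>V\<in>\<B>. openin (realization X) V) \<and>
      (\<forall>U P. openin (realization X) U \<and> P \<in> U \<and> P \<in> star x \<longrightarrow> (\<exists>V\<in>\<B>. P \<in> V \<and> V \<subseteq> U))" for x \<B>
  have "\<exists>\<B>. Q x \<B>" if x: "x \<in> cells X 0" for x
  proof -
    obtain \<B> where B: "countable \<B>" "\<forall>V\<in>\<B>. openin (star_space x) V"
      "\<forall>U P. openin (star_space x) U \<and> P \<in> U \<longrightarrow> (\<exists>V\<in>\<B>. P \<in> V \<and> V \<subseteq> U)"
      using star_disc_properties(1)[OF x] unfolding second_countable_def by (elim exE conjE)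
    have o: "openin (realization X) V" if "V \<in> \<B>" for V
      using bspec[OF B(2) that] openin_open_subtopology[OF star_disc_properties(2)[OF x]] by blast
    have "\<exists>V\<in>\<B>. P \<in> V \<and> V \<subseteq> U" if U: "openin (realization X) U" "P \<in> U" "P \<in> star x" for U P
    proof -
      have "openin (star_space x) (U \<inter> star x) \<and> P \<in> U \<inter> star x"
        using openin_subtopology_Int[OF U(1)] U(2,3) by blast
      then obtain V where "V \<in> \<B>" "P \<in> V" "V \<subseteq> U \<inter> star x" using B(3) by meson
      then show ?thesis by blast
    qed
    then show ?thesis unfolding Q_def using B(1) o by (intro exI[of _ \<B>]) simp
  qed
  then obtain \<B> where B: "\<And>x. x \<in> cells X 0 \<Longrightarrow> Q x (\<B> x)" by metis
  show ?thesis
    unfolding second_countable_def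
  proof (intro exI[of _ "\<Union>x\<in>cells X 0. \<B> x"] conjI allI impI)
    show "countable (\<Union>x\<in>cells X 0. \<B> x)"
      using B finite_cells[of 0] by (intro countable_UN) (auto simp: countable_finite Q_def)
    show "\<forall>V\<in>\<Union>x\<in>cells X 0. \<B> x. openin (realization X) V" using B by (auto simp: Q_def)
    fix U P assume UP: "openin (realization X) U \<and> P \<in> U"
    then have "P \<in> topspace (realization X)" using openin_subset by blast
    then obtain x where x: "x \<in> cells X 0" "P \<in> star x" using some_weight_positive by blast
    have "\<exists>V\<in>\<B> x. P \<in> V \<and> V \<subseteq> U" using B[OF x(1)] x(2) UP unfolding Q_def by simp
    then show "\<exists>V\<in>\<Union>x\<in>cells X 0. \<B> x. P \<in> V \<and> V \<subseteq> U" using x(1) by blast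
  qed
qed

theorem surface:
  assumes "connected_space (realization X)" "cells X 0 \<noteq> {}"
  shows "surface (realization X)"
  unfolding surface_def
proof (intro conjI ballI)
  show "topspace (realization X) \<noteq> {}"
    using assms(2) pt_in_realization[of _ X 0 "\<lambda>i. if i = 0 then 1 else 0"] by force
  fix P assume P: "P \<in> topspace (realization X)"
  then obtain x where x: "x \<in> cells X 0" "0 < weight x P" using some_weight_positive by blast
  show "\<exists>U (V :: (real \<times> real) set). openin (realization X) U \<and> P \<in> U \<and> open V \<and>
      subtopology (realization X) U homeomorphic_space top_of_set V"
    using star_disc_properties(2,3)[OF x(1)] P x(2)
    by (intro exI[of _ "star x"] exI[of _ "ball 0 1"]) simp
qed (use assms Hausdorff second_countable in simp_all)

end

text \<open>A simplicial map that carries the cycle of triangles around each vertex bijectively to the cycle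
  around the image vertex restricts to a homeomorphism of open stars: in the charts it is the
  identity. Distinct vertices over one vertex have disjoint open stars, because the vertices of a
  triangle have distinct images.\<close>

theorem covering_projectionI:
  assumes X: "closed_surface X" and Y: "triangulated Y" and f: "simplicial X Y f"
    and cycles: "\<And>x. x \<in> cells X 0 \<Longrightarrow>
      \<exists>N \<epsilon> T b c. vertex_cycle X x N \<epsilon> T b c \<and> vertex_cycle Y (f x) N (f \<circ> \<epsilon>) (f \<circ> T) b c"
    and surj: "f ` cells X 0 = cells Y 0"
  shows "covering_projection (realization X) (realization Y) (realization_map Y f)"
proof -
  interpret X: closed_surface X by (rule X)
  interpret Y: triangulated Y by (rule Y)
  let ?p = "realization_map Y f"
  have cells: "f \<sigma> \<in> cells Y n" if "\<sigma> \<in> cells X n" for \<sigma> n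
    using f that by (auto simp: simplicial_def)
  have faces: "face Y k (f \<sigma>) = f (face X k \<sigma>)" if "\<sigma> \<in> cells X (Suc n)" "k \<le> Suc n" for \<sigma> n k
    using f that by (auto simp: simplicial_def)
  have corners: "corner Y (f \<tau>) k = f (corner X \<tau> k)" if \<tau>: "\<tau> \<in> cells X 2" for \<tau> k
  proof -
    have "face Y k (f \<tau>) = f (face X k \<tau>)" if "k \<le> 2" for k
      using faces[of \<tau> 1 k] \<tau> that by (simp add: numeral_2_eq_2 One_nat_def)
    moreover have "face Y l (f (face X k \<tau>)) = f (face X l (face X k \<tau>))" if "k \<le> 2" "l \<le> 1" for k l
      using faces[of "face X k \<tau>" 0 l] X.face_2[OF \<tau> that(1)] that by (simp add: One_nat_def)
    ultimately show ?thesis by (simp add: corner_def)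
  qed
  have cont: "continuous_map (realization X) (realization Y) ?p"
    by (rule realization_map_continuous[OF Y.delta f])
  have into: "?p P \<in> topspace (realization Y)" if "P \<in> topspace (realization X)" for P
    using cont that by (auto simp: continuous_map_def)
  have homeo: "homeomorphic_map (X.star_space x) (Y.star_space (f x)) ?p"
    if x: "x \<in> cells X 0" for x
  proof -
    obtain N \<epsilon> T b c where cyc: "vertex_cycle X x N \<epsilon> T b c" "vertex_cycle Y (f x) N (f \<circ> \<epsilon>) (f \<circ> T) b c"
      using cycles[OF x] by blast
    interpret A: vertex_cycle X x N \<epsilon> T b c by (rule cyc(1))
    interpret B: vertex_cycle Y "f x" N "f \<circ> \<epsilon>" "f \<circ> T" b c by (rule cyc(2))
    have same: "?p P \<in> Y.star (f x) \<and> B.chart (?p P) = A.chart P" if P: "P \<in> X.star x" for P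
    proof -
      obtain j u r where j: "j < N" "0 \<le> u" "u < 1" "0 \<le> r" "r < 1" "P = A.spoke j u r"
        using A.star_spoke[OF P] .
      note j' = j(1,2) less_imp_le[OF j(3)] j(4) less_imp_le[OF j(5)]
      have "?p P = B.spoke j u r"
        unfolding j(6) A.spoke_def B.spoke_def
        using realization_map_pt[OF Y.delta f A.T_cells[OF j(1)] A.spoke_simplex[OF j']]
        by (simp add: A.a_def B.a_def)
      then show ?thesis
        using A.chart_spoke[OF j'] B.chart_spoke[OF j'] B.spoke_values(1,2)[OF j'] j(5,6) by simp
    qed
    obtain g where g: "homeomorphic_maps (Y.star_space (f x)) (top_of_set star_model) B.chart g"
      using B.chart_homeomorphic_map unfolding homeomorphic_map_maps by blast
    then have "homeomorphic_map (top_of_set star_model) (Y.star_space (f x)) g"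
      using homeomorphic_map_maps homeomorphic_maps_sym by blast
    then have "homeomorphic_map (X.star_space x) (Y.star_space (f x))
        (g \<circ> A.chart)"
      by (rule homeomorphic_map_compose[OF A.chart_homeomorphic_map])
    then show ?thesis
    proof (rule homeomorphic_map_eq)
      fix P assume "P \<in> topspace (X.star_space x)"
      then have p: "?p P \<in> topspace (Y.star_space (f x))" "B.chart (?p P) = A.chart P"
        using same by auto
      have "g (B.chart (?p P)) = ?p P" using g p(1) unfolding homeomorphic_maps_def by blast
      then show "(g \<circ> A.chart) P = ?p P" by (simp add: p(2))
    qed
  qed
  have over: "{P \<in> topspace (realization X). ?p P \<in> Y.star y} = \<Union>(X.star ` {x \<in> cells X 0. f x = y})" for y
  proof (intro equalityI subsetI)
    fix P assume "P \<in> \<Union>(X.star ` {x \<in> cells X 0. f x = y})"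
    then obtain x where x: "x \<in> cells X 0" "f x = y" "P \<in> X.star x" by auto
    then have "?p P \<in> Y.star y"
      using homeomorphic_imp_surjective_map[OF homeo[OF x(1)]] by auto
    then show "P \<in> {P \<in> topspace (realization X). ?p P \<in> Y.star y}" using x(3) by blast
  next
    fix P assume P: "P \<in> {P \<in> topspace (realization X). ?p P \<in> Y.star y}"
    then obtain \<tau> t where t: "\<tau> \<in> cells X 2" "t \<in> standard_simplex 2" "P = pt X 2 \<tau> t"
      using X.point_in_triangle by blast
    have p: "?p P = pt Y 2 (f \<tau>) t" unfolding t(3) by (rule realization_map_pt[OF Y.delta f t(1,2)])
    have "Y.weight y (pt Y 2 (f \<tau>) t) \<noteq> 0" using P unfolding p[symmetric] by auto
    then obtain k where k: "k \<le> 2" "corner Y (f \<tau>) k = y" "t k = Y.weight y (pt Y 2 (f \<tau>) t)"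
      using Y.weight_nonzero_corner[OF cells[OF t(1)] t(2)] by blast
    have "0 < t k" using P k(3) by (simp add: p)
    then have "P \<in> X.star (corner X \<tau> k)"
      using X.weight_triangle[OF t(1,2) k(1) HOL.refl] P t(3) by simp
    moreover have "corner X \<tau> k \<in> {x \<in> cells X 0. f x = y}"
      using corners[OF t(1)] k(2) X.corner_cells[OF t(1)] by simp
    ultimately show "P \<in> \<Union>(X.star ` {x \<in> cells X 0. f x = y})" by blast
  qed
  have disj: "disjoint (X.star ` {x \<in> cells X 0. f x = y})" for y
  proof -
    have "x = x'" if "f x = y" "f x' = y" "P \<in> X.star x" "P \<in> X.star x'" for x x' P
    proof -
      obtain \<tau> t where t: "\<tau> \<in> cells X 2" "t \<in> standard_simplex 2" "P = pt X 2 \<tau> t"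
        using X.point_in_triangle[of P] \<open>P \<in> X.star x\<close> by simp metis
      have w: "X.weight x (pt X 2 \<tau> t) \<noteq> 0" "X.weight x' (pt X 2 \<tau> t) \<noteq> 0"
        using \<open>P \<in> X.star x\<close> \<open>P \<in> X.star x'\<close> unfolding t(3) by simp_all
      obtain k where k: "k \<le> 2" "corner X \<tau> k = x"
        using X.weight_nonzero_corner[OF t(1,2) w(1)] by metis
      obtain l where l: "l \<le> 2" "corner X \<tau> l = x'"
        using X.weight_nonzero_corner[OF t(1,2) w(2)] by metis
      have "corner Y (f \<tau>) k = corner Y (f \<tau>) l"
        using corners[OF t(1)] k(2) l(2) \<open>f x = y\<close> \<open>f x' = y\<close> by simp
      then have "k = l" by (rule Y.corner_inj[OF cells[OF t(1)] k(1) l(1)])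
      then show ?thesis using k(2) l(2) by simp
    qed
    then show ?thesis unfolding disjoint_def by blast
  qed
  show ?thesis
    unfolding covering_projection_def
  proof (intro conjI ballI)
    show "?p ` topspace (realization X) = topspace (realization Y)"
    proof
      show "?p ` topspace (realization X) \<subseteq> topspace (realization Y)" using into by blast
      show "topspace (realization Y) \<subseteq> ?p ` topspace (realization X)"
      proof
        fix Q assume Q: "Q \<in> topspace (realization Y)"
        then obtain y where y: "y \<in> cells Y 0" "0 < Y.weight y Q" using Y.some_weight_positive by blast
        then obtain x where "x \<in> cells X 0" "y = f x" using surj by blast
        then have x: "x \<in> cells X 0" "f x = y" "Q \<in> Y.star y" using Q y(2) by auto
        have "?p ` topspace (X.star_space x) = topspace (Y.star_space (f x))"
          by (rule homeomorphic_imp_surjective_map[OF homeo[OF x(1)]])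
        then show "Q \<in> ?p ` topspace (realization X)" using x(2,3) by auto
      qed
    qed
    fix Q assume Q: "Q \<in> topspace (realization Y)"
    then obtain y where y: "y \<in> cells Y 0" "0 < Y.weight y Q" using Y.some_weight_positive by blast
    have o: "openin (realization Y) (Y.star y)"
      using openin_continuous_map_preimage[OF Y.weight_continuous, of "{0<..}" y] by simp
    have oX: "openin (realization X) (X.star x)" for x
      using openin_continuous_map_preimage[OF X.weight_continuous, of "{0<..}" x] by simp
    show "\<exists>U. openin (realization Y) U \<and> Q \<in> U \<and>
        (\<exists>\<V>. \<Union>\<V> = {P \<in> topspace (realization X). ?p P \<in> U} \<and>
          (\<forall>V\<in>\<V>. openin (realization X) V) \<and> disjoint \<V> \<and>
          (\<forall>V\<in>\<V>. homeomorphic_map (subtopology (realization X) V) (subtopology (realization Y) U) ?p))"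
    proof (intro exI[of _ "Y.star y"] exI[of _ "X.star ` {x \<in> cells X 0. f x = y}"] conjI ballI)
      show "openin (realization Y) (Y.star y)" by (rule o)
      show "Q \<in> Y.star y" using Q y(2) by simp
      show "\<Union>(X.star ` {x \<in> cells X 0. f x = y}) = {P \<in> topspace (realization X). ?p P \<in> Y.star y}"
        by (rule over[symmetric])
      show "disjoint (X.star ` {x \<in> cells X 0. f x = y})" by (rule disj)
      fix V assume "V \<in> X.star ` {x \<in> cells X 0. f x = y}"
      then obtain x where x: "x \<in> cells X 0" "f x = y" "V = X.star x" by blast
      show "openin (realization X) V" unfolding x(3) by (rule oX)
      show "homeomorphic_map (subtopology (realization X) V) (subtopology (realization Y) (Y.star y)) ?p"
        using homeo[OF x(1)] unfolding x(2,3) .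
    qed
  qed (rule cont)
qed

section \<open>The elliptic surface of an elliptic generating system\<close>

lemma cells_elliptic_surface [simp]: "cells (elliptic_surface G gs) = elliptic_cells G gs"
  and face_elliptic_surface [simp]: "face (elliptic_surface G gs) = elliptic_face G gs"
  by (simp_all add: elliptic_surface_def)

lemma elliptic_cells_0: "elliptic_cells G gs 0 =
    {V0 g | g. g \<in> carrier G} \<union> {O0 g | g. g \<in> carrier G} \<union>
    {C0 i (g <#\<^bsub>G\<^esub> generate G {gs ! i}) | i g. i < length gs \<and> g \<in> carrier G}"
  by (simp add: elliptic_cells_def Let_def)

lemma elliptic_cells_1: "elliptic_cells G gs 1 =
    {E1 i g | i g. i < length gs \<and> g \<in> carrier G} \<union> {R1 i g | i g. i < length gs \<and> g \<in> carrier G} \<union>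
    {S1 i g | i g. i < length gs \<and> g \<in> carrier G}"
  by (simp add: elliptic_cells_def Let_def)

lemma elliptic_cells_2: "elliptic_cells G gs 2 =
    {F2 i g | i g. i < length gs \<and> g \<in> carrier G} \<union> {T2 i g | i g. i < length gs \<and> g \<in> carrier G}"
  by (simp add: elliptic_cells_def Let_def)

lemma elliptic_cells_empty: "2 < n \<Longrightarrow> elliptic_cells G gs n = {}"
  by (simp add: elliptic_cells_def Let_def)

lemma (in group) pow_mod_ord:
  assumes "x \<in> carrier G"
  shows "x [^] (k mod ord x) = x [^] k"
proof -
  have "x [^] k = x [^] (ord x * (k div ord x) + k mod ord x)" by simp
  also have "\<dots> = x [^] (ord x * (k div ord x)) \<otimes> x [^] (k mod ord x)"
    using assms by (simp only: nat_pow_mult)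
  also have "x [^] (ord x * (k div ord x)) = \<one>"
    using assms nat_pow_pow[of x "ord x" "k div ord x"] by simp
  finally show ?thesis using assms by simp
qed

definition v_right :: "nat \<Rightarrow> nat" where
  "v_right j = (if j mod 4 = 1 then 1 else if j mod 4 = 3 then 0 else 2)"

definition v_left :: "nat \<Rightarrow> nat" where
  "v_left j = (if j mod 4 = 0 then 1 else if j mod 4 = 2 then 0 else 2)"

locale elliptic_group = group G for G :: "('a, 'b) monoid_scheme" (structure) +
  fixes gs :: "'a list"
  assumes finite_G: "finite (carrier G)" and elliptic: "elliptic_system G gs"
begin

abbreviation Y where "Y \<equiv> elliptic_surface G gs"
abbreviation L where "L \<equiv> length gs"
abbreviation coset where "coset i g \<equiv> g <# generate G {gs ! i}"

lemma L_pos: "0 < L"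
  using elliptic by (simp add: elliptic_system_def)

lemma gen_closed [simp]: "i < L \<Longrightarrow> gs ! i \<in> carrier G"
  using elliptic by (auto simp: elliptic_system_def)

lemma gen_not_one: "i < L \<Longrightarrow> gs ! i \<noteq> \<one>"
  using elliptic ord_id by (metis elliptic_system_def less_irrefl nth_mem)

lemma ord_gen_pos: "i < L \<Longrightarrow> 0 < ord (gs ! i)"
  using elliptic by (metis elliptic_system_def gr_zeroI not_less0 nth_mem)

lemma mult_gen_neq: "i < L \<Longrightarrow> g \<in> carrier G \<Longrightarrow> g \<otimes> gs ! i \<noteq> g"
  using gen_not_one[of i] by simp

lemma generate_gen: "i < L \<Longrightarrow> generate G {gs ! i} = {gs ! i [^] k | k. k \<in> (UNIV :: nat set)}"
  using ord_gen_pos[of i] by (intro generate_pow_nat) auto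

lemma coset_mult_gen_power:
  assumes "i < L" "g \<in> carrier G"
  shows "coset i (g \<otimes> gs ! i [^] (k::nat)) = coset i g"
proof -
  have "subgroup (generate G {gs ! i}) G" using assms by (intro generate_is_subgroup) simp
  moreover have "gs ! i [^] k \<in> generate G {gs ! i}" using generate_gen[OF assms(1)] by blast
  ultimately have "gs ! i [^] k <# generate G {gs ! i} = generate G {gs ! i}"
    using assms by (intro coset_join3) auto
  then show ?thesis
    using lcos_m_assoc[of "generate G {gs ! i}" g "gs ! i [^] k"] assms generate_incl[of "{gs ! i}"] by simp
qed

lemma coset_mult_gen:
  assumes "i < L" "g \<in> carrier G"
  shows "coset i (g \<otimes> gs ! i) = coset i g"
  using coset_mult_gen_power[OF assms, of 1] assms by simp

lemma coset_eqD:
  assumes "i < L" "g \<in> carrier G" "h \<in> carrier G" "coset i h = coset i g"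
  obtains k where "k < ord (gs ! i)" "h = g \<otimes> gs ! i [^] k"
proof -
  have "h = h \<otimes> \<one>" "\<one> \<in> generate G {gs ! i}" using assms by (auto intro: generate.one)
  then have "h \<in> coset i h" unfolding l_coset_def by blast
  then have "h \<in> coset i g" using assms(4) by simp
  then obtain k where "h = g \<otimes> gs ! i [^] (k::nat)"
    unfolding l_coset_def using generate_gen[OF assms(1)] by auto
  moreover have "gs ! i [^] k = gs ! i [^] (k mod ord (gs ! i))"
    using pow_mod_ord[of "gs ! i"] assms by simp
  ultimately show thesis using that[of "k mod ord (gs ! i)"] ord_gen_pos[OF assms(1)] by simp
qed

definition tail_product :: "nat \<Rightarrow> 'a" where
  "tail_product i = list_mult G (drop i gs)"

lemma tail_closed [simp]: "tail_product i \<in> carrier G"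
proof -
  have "set (drop i gs) \<subseteq> carrier G"
    using elliptic set_drop_subset[of i gs] by (auto simp: elliptic_system_def)
  then show ?thesis unfolding tail_product_def by (rule list_mult_closed)
qed

lemma tail_0: "tail_product 0 = \<one>"
  using elliptic by (simp add: tail_product_def elliptic_system_def)

text \<open>The tails \<open>g\<^sub>i\<dots>g\<^sub>d\<^sub>+\<^sub>1\<close> of the product close up cyclically because the whole product is \<open>1\<close>.\<close>

lemma tail_Suc:
  assumes "i < L"
  shows "tail_product i = gs ! i \<otimes> tail_product (Suc i mod L)"
proof -
  have d: "tail_product i = gs ! i \<otimes> list_mult G (drop (Suc i) gs)"
    using assms by (simp add: tail_product_def list_mult_def Cons_nth_drop_Suc[symmetric])
  show ?thesis
  proof (cases "Suc i = L")
    case True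
    then show ?thesis using d tail_0 by (simp add: list_mult_def)
  next
    case False
    then show ?thesis using d assms by (simp add: tail_product_def)
  qed
qed

lemma face_S1: "elliptic_face G gs k (S1 i g) = (if k = 0 then O0 (g \<otimes> tail_product i) else V0 g)"
  by (simp add: tail_product_def)

declare elliptic_face.simps(3) [simp del]
declare face_S1 [simp]

lemma delta_Y: "delta_complex Y"
  unfolding delta_complex_def cells_elliptic_surface face_elliptic_surface
proof (intro conjI allI ballI impI)
  fix n \<sigma> k assume \<sigma>: "\<sigma> \<in> elliptic_cells G gs (Suc n)" and k: "k \<le> Suc n"
  have "n = 0 \<or> n = 1" using elliptic_cells_empty[of "Suc n" G gs] \<sigma> by fastforce
  then show "elliptic_face G gs k \<sigma> \<in> elliptic_cells G gs n"
  proof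
    assume n: "n = 0"
    then have "\<sigma> \<in> elliptic_cells G gs 1" using \<sigma> by (simp add: One_nat_def)
    then show ?thesis unfolding n
      by (cases "k = 0") (auto simp: elliptic_cells_1 elliptic_cells_0)
  next
    assume n: "n = 1"
    then have "\<sigma> \<in> elliptic_cells G gs 2" using \<sigma> by (simp add: numeral_2_eq_2 One_nat_def)
    moreover have "k = 0 \<or> k = 1 \<or> k = 2" using k n by auto
    ultimately show ?thesis unfolding n using L_pos
      by (elim disjE) (auto simp: elliptic_cells_1 elliptic_cells_2)
  qed
next
  fix n \<sigma> k l assume \<sigma>: "\<sigma> \<in> elliptic_cells G gs (Suc (Suc n))" and kl: "k < l \<and> l \<le> Suc (Suc n)"
  have n: "n = 0" using elliptic_cells_empty[of "Suc (Suc n)" G gs] \<sigma> by fastforce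
  then have "\<sigma> \<in> elliptic_cells G gs 2" using \<sigma> by (simp add: numeral_2_eq_2)
  then obtain i g where ig: "i < L" "g \<in> carrier G" "\<sigma> = F2 i g \<or> \<sigma> = T2 i g"
    by (auto simp: elliptic_cells_2)
  have "k = 0 \<and> l = 1 \<or> k = 0 \<and> l = 2 \<or> k = 1 \<and> l = 2" using kl n by auto
  moreover have "g \<otimes> gs ! i \<otimes> tail_product (Suc i mod L) = g \<otimes> tail_product i"
    using ig by (simp add: m_assoc tail_Suc[symmetric])
  ultimately show "elliptic_face G gs k (elliptic_face G gs l \<sigma>)
      = elliptic_face G gs (l - 1) (elliptic_face G gs k \<sigma>)"
    using ig coset_mult_gen[OF ig(1,2)] by (elim disjE conjE) (simp_all add: One_nat_def)
qed

lemma finite_elliptic_cells: "finite (elliptic_cells G gs n)"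
proof -
  have "finite {f i g | i g. i < L \<and> g \<in> carrier G}" for f :: "nat \<Rightarrow> 'a \<Rightarrow> 'a esimplex"
    using finite_G finite_image_set2[of "\<lambda>i. i < L" "\<lambda>g. g \<in> carrier G" f] by simp
  moreover have "finite {f g | g. g \<in> carrier G}" for f :: "'a \<Rightarrow> 'a esimplex"
    using finite_G by simp
  moreover have "n = 0 \<or> n = 1 \<or> n = 2 \<or> 2 < n" by auto
  ultimately show ?thesis
    by (elim disjE) (simp_all add: elliptic_cells_0 elliptic_cells_1 elliptic_cells_2 elliptic_cells_empty)
qed

sublocale triangulated Y
proof
  show "delta_complex Y" by (rule delta_Y)
  show "cells Y n = {}" if "2 < n" for n using that by (simp add: elliptic_cells_empty)
  show "finite (cells Y n)" for n by (simp add: finite_elliptic_cells)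
  show "\<exists>e\<in>cells Y 1. \<exists>k\<le>1. face Y k e = v" if "v \<in> cells Y 0" for v
  proof -
    have "v \<in> elliptic_cells G gs 0" using that by simp
    then consider g where "g \<in> carrier G" "v = V0 g" | g where "g \<in> carrier G" "v = O0 g"
      | i g where "i < L" "g \<in> carrier G" "v = C0 i (coset i g)"
      unfolding elliptic_cells_0 by blast
    then show ?thesis
    proof cases
      case 1
      then show ?thesis using L_pos
        by (intro bexI[of _ "E1 0 g"] exI[of _ 1]) (auto simp: elliptic_cells_1)
    next
      case 2
      then show ?thesis using L_pos
        by (intro bexI[of _ "S1 0 g"] exI[of _ 0]) (auto simp: elliptic_cells_1 tail_0)
    next
      case 3
      then show ?thesis
        by (intro bexI[of _ "R1 i g"] exI[of _ 0]) (auto simp: elliptic_cells_1)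
    qed
  qed
  show "\<exists>\<tau>\<in>cells Y 2. \<exists>k\<le>2. face Y k \<tau> = e" if "e \<in> cells Y 1" for e
  proof -
    have "e \<in> elliptic_cells G gs 1" using that by simp
    then consider i g where "i < L" "g \<in> carrier G" "e = E1 i g"
      | i g where "i < L" "g \<in> carrier G" "e = R1 i g" | i g where "i < L" "g \<in> carrier G" "e = S1 i g"
      unfolding elliptic_cells_1 by blast
    then show ?thesis
    proof cases
      case 1
      then show ?thesis by (intro bexI[of _ "F2 i g"] exI[of _ 2]) (auto simp: elliptic_cells_2)
    next
      case 2
      then show ?thesis by (intro bexI[of _ "F2 i g"] exI[of _ 1]) (auto simp: elliptic_cells_2)
    next
      case 3
      then show ?thesis by (intro bexI[of _ "T2 i g"] exI[of _ 1]) (auto simp: elliptic_cells_2)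
    qed
  qed
  show "face Y 0 e \<noteq> face Y 1 e" if "e \<in> cells Y 1" for e
    using that by (auto simp: elliptic_cells_1 dest: mult_gen_neq)
qed

lemma triangle_cases:
  assumes "\<tau> \<in> cells Y 2"
  obtains i g where "i < L" "g \<in> carrier G" "\<tau> = F2 i g" | i g where "i < L" "g \<in> carrier G" "\<tau> = T2 i g"
  using assms unfolding cells_elliptic_surface elliptic_cells_2 by blast

lemma triangle_cells: "i < L \<Longrightarrow> g \<in> carrier G \<Longrightarrow> F2 i g \<in> cells Y 2 \<and> T2 i g \<in> cells Y 2"
  by (auto simp: elliptic_cells_2)

lemma corner_F2: "corner Y (F2 i g) k =
    (if k = 0 then V0 g else if k = 1 then V0 (g \<otimes> gs ! i) else C0 i (coset i g))"
  and corner_T2: "corner Y (T2 i g) k =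
    (if k = 0 then V0 g else if k = 1 then V0 (g \<otimes> gs ! i) else O0 (g \<otimes> tail_product i))"
  by (simp_all add: corner_def)

text \<open>Around \<open>g\<close>\<^bold>\<open>v\<close> the edges \<open>g\<close>\<^bold>\<open>s\<close>\<open>\<^sub>i\<close>, \<open>g\<close>\<^bold>\<open>e\<close>\<open>\<^sub>i\<close>, \<open>g\<close>\<^bold>\<open>r\<close>\<open>\<^sub>i\<close>, \<open>gg\<^sub>i\<inverse>\<close>\<^bold>\<open>e\<close>\<open>\<^sub>i\<close> follow each other for
  each \<open>i\<close>, the last one arriving at \<open>g\<close>\<^bold>\<open>v\<close>, and then come the edges for \<open>i + 1\<close>; position \<open>j = 4i + s\<close> encodes
  the \<open>s\<close>-th of the four. Each of the triangles \<open>g\<close>\<^bold>\<open>t\<close>\<open>\<^sub>i\<close>, \<open>g\<close>\<^bold>\<open>f\<close>\<open>\<^sub>i\<close>, \<open>gg\<^sub>i\<inverse>\<close>\<^bold>\<open>f\<close>\<open>\<^sub>i\<close>, \<open>gg\<^sub>i\<inverse>\<close>\<^bold>\<open>t\<close>\<open>\<^sub>i\<close> lies between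
  one of them and the next.\<close>

definition v_edge :: "'a \<Rightarrow> nat \<Rightarrow> 'a esimplex" where
  "v_edge g j = (let i = j div 4; s = j mod 4 in
     if s = 0 then S1 i g else if s = 1 then E1 i g else if s = 2 then R1 i g
     else E1 i (g \<otimes> inv (gs ! i)))"

definition v_triangle :: "'a \<Rightarrow> nat \<Rightarrow> 'a esimplex" where
  "v_triangle g j = (let i = j div 4; s = j mod 4 in
     if s = 0 then T2 i g else if s = 1 then F2 i g else if s = 2 then F2 i (g \<otimes> inv (gs ! i))
     else T2 i (g \<otimes> inv (gs ! i)))"

lemma mod_4_cases: "j mod 4 = 0 \<or> j mod 4 = 1 \<or> j mod 4 = 2 \<or> j mod 4 = (3::nat)"
  by linarith

lemma v_cycle:
  assumes g: "g \<in> carrier G"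
  shows "vertex_cycle Y (V0 g) (4 * L) (v_edge g) (v_triangle g) v_right v_left"
proof
  have cancel: "g \<otimes> inv (gs ! i) \<otimes> gs ! i = g" "g \<otimes> inv (gs ! i) \<in> carrier G"
    "g \<otimes> inv (gs ! i) \<noteq> g" if "i < L" for i
  proof -
    show c: "g \<otimes> inv (gs ! i) \<otimes> gs ! i = g" "g \<otimes> inv (gs ! i) \<in> carrier G"
      using g that by (simp_all add: m_assoc)
    show "g \<otimes> inv (gs ! i) \<noteq> g" using c(1) mult_gen_neq[OF that g] by metis
  qed
  show "0 < 4 * L" using L_pos by simp
  fix j assume j: "j < 4 * L"
  have i: "j div 4 < L" using j by linarith
  note s = mod_4_cases[of j]
  show "v_triangle g j \<in> cells Y 2"
    using s i g cancel[OF i] by (elim disjE) (simp_all add: v_triangle_def Let_def elliptic_cells_2)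
  show "v_right j \<le> 2 \<and> v_left j \<le> 2 \<and> v_right j \<noteq> v_left j"
    using s by (elim disjE) (simp_all add: v_right_def v_left_def)
  show "corner Y (v_triangle g j) (3 - v_right j - v_left j) = V0 g"
    using s cancel[OF i]
    by (elim disjE) (simp_all add: v_triangle_def v_right_def v_left_def Let_def corner_F2 corner_T2)
  show "face Y (v_left j) (v_triangle g j) = v_edge g j"
    using s cancel[OF i]
    by (elim disjE) (simp_all add: v_triangle_def v_edge_def v_left_def Let_def)
  show "face Y (v_right j) (v_triangle g j) = v_edge g (Suc j mod (4 * L))"
  proof (cases "j mod 4 = 3")
    case True
    then have "Suc j = 4 * Suc (j div 4)" by presburger
    then have "Suc j mod (4 * L) = 4 * (Suc (j div 4) mod L)" by (simp only: mult_mod_right)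
    then show ?thesis using True cancel[OF i]
      by (simp add: v_triangle_def v_edge_def v_right_def Let_def)
  next
    case False
    then have d: "Suc j div 4 = j div 4" "Suc j mod 4 = Suc (j mod 4)" by presburger+
    have "Suc j \<noteq> 4 * L" using False by presburger
    then have "Suc j mod (4 * L) = Suc j" using j by simp
    then show ?thesis using s False
      by (elim disjE) (simp_all add: v_triangle_def v_edge_def v_right_def Let_def d)
  qed
next
  have neq: "g \<otimes> inv (gs ! i) \<noteq> g" if "i < L" for i
    using mult_gen_neq[OF that g] g that by (metis inv_closed gen_closed inv_solve_right m_closed)
  have div: "j div 4 < L" if "j < 4 * L" for j using that by linarith
  have eq: "j = k" if "j div 4 = k div 4" "j mod 4 = k mod 4" for j k :: nat
    using that by (metis div_mult_mod_eq)
  define h where "h i = g \<otimes> inv (gs ! i)" for i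
  have edge: "v_edge g j = (if j mod 4 = 0 then S1 (j div 4) g else if j mod 4 = 1 then E1 (j div 4) g
      else if j mod 4 = 2 then R1 (j div 4) g else E1 (j div 4) (h (j div 4)))" for j
    by (simp add: v_edge_def Let_def h_def)
  have triangle: "v_triangle g j = (if j mod 4 = 0 then T2 (j div 4) g else if j mod 4 = 1 then F2 (j div 4) g
      else if j mod 4 = 2 then F2 (j div 4) (h (j div 4)) else T2 (j div 4) (h (j div 4)))" for j
    by (simp add: v_triangle_def Let_def h_def)
  have hg: "h (j div 4) \<noteq> g" "g \<noteq> h (j div 4)" if "j < 4 * L" for j
    using neq[OF div[OF that]] unfolding h_def by (metis, metis)
  show "inj_on (v_edge g) {..<4 * L}"
  proof (rule inj_onI)
    fix j k assume "j \<in> {..<4 * L}" "k \<in> {..<4 * L}" and e: "v_edge g j = v_edge g k"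
    then have jk: "j < 4 * L" "k < 4 * L" by auto
    have "j div 4 = k div 4 \<and> j mod 4 = k mod 4"
      using mod_4_cases[of j] mod_4_cases[of k] e hg[OF jk(1)] hg[OF jk(2)]
      unfolding edge by (elim disjE) simp_all
    then show "j = k" using eq by blast
  qed
  show "inj_on (v_triangle g) {..<4 * L}"
  proof (rule inj_onI)
    fix j k assume "j \<in> {..<4 * L}" "k \<in> {..<4 * L}" and e: "v_triangle g j = v_triangle g k"
    then have jk: "j < 4 * L" "k < 4 * L" by auto
    have "j div 4 = k div 4 \<and> j mod 4 = k mod 4"
      using mod_4_cases[of j] mod_4_cases[of k] e hg[OF jk(1)] hg[OF jk(2)]
      unfolding triangle by (elim disjE) simp_all
    then show "j = k" using eq by blast
  qed
  fix \<tau> k assume \<tau>: "\<tau> \<in> cells Y 2" and k: "k \<le> 2" and c: "corner Y \<tau> k = V0 g"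
  have solve: "h = g \<otimes> inv (gs ! i)" if "h \<otimes> gs ! i = g" "i < L" "h \<in> carrier G" for h i
    using that g by (simp add: inv_solve_right)
  have dm: "(4 * i + s) div 4 = i \<and> (4 * i + s) mod 4 = s" if "s < 4" for i s :: nat using that by simp
  have vals: "v_triangle g (4 * i + 0) = T2 i g" "v_triangle g (4 * i + 1) = F2 i g"
    "v_triangle g (4 * i + 2) = F2 i (g \<otimes> inv (gs ! i))"
    "v_triangle g (4 * i + 3) = T2 i (g \<otimes> inv (gs ! i))" for i
    unfolding v_triangle_def Let_def using dm[of 0 i] dm[of 1 i] dm[of 2 i] dm[of 3 i] by (simp_all only:) simp_all
  have bound: "4 * i + s < 4 * L" if "i < L" "s < 4" for i s using that by linarith
  from \<tau> show "\<exists>j<4 * L. \<tau> = v_triangle g j"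
  proof (cases rule: triangle_cases)
    case (1 i h)
    then have "h = g \<or> h = g \<otimes> inv (gs ! i)" using c solve[of h i] by (auto simp: corner_F2 split: if_splits)
    then have "\<tau> = v_triangle g (4 * i + 1) \<or> \<tau> = v_triangle g (4 * i + 2)" unfolding vals 1(3) by auto
    moreover have "4 * i + 1 < 4 * L" "4 * i + 2 < 4 * L" using bound[OF 1(1), of 1] bound[OF 1(1), of 2] by simp_all
    ultimately show ?thesis by blast
  next
    case (2 i h)
    then have "h = g \<or> h = g \<otimes> inv (gs ! i)" using c solve[of h i] by (auto simp: corner_T2 split: if_splits)
    then have "\<tau> = v_triangle g (4 * i + 0) \<or> \<tau> = v_triangle g (4 * i + 3)" unfolding vals 2(3) by auto
    moreover have "4 * i + 0 < 4 * L" "4 * i + 3 < 4 * L" using bound[OF 2(1), of 0] bound[OF 2(1), of 3] by simp_all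
    ultimately show ?thesis by blast
  qed
qed

text \<open>Turning around \<open>g\<close>\<^bold>\<open>c\<close>\<open>\<^sub>i\<close> by one triangle multiplies \<open>g\<close> by \<open>g\<^sub>i\<close> on the right, so the cycle closes after
  \<open>m\<^sub>i\<close> steps.\<close>

lemma c_cycle:
  assumes i: "i < L" and g: "g \<in> carrier G"
  shows "vertex_cycle Y (C0 i (coset i g)) (ord (gs ! i))
    (\<lambda>k. R1 i (g \<otimes> gs ! i [^] k)) (\<lambda>k. F2 i (g \<otimes> gs ! i [^] k)) (\<lambda>_. 0) (\<lambda>_. 1)"
proof
  let ?m = "ord (gs ! i)"
  show "0 < ?m" by (rule ord_gen_pos[OF i])
  have c: "g \<otimes> gs ! i [^] (k::nat) \<in> carrier G" for k using i g by simp
  have inj: "k = l" if kl: "k < ?m" "l < ?m" "g \<otimes> gs ! i [^] k = g \<otimes> gs ! i [^] l" for k l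
  proof -
    have "gs ! i [^] k = gs ! i [^] l" using kl(3) i g by simp
    moreover have "inj_on (\<lambda>x. gs ! i [^] x) {0..?m - 1}" using ord_inj[of "gs ! i"] i by simp
    ultimately show ?thesis using kl(1,2) by (auto simp: inj_on_def)
  qed
  show "inj_on (\<lambda>k. R1 i (g \<otimes> gs ! i [^] k)) {..<?m}" "inj_on (\<lambda>k. F2 i (g \<otimes> gs ! i [^] k)) {..<?m}"
    using inj by (auto intro!: inj_onI)
  fix j assume "j < ?m"
  show "F2 i (g \<otimes> gs ! i [^] j) \<in> cells Y 2" using triangle_cells[OF i c] by simp
  show "(0::nat) \<le> 2 \<and> (1::nat) \<le> 2 \<and> (0::nat) \<noteq> 1" by simp
  show "corner Y (F2 i (g \<otimes> gs ! i [^] j)) (3 - 0 - 1) = C0 i (coset i g)"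
    by (simp add: corner_F2 coset_mult_gen_power[OF i g])
  show "face Y 1 (F2 i (g \<otimes> gs ! i [^] j)) = R1 i (g \<otimes> gs ! i [^] j)" by simp
  have "g \<otimes> gs ! i [^] j \<otimes> gs ! i = g \<otimes> gs ! i [^] Suc j" using i g by (simp add: m_assoc)
  also have "gs ! i [^] Suc j = gs ! i [^] (Suc j mod ?m)" using pow_mod_ord[of "gs ! i" "Suc j"] i by simp
  finally show "face Y 0 (F2 i (g \<otimes> gs ! i [^] j)) = R1 i (g \<otimes> gs ! i [^] (Suc j mod ?m))" by simp
next
  fix \<tau> k assume \<tau>: "\<tau> \<in> cells Y 2" and k: "k \<le> 2" and c: "corner Y \<tau> k = C0 i (coset i g)"
  from \<tau> show "\<exists>j< ord (gs ! i). \<tau> = F2 i (g \<otimes> gs ! i [^] j)"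
  proof (cases rule: triangle_cases)
    case (1 l h)
    then have "l = i" "coset i h = coset i g" using c by (auto simp: corner_F2 split: if_splits)
    then show ?thesis using coset_eqD[OF i g 1(2)] 1(3) by metis
  next
    case (2 l h)
    then show ?thesis using c by (auto simp: corner_T2 split: if_splits)
  qed
qed

text \<open>The triangle \<open>h\<close>\<^bold>\<open>t\<close>\<open>\<^sub>i\<close> touches \<open>g\<close>\<^bold>\<open>o\<close> exactly if \<open>h\<close> times the tail \<open>g\<^sub>i\<dots>g\<^sub>d\<^sub>+\<^sub>1\<close> is \<open>g\<close>, which leaves one
  triangle for each \<open>i\<close>.\<close>

lemma o_cycle:
  assumes g: "g \<in> carrier G"
  shows "vertex_cycle Y (O0 g) L (\<lambda>i. S1 i (g \<otimes> inv (tail_product i)))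
    (\<lambda>i. T2 i (g \<otimes> inv (tail_product i))) (\<lambda>_. 0) (\<lambda>_. 1)"
proof
  show "0 < L" by (rule L_pos)
  show "inj_on (\<lambda>i. S1 i (g \<otimes> inv (tail_product i))) {..<L}"
    "inj_on (\<lambda>i. T2 i (g \<otimes> inv (tail_product i))) {..<L}"
    by (auto intro!: inj_onI)
  fix i assume i: "i < L"
  show "T2 i (g \<otimes> inv (tail_product i)) \<in> cells Y 2" using triangle_cells[OF i] g by simp
  show "(0::nat) \<le> 2 \<and> (1::nat) \<le> 2 \<and> (0::nat) \<noteq> 1" by simp
  show "corner Y (T2 i (g \<otimes> inv (tail_product i))) (3 - 0 - 1) = O0 g"
    using g by (simp add: corner_T2 m_assoc)
  show "face Y 1 (T2 i (g \<otimes> inv (tail_product i))) = S1 i (g \<otimes> inv (tail_product i))" by simp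
  have "g \<otimes> inv (tail_product i) \<otimes> gs ! i = g \<otimes> inv (tail_product (Suc i mod L))"
    using g i by (simp add: tail_Suc[OF i] inv_mult_group m_assoc)
  then show "face Y 0 (T2 i (g \<otimes> inv (tail_product i)))
      = S1 (Suc i mod L) (g \<otimes> inv (tail_product (Suc i mod L)))" by simp
next
  fix \<tau> k assume \<tau>: "\<tau> \<in> cells Y 2" and k: "k \<le> 2" and c: "corner Y \<tau> k = O0 g"
  from \<tau> show "\<exists>j<L. \<tau> = T2 j (g \<otimes> inv (tail_product j))"
  proof (cases rule: triangle_cases)
    case (1 i h)
    then show ?thesis using c by (auto simp: corner_F2 split: if_splits)
  next
    case (2 i h)
    then have "h \<otimes> tail_product i = g" using c by (auto simp: corner_T2 split: if_splits)
    then have "h = g \<otimes> inv (tail_product i)" using 2 g by (simp add: inv_solve_right)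
    then show ?thesis using 2 by blast
  qed
qed

lemma vertex_cases:
  assumes "x \<in> cells Y 0"
  obtains g where "g \<in> carrier G" "x = V0 g" | g where "g \<in> carrier G" "x = O0 g"
    | i g where "i < L" "g \<in> carrier G" "x = C0 i (coset i g)"
  using assms unfolding cells_elliptic_surface elliptic_cells_0 by blast

sublocale closed_surface Y
proof
  fix x assume "x \<in> cells Y 0"
  then show "\<exists>N \<epsilon> T b c. vertex_cycle Y x N \<epsilon> T b c"
  proof (cases rule: vertex_cases)
    case 1 then show ?thesis using v_cycle by blast
  next
    case 2 then show ?thesis using o_cycle by blast
  next
    case 3 then show ?thesis using c_cycle by blast
  qed
qed

end

section \<open>Orientation and connectedness of elliptic surfaces\<close>

context elliptic_group
begin

definition pred_index :: "nat \<Rightarrow> nat" where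
  "pred_index i = (if i = 0 then L - 1 else i - 1)"

lemma pred_index: "i < L \<Longrightarrow> pred_index i < L \<and> Suc (pred_index i) mod L = i"
  by (auto simp: pred_index_def)

lemma pred_index_unique: "j < L \<Longrightarrow> Suc j mod L = i \<Longrightarrow> j = pred_index i"
  by (cases "Suc j = L") (auto simp: pred_index_def)

lemma in_sides:
  "(\<tau>, k) \<in> sides Y e \<longleftrightarrow> \<tau> \<in> cells Y 2 \<and> (k = 0 \<or> k = 1 \<or> k = 2) \<and> face Y k \<tau> = e"
  by (auto simp: sides_def)

lemma solve_right: "h \<in> carrier G \<Longrightarrow> g \<in> carrier G \<Longrightarrow> i < L \<Longrightarrow> h \<otimes> gs ! i = g \<longleftrightarrow> h = g \<otimes> inv (gs ! i)"
  by (auto simp: m_assoc)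

lemma sides_E1:
  assumes "i < L" "g \<in> carrier G"
  shows "sides Y (E1 i g) = {(F2 i g, 2), (T2 i g, 2)}"
proof (intro equalityI subrelI)
  fix \<tau> k assume "(\<tau>, k) \<in> sides Y (E1 i g)"
  then have \<tau>: "\<tau> \<in> cells Y 2" and k: "k = 0 \<or> k = 1 \<or> k = 2" and f: "face Y k \<tau> = E1 i g"
    by (auto simp: in_sides)
  from \<tau> have "\<tau> = F2 i g \<and> k = 2 \<or> \<tau> = T2 i g \<and> k = 2"
    by (cases rule: triangle_cases) (use k f in \<open>elim disjE; simp\<close>)+
  then show "(\<tau>, k) \<in> {(F2 i g, 2), (T2 i g, 2)}" by auto
qed (use triangle_cells[OF assms] in \<open>auto simp: in_sides\<close>)

lemma sides_R1:
  assumes "i < L" "g \<in> carrier G"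
  shows "sides Y (R1 i g) = {(F2 i (g \<otimes> inv (gs ! i)), 0), (F2 i g, 1)}"
proof (intro equalityI subrelI)
  fix \<tau> k assume "(\<tau>, k) \<in> sides Y (R1 i g)"
  then have \<tau>: "\<tau> \<in> cells Y 2" and k: "k = 0 \<or> k = 1 \<or> k = 2" and f: "face Y k \<tau> = R1 i g"
    by (auto simp: in_sides)
  from \<tau> have "\<tau> = F2 i (g \<otimes> inv (gs ! i)) \<and> k = 0 \<or> \<tau> = F2 i g \<and> k = 1"
  proof (cases rule: triangle_cases)
    case (1 j h)
    then show ?thesis using k f solve_right[of h g i] assms by (elim disjE) auto
  next
    case (2 j h)
    then show ?thesis using k f by (elim disjE) auto
  qed
  then show "(\<tau>, k) \<in> {(F2 i (g \<otimes> inv (gs ! i)), 0), (F2 i g, 1)}" by auto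
next
  have "g \<otimes> inv (gs ! i) \<in> carrier G" "g \<otimes> inv (gs ! i) \<otimes> gs ! i = g"
    using assms by (simp_all add: m_assoc)
  then show "(\<tau>, k) \<in> sides Y (R1 i g)"
    if "(\<tau>, k) \<in> {(F2 i (g \<otimes> inv (gs ! i)), 0), (F2 i g, 1)}" for \<tau> k
    using that triangle_cells[OF assms(1)] assms(2) by (auto simp: in_sides simp del: cells_elliptic_surface)
qed

lemma sides_S1:
  assumes "i < L" "g \<in> carrier G"
  defines "j \<equiv> pred_index i"
  shows "sides Y (S1 i g) = {(T2 j (g \<otimes> inv (gs ! j)), 0), (T2 i g, 1)}"
proof (intro equalityI subrelI)
  fix \<tau> k assume "(\<tau>, k) \<in> sides Y (S1 i g)"
  then have \<tau>: "\<tau> \<in> cells Y 2" and k: "k = 0 \<or> k = 1 \<or> k = 2" and f: "face Y k \<tau> = S1 i g"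
    by (auto simp: in_sides)
  from \<tau> have "\<tau> = T2 j (g \<otimes> inv (gs ! j)) \<and> k = 0 \<or> \<tau> = T2 i g \<and> k = 1"
  proof (cases rule: triangle_cases)
    case (1 l h)
    then show ?thesis using k f by (elim disjE) auto
  next
    case (2 l h)
    then show ?thesis using k f solve_right[of h g l] assms(2) pred_index_unique[of l i] j_def
      by (elim disjE) auto
  qed
  then show "(\<tau>, k) \<in> {(T2 j (g \<otimes> inv (gs ! j)), 0), (T2 i g, 1)}" by auto
next
  have j: "j < L" "Suc j mod L = i" using pred_index[OF assms(1)] by (simp_all add: j_def)
  have "g \<otimes> inv (gs ! j) \<in> carrier G" "g \<otimes> inv (gs ! j) \<otimes> gs ! j = g"
    using assms(2) j by (simp_all add: m_assoc)
  then show "(\<tau>, k) \<in> sides Y (S1 i g)"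
    if "(\<tau>, k) \<in> {(T2 j (g \<otimes> inv (gs ! j)), 0), (T2 i g, 1)}" for \<tau> k
    using that triangle_cells[OF j(1)] triangle_cells[OF assms(1)] assms(2) j(2)
    by (auto simp: in_sides simp del: cells_elliptic_surface)
qed

lemma orientation_Y: "orientation Y elliptic_orientation"
  unfolding orientation_def
proof (intro conjI ballI)
  fix \<tau> assume "\<tau> \<in> cells Y 2"
  then show "elliptic_orientation \<tau> = 1 \<or> elliptic_orientation \<tau> = - 1"
    by (cases rule: triangle_cases) (simp_all add: elliptic_orientation_def)
next
  fix e assume "e \<in> cells Y 1"
  then consider i g where "i < L" "g \<in> carrier G" "e = E1 i g"
    | i g where "i < L" "g \<in> carrier G" "e = R1 i g" | i g where "i < L" "g \<in> carrier G" "e = S1 i g"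
    unfolding cells_elliptic_surface elliptic_cells_1 by blast
  note edge = this
  have two: "\<exists>\<tau> k \<tau>' k'. (\<tau>, k) \<noteq> (\<tau>', k') \<and> sides Y e = {(\<tau>, k), (\<tau>', k')} \<and>
      elliptic_orientation \<tau> * (- 1) ^ k = - (elliptic_orientation \<tau>' * (- 1) ^ k')"
    if "sides Y e = {(\<tau>, k), (\<tau>', k')}" "(\<tau>, k) \<noteq> (\<tau>', k')"
      "elliptic_orientation \<tau> * (- 1) ^ k = - (elliptic_orientation \<tau>' * (- 1) ^ k')" for \<tau> k \<tau>' k'
    using that by blast
  from edge show "\<exists>\<tau> k \<tau>' k'. (\<tau>, k) \<noteq> (\<tau>', k') \<and> sides Y e = {(\<tau>, k), (\<tau>', k')} \<and>
      elliptic_orientation \<tau> * (- 1) ^ k = - (elliptic_orientation \<tau>' * (- 1) ^ k')"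
  proof cases
    case 1
    show ?thesis
      by (rule two[OF sides_E1[OF 1(1,2), folded 1(3)]]) (simp_all add: elliptic_orientation_def)
  next
    case 2
    show ?thesis
      by (rule two[OF sides_R1[OF 2(1,2), folded 2(3)]]) (simp_all add: elliptic_orientation_def)
  next
    case 3
    show ?thesis
      by (rule two[OF sides_S1[OF 3(1,2), folded 3(3)]]) (simp_all add: elliptic_orientation_def)
  qed
qed

text \<open>A clopen set contains each triangle entirely or not at all. It therefore contains all of the vertices
  \<open>g\<close>\<^bold>\<open>v\<close> or none of them, since the triangle \<open>g\<close>\<^bold>\<open>f\<close>\<open>\<^sub>i\<close> joins \<open>g\<close>\<^bold>\<open>v\<close> to \<open>gg\<^sub>i\<close>\<^bold>\<open>v\<close> and the \<open>g\<^sub>i\<close> generate the group; and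
  every triangle has such a vertex.\<close>

lemma connected_Y: "connected_space (realization Y)"
  unfolding connected_space_clopen_in
proof (intro allI impI)
  fix U assume U: "openin (realization Y) U \<and> closedin (realization Y) U"
  let ?o = "\<lambda>i. if i = (0::nat) then 1 else (0::real)"
  let ?v = "\<lambda>g. pt Y 0 (V0 g) ?o"
  have all: "pt Y 2 \<tau> t \<in> U" if \<tau>: "\<tau> \<in> cells Y 2" and t: "t \<in> standard_simplex 2"
    and s: "s \<in> standard_simplex 2" "pt Y 2 \<tau> s \<in> U" for \<tau> t s
  proof -
    have "connectedin (top_of_set (standard_simplex 2)) (standard_simplex 2)"
      using connectedin_standard_simplex[of 2] by (simp add: connectedin_subtopology euclidean_product_topology)
    then have "connectedin (realization Y) (pt Y 2 \<tau> ` standard_simplex 2)"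
      by (rule connectedin_continuous_map_image[OF continuous_map_pt[OF \<tau>]])
    then have "pt Y 2 \<tau> ` standard_simplex 2 \<subseteq> U \<or> disjnt (pt Y 2 \<tau> ` standard_simplex 2) U"
      using U connectedin_clopen_cases by blast
    then show ?thesis using t s by (auto simp: disjnt_def)
  qed
  have corner_pt: "pt Y 2 \<tau> (\<lambda>i. if i = k then 1 else 0) = pt Y 0 (corner Y \<tau> k) ?o"
    if "\<tau> \<in> cells Y 2" "k \<le> 2" for \<tau> k
    by (rule pt_at_corner) (use that in auto)
  have corner_iff: "pt Y 0 (corner Y \<tau> k) ?o \<in> U \<longleftrightarrow> pt Y 2 \<tau> t \<in> U"
    if \<tau>: "\<tau> \<in> cells Y 2" and k: "k \<le> 2" and t: "t \<in> standard_simplex 2" for \<tau> k t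
  proof -
    have b: "(\<lambda>i. if i = k then 1 else 0) \<in> standard_simplex 2" using k by simp
    show ?thesis using all[OF \<tau> t b] all[OF \<tau> b t] unfolding corner_pt[OF \<tau> k] by blast
  qed
  have step: "?v (g \<otimes> gs ! i) \<in> U \<longleftrightarrow> ?v g \<in> U" if "g \<in> carrier G" "i < L" for g i
  proof -
    have F: "F2 i g \<in> cells Y 2" using triangle_cells that by blast
    have b: "(\<lambda>j. if j = (0::nat) then 1 else 0) \<in> standard_simplex 2" by simp
    show ?thesis using corner_iff[OF F, of 0, OF _ b] corner_iff[OF F, of 1, OF _ b] by (simp add: corner_F2)
  qed
  have base: "\<exists>g\<in>carrier G. pt Y 2 \<tau> t \<in> U \<longleftrightarrow> ?v g \<in> U"
    if \<tau>: "\<tau> \<in> cells Y 2" and t: "t \<in> standard_simplex 2" for \<tau> t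
    using \<tau>
  proof (cases rule: triangle_cases)
    case (1 i g)
    then show ?thesis using corner_iff[OF \<tau> _ t, of 0] by (intro bexI[of _ g]) (simp_all add: corner_F2)
  next
    case (2 i g)
    then show ?thesis using corner_iff[OF \<tau> _ t, of 0] by (intro bexI[of _ g]) (simp_all add: corner_T2)
  qed
  have move: "\<forall>g\<in>carrier G. ?v (g \<otimes> x) \<in> U \<longleftrightarrow> ?v g \<in> U" if "x \<in> generate G (set gs)" for x
    using that
  proof (induction rule: generate.induct)
    case one
    then show ?case by simp
  next
    case (incl h)
    then obtain i where "i < L" "h = gs ! i" by (auto simp: in_set_conv_nth)
    then show ?case using step by simp
  next
    case (inv h)
    then obtain i where i: "i < L" "h = gs ! i" by (auto simp: in_set_conv_nth)
    show ?case
    proof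
      fix g assume g: "g \<in> carrier G"
      then have "g \<otimes> inv h \<otimes> gs ! i = g" using i by (simp add: m_assoc)
      then show "?v (g \<otimes> inv h) \<in> U \<longleftrightarrow> ?v g \<in> U" using step[of "g \<otimes> inv h" i] i g by simp
    qed
  next
    case (eng x y)
    have "set gs \<subseteq> carrier G" using elliptic by (simp add: elliptic_system_def)
    then have "x \<in> carrier G" "y \<in> carrier G"
      using eng generate_incl by blast+
    then show ?case using eng by (simp flip: m_assoc)
  qed
  have same: "?v g \<in> U \<longleftrightarrow> ?v h \<in> U" if "g \<in> carrier G" "h \<in> carrier G" for g h
  proof -
    have "inv g \<otimes> h \<in> generate G (set gs)" using that elliptic by (simp add: elliptic_system_def)
    moreover have "g \<otimes> (inv g \<otimes> h) = h" using that by (simp add: m_assoc[symmetric])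
    ultimately show ?thesis using move that(1) by metis
  qed
  show "U = {} \<or> U = topspace (realization Y)"
  proof (rule disjCI)
    assume ne: "U \<noteq> topspace (realization Y)"
    have sub: "U \<subseteq> topspace (realization Y)" using U openin_subset by blast
    then obtain Q where Q: "Q \<in> topspace (realization Y)" "Q \<notin> U" using ne by blast
    obtain \<tau> t where t: "\<tau> \<in> cells Y 2" "t \<in> standard_simplex 2" "Q = pt Y 2 \<tau> t"
      using point_in_triangle[OF Q(1)] .
    obtain h where h: "h \<in> carrier G" "?v h \<notin> U" using base[OF t(1,2)] Q(2) t(3) by blast
    have "P \<notin> U" for P
    proof
      assume P: "P \<in> U"
      obtain \<sigma> s where s: "\<sigma> \<in> cells Y 2" "s \<in> standard_simplex 2" "P = pt Y 2 \<sigma> s"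
        using point_in_triangle[of P] P sub by blast
      then show False using base[OF s(1,2)] P s(3) same h by blast
    qed
    then show "U = {}" by blast
  qed
qed

theorem compact_oriented_surface_Y: "compact_oriented_surface Y elliptic_orientation"
  unfolding compact_oriented_surface_def
proof (intro conjI)
  have "V0 \<one> \<in> cells Y 0" by (simp add: elliptic_cells_0)
  then show "surface (realization Y)" using surface[OF connected_Y] by blast
qed (use delta_Y dim orientation_Y compact in auto)

end

section \<open>Maps of elliptic surfaces induced by homomorphisms\<close>

lemma l_coset_image: "x <#\<^bsub>H\<^esub> S = (\<lambda>s. x \<otimes>\<^bsub>H\<^esub> s) ` S"
  by (auto simp: l_coset_def)

lemma vertex_cycle_cong:
  assumes "vertex_cycle X x N \<epsilon> T b c" and "\<And>j. j < N \<Longrightarrow> \<epsilon>' j = \<epsilon> j" and "\<And>j. j < N \<Longrightarrow> T' j = T j"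
  shows "vertex_cycle X x N \<epsilon>' T' b c"
proof -
  interpret vertex_cycle X x N \<epsilon> T b c by (rule assms(1))
  show ?thesis
  proof
    show "0 < N" by (rule N_pos)
    show "inj_on \<epsilon>' {..<N}" "inj_on T' {..<N}"
      using inj_edges inj_triangles assms(2,3) by (simp_all add: inj_on_def)
    show "\<exists>j<N. \<tau> = T' j" if "\<tau> \<in> cells X 2" "k \<le> 2" "corner X \<tau> k = x" for \<tau> k
      using all_triangles[OF that] assms(3) by auto
    fix j assume j: "j < N"
    show "T' j \<in> cells X 2" "b j \<le> 2 \<and> c j \<le> 2 \<and> b j \<noteq> c j"
      "corner X (T' j) (3 - b j - c j) = x" "face X (c j) (T' j) = \<epsilon>' j"
      "face X (b j) (T' j) = \<epsilon>' (Suc j mod N)"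
      using T_cells[OF j] bc[OF j] apex[OF j] left_edge[OF j] right_edge[OF j] N_pos
      by (simp_all add: assms(2,3) j)
  qed
qed

text \<open>A homomorphism that preserves the orders of the generators maps the cycle of triangles around each
  vertex bijectively; otherwise the map of surfaces would be branched at the vertices
  \<open>g\<close>\<^bold>\<open>c\<close>\<open>\<^sub>i\<close>.\<close>

locale unbranched_elliptic_map =
  D: elliptic_group D ds + G: elliptic_group G gs
  for D :: "('d, 'e) monoid_scheme" and ds :: "'d list" and G :: "('a, 'b) monoid_scheme" and gs :: "'a list" +
  fixes \<pi> :: "'d \<Rightarrow> 'a"
  assumes \<pi>_hom: "\<pi> \<in> hom D G" and \<pi>_surj: "\<pi> ` carrier D = carrier G"
    and length_ds: "length ds = length gs"
    and \<pi>_gen: "\<And>i. i < length gs \<Longrightarrow> \<pi> (ds ! i) = gs ! i"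
    and ord_gen: "\<And>i. i < length gs \<Longrightarrow> D.ord (ds ! i) = G.ord (gs ! i)"
begin

sublocale \<pi>: group_hom D G \<pi>
  using \<pi>_hom by (simp add: group_hom_def group_hom_axioms_def)

abbreviation p where "p \<equiv> elliptic_map \<pi>"

lemma \<pi>_coset:
  assumes "i < length gs" "h \<in> carrier D"
  shows "\<pi> ` D.coset i h = G.coset i (\<pi> h)"
proof -
  have d: "ds ! i \<in> carrier D" using assms length_ds by simp
  have "\<pi> ` generate D {ds ! i} = generate G {gs ! i}"
    using hom_image_generate[OF D.group_axioms G.group_axioms \<pi>_hom, of "{ds ! i}"] d \<pi>_gen[OF assms(1)] by simp
  moreover have "generate D {ds ! i} \<subseteq> carrier D" using d by (intro D.generate_incl) simp
  then have "\<pi> ` (\<lambda>s. h \<otimes>\<^bsub>D\<^esub> s) ` generate D {ds ! i} = (\<lambda>s. \<pi> h \<otimes>\<^bsub>G\<^esub> s) ` \<pi> ` generate D {ds ! i}"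
    unfolding image_image using assms(2) by (intro image_cong) auto
  ultimately show ?thesis by (simp add: l_coset_image)
qed

lemma \<pi>_tail: "\<pi> (D.tail_product i) = G.tail_product i"
proof -
  have "map \<pi> ds = gs" using length_ds \<pi>_gen by (intro nth_equalityI) auto
  moreover have "set (drop i ds) \<subseteq> carrier D"
    using D.elliptic set_drop_subset[of i ds] by (auto simp: elliptic_system_def)
  ultimately show ?thesis
    unfolding D.tail_product_def G.tail_product_def
    using hom_list_mult[OF D.group_axioms G.group_axioms \<pi>_hom, of "drop i ds"] by (simp flip: drop_map)
qed

lemma p_simplicial: "simplicial D.Y G.Y p"
  unfolding simplicial_def
proof (intro conjI allI ballI impI)
  fix n :: nat
  have "n = 0 \<or> n = 1 \<or> n = 2 \<or> 2 < n" by auto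
  then show "p ` cells D.Y n \<subseteq> cells G.Y n"
  proof (elim disjE)
    assume "n = 0"
    then show ?thesis
      by (auto simp: elliptic_cells_0 length_ds \<pi>_coset) (use \<pi>.hom_closed in blast)
  next
    assume "n = 1"
    then show ?thesis by (auto simp: elliptic_cells_1 length_ds)
  next
    assume "n = 2"
    then show ?thesis by (auto simp: elliptic_cells_2 length_ds)
  next
    assume "2 < n"
    then show ?thesis by (simp add: elliptic_cells_empty)
  qed
  fix \<sigma> k assume \<sigma>: "\<sigma> \<in> cells D.Y (Suc n)" and k: "k \<le> Suc n"
  have "n = 0 \<or> n = 1" using elliptic_cells_empty[of "Suc n" D ds] \<sigma> by fastforce
  then show "face G.Y k (p \<sigma>) = p (face D.Y k \<sigma>)"
  proof
    assume n: "n = 0"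
    then have "\<sigma> \<in> elliptic_cells D ds 1" using \<sigma> by (simp add: One_nat_def)
    then show ?thesis
      by (auto simp: elliptic_cells_1 length_ds \<pi>_gen \<pi>_coset \<pi>_tail)
  next
    assume n: "n = 1"
    then have "\<sigma> \<in> elliptic_cells D ds 2" using \<sigma> by (simp add: numeral_2_eq_2 One_nat_def)
    then show ?thesis
      by (auto simp: elliptic_cells_2 length_ds \<pi>_gen)
  qed
qed

lemma p_vertices: "p ` cells D.Y 0 = cells G.Y 0"
proof
  show "p ` cells D.Y 0 \<subseteq> cells G.Y 0" using p_simplicial unfolding simplicial_def by blast
  show "cells G.Y 0 \<subseteq> p ` cells D.Y 0"
  proof
    fix x assume "x \<in> cells G.Y 0"
    then show "x \<in> p ` cells D.Y 0"
    proof (cases rule: G.vertex_cases)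
      case (1 g)
      then obtain h where "h \<in> carrier D" "g = \<pi> h" using \<pi>_surj by blast
      then show ?thesis using 1 by (intro image_eqI[of _ _ "V0 h"]) (auto simp: elliptic_cells_0)
    next
      case (2 g)
      then obtain h where "h \<in> carrier D" "g = \<pi> h" using \<pi>_surj by blast
      then show ?thesis using 2 by (intro image_eqI[of _ _ "O0 h"]) (auto simp: elliptic_cells_0)
    next
      case (3 i g)
      then obtain h where "h \<in> carrier D" "g = \<pi> h" using \<pi>_surj by blast
      then show ?thesis using 3
        by (intro image_eqI[of _ _ "C0 i (D.coset i h)"]) (auto simp: elliptic_cells_0 \<pi>_coset length_ds)
    qed
  qed
qed

theorem covering: "covering_projection (realization D.Y) (realization G.Y) (realization_map G.Y p)"
proof (rule covering_projectionI[OF _ _ p_simplicial _ p_vertices])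
  show "closed_surface D.Y" by (rule D.closed_surface_axioms)
  show "triangulated G.Y" by (rule G.triangulated_axioms)
  fix x assume x: "x \<in> cells D.Y 0"
  have px: "p x \<in> cells G.Y 0" using p_vertices x by blast
  from x show "\<exists>N \<epsilon> T b c. vertex_cycle D.Y x N \<epsilon> T b c \<and> vertex_cycle G.Y (p x) N (p \<circ> \<epsilon>) (p \<circ> T) b c"
  proof (cases rule: D.vertex_cases)
    case (1 h)
    have div: "j div 4 < length gs" if "j < 4 * length gs" for j using that by linarith
    have "vertex_cycle G.Y (V0 (\<pi> h)) (4 * length gs) (p \<circ> D.v_edge h) (p \<circ> D.v_triangle h) v_right v_left"
      by (rule vertex_cycle_cong[OF G.v_cycle[of "\<pi> h"]])
        (use 1 div length_ds in \<open>auto simp: D.v_edge_def G.v_edge_def D.v_triangle_def G.v_triangle_def Let_def \<pi>_gen\<close>)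
    moreover have "vertex_cycle D.Y (V0 h) (4 * length gs) (D.v_edge h) (D.v_triangle h) v_right v_left"
      using D.v_cycle[OF 1(1)] length_ds by simp
    ultimately show ?thesis unfolding 1(2) elliptic_map.simps by blast
  next
    case (2 h)
    have "vertex_cycle G.Y (O0 (\<pi> h)) (length gs)
        (p \<circ> (\<lambda>i. S1 i (h \<otimes>\<^bsub>D\<^esub> inv\<^bsub>D\<^esub> D.tail_product i)))
        (p \<circ> (\<lambda>i. T2 i (h \<otimes>\<^bsub>D\<^esub> inv\<^bsub>D\<^esub> D.tail_product i))) (\<lambda>_. 0) (\<lambda>_. 1)"
      by (rule vertex_cycle_cong[OF G.o_cycle[of "\<pi> h"]]) (use 2 in \<open>auto simp: \<pi>_tail\<close>)
    then show ?thesis using D.o_cycle[OF 2(1)] unfolding 2(2) elliptic_map.simps length_ds by blast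
  next
    case (3 i h)
    have i: "i < length gs" using 3 length_ds by simp
    have "vertex_cycle G.Y (C0 i (G.coset i (\<pi> h))) (G.ord (gs ! i))
        (p \<circ> (\<lambda>k. R1 i (h \<otimes>\<^bsub>D\<^esub> ds ! i [^]\<^bsub>D\<^esub> k))) (p \<circ> (\<lambda>k. F2 i (h \<otimes>\<^bsub>D\<^esub> ds ! i [^]\<^bsub>D\<^esub> k))) (\<lambda>_. 0) (\<lambda>_. 1)"
      by (rule vertex_cycle_cong[OF G.c_cycle[OF i, of "\<pi> h"]])
        (use 3 i \<pi>_gen[OF i] in \<open>auto simp: \<pi>.hom_nat_pow\<close>)
    then show ?thesis using D.c_cycle[OF 3(1,2)]
      unfolding 3(3) elliptic_map.simps \<pi>_coset[OF i 3(2)] ord_gen[OF i] by blast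
  qed
qed

end

theorem theorem1p4:
  fixes G :: "('a, 'b) monoid_scheme"
  assumes "group G" and "finite (carrier G)"
  shows
    "(\<forall>gs \<phi>. elliptic_presentation G gs \<phi> \<longrightarrow>
       (let D = elliptic_central G gs \<phi>;
            ds = elliptic_central_system G gs \<phi>;
            W = elliptic_surface D ds;
            Y = elliptic_surface G gs;
            p = elliptic_map (elliptic_central_proj \<phi>)
        in group D \<and> elliptic_system D ds \<and>
           compact_oriented_surface W elliptic_orientation \<and>
           compact_oriented_surface Y elliptic_orientation \<and>
           simplicial W Y p \<and>
           covering_projection (realization W) (realization Y) (realization_map Y p))) \<and>
     (carrier G \<noteq> {\<one>\<^bsub>G\<^esub>} \<longrightarrow>
       (\<exists>gs \<phi>. elliptic_presentation G gs \<phi> \<and>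
          group_cover (elliptic_central_kernel G gs \<phi>) (elliptic_central G gs \<phi>) G
            (elliptic_central_proj \<phi>)))"
proof (intro conjI allI impI)
  fix gs \<phi> assume pres: "elliptic_presentation G gs \<phi>"
  interpret X: elliptic_extension G gs \<phi> by (rule elliptic_extension.intro[OF assms(1) pres])
  interpret G: elliptic_group G gs
    using assms X.elliptic by (simp add: elliptic_group_def elliptic_group_axioms_def)
  interpret D: elliptic_group X.D X.ds
    using X.group_D X.finite_D[OF assms(2)] X.elliptic_system_D
    by (simp add: elliptic_group_def elliptic_group_axioms_def)
  interpret p: unbranched_elliptic_map X.D X.ds G gs X.\<pi>
    by (intro unbranched_elliptic_map.intro unbranched_elliptic_map_axioms.intro
        D.elliptic_group_axioms G.elliptic_group_axioms)
      (simp_all add: X.proj_hom X.proj_surj X.proj_ds X.ord_ds)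
  show "let D = X.D; ds = X.ds; W = elliptic_surface D ds; Y = elliptic_surface G gs; p = elliptic_map X.\<pi>
    in group D \<and> elliptic_system D ds \<and>
       compact_oriented_surface W elliptic_orientation \<and>
       compact_oriented_surface Y elliptic_orientation \<and>
       simplicial W Y p \<and>
       covering_projection (realization W) (realization Y) (realization_map Y p)"
    unfolding Let_def
    using X.group_D X.elliptic_system_D D.compact_oriented_surface_Y G.compact_oriented_surface_Y
      p.p_simplicial p.covering by blast
next
  assume "carrier G \<noteq> {\<one>\<^bsub>G\<^esub>}"
  then show "\<exists>gs \<phi>. elliptic_presentation G gs \<phi> \<and>
      group_cover (elliptic_central_kernel G gs \<phi>) (elliptic_central G gs \<phi>) G (elliptic_central_proj \<phi>)"
    by (rule elliptic_cover_exists[OF assms])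
qed

end
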